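(* Let $\mathbf{T}=(T_t\colon t\ge 0)$ be a subordinator with the Lévy–Khintchine exponent $\psi$ and the Laplace exponent $\phi$. Suppose that $-\phi''\in\mathrm{WLSC}(\alpha-2,c,x_0)$ for some $c\in(0,1]$, $x_0\ge 0$, and $\alpha>0$. Assume also that the Lévy measure $\nu$ has an almost monotone density $\nu(x)$. Then the probability distribution of $T_t$ has a density $p(t,\cdot)$. Moreover, there is $C>0$ such that for all $t\in(0,1/\varphi(x_0))$ and $x\in\mathbb{R}$, $$p\big(t,x+t\,b_{1/\psi^{-1}(1/t)}\big)\le C\min\big\{\varphi^{-1}(1/t),\,t\,\eta(|x|)\big\}.$$ In particular, for all $t\in(0,1/\varphi(x_0))$ and $x\ge 2e\,t\,\phi'(\psi^{-1}(1/t))$, $$p(t,x+tb)\le C\min\big\{\varphi^{-1}(1/t),\,t\,\eta(x)\big\}.$$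
   Context: A subordinator is a one-dimensional Lévy process $\mathbf{T}=(T_t\colon t\ge 0)$ with $T_0=0$ and nondecreasing paths. Its Laplace exponent $\phi\colon[0,\infty)\to[0,\infty)$ is defined by $\mathbb{E}\,e^{-\lambda T_t}=e^{-t\phi(\lambda)}$, and $\phi(\lambda)=b\lambda+\int_{(0,\infty)}(1-e^{-\lambda s})\,\nu(\mathrm{d}s)$, where $b\ge 0$ and $\nu$ (the Lévy measure) satisfies $\int_{(0,\infty)}\min\{1,s\}\,\nu(\mathrm{d}s)<\infty$. Its Lévy–Khintchine exponent $\psi$ is given by $\mathbb{E}\,e^{i\xi T_t}=e^{-t\psi(\xi)}$, i.e. $\psi(\xi)=-i\xi b-\int_{(0,\infty)}(e^{i\xi x}-1)\,\nu(\mathrm{d}x)$. It is assumed that $\phi''\not\equiv 0$. $p(t,\cdot)$ denotes the continuous version of the density. For $\tau\in\mathbb{R}$, $c\in(0,1]$, $x_0\ge 0$, a nonnegative function $f$ on $(0,\infty)$ belongs to $\mathrm{WLSC}(\tau,c,x_0)$ if $f(\lambda x)\ge c\lambda^{\tau}f(x)$ for all $\lambda\ge 1$ and $x>x_0$. A function $f\ge0$ on $(0,\infty)$ is almost increasing if $cf(x)\le f(y)$ for all $y\ge x>0$ and some $c\in(0,1]$; almost decreasing if $Cf(x)\ge f(y)$ for all $y\ge x>0$ and some $C\ge1$; almost monotone means one of the two. Notation: $\varphi(x)=x^2(-\phi''(x))$ for $x>0$, $\varphi^*(r)=\sup_{0<x\le r}\varphi(x)$, $\varphi^{-1}(x)=\sup\{r>0\colon\varphi^*(r)=x\}$;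 $\psi^*(r)=\sup_{|z|\le r}\Re\psi(z)$ (real $z$), $\psi^{-1}(s)=\sup\{r>0\colon\psi^*(r)=s\}$; $b_r=b+\int_{(0,r)}s\,\nu(\mathrm{d}s)$ for $r>0$. The function $\eta\colon[0,\infty)\to[0,\infty]$ is defined by $\eta(0)=\infty$, $\eta(s)=s^{-1}\varphi^*(1/s)$ if $0<s\le x_0^{-1}$, and $\eta(s)=A\,s^{-1}\phi(1/s)$ if $s>x_0^{-1}$, where $A=\varphi^*(x_0)/\phi(x_0)\in(0,2]$. Conventions when $x_0=0$: $x_0^{-1}=\infty$, $\varphi(x_0)=0$ and $1/\varphi(x_0)=\infty$ (so only the first formula for $\eta$ on $(0,\infty)$ is used). *)

theory Defs
  imports "HOL-Probability.Probability"
begin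

section \<open>Subordinators\<close>

definition cadlag :: "(real \<Rightarrow> real) \<Rightarrow> bool" where
  "cadlag f \<longleftrightarrow> (\<forall>t\<ge>0. (f \<longlongrightarrow> f t) (at_right t)) \<and> (\<forall>t>0. \<exists>l. (f \<longlongrightarrow> l) (at_left t))"

text \<open>Path properties are required almost surely, and only times \<open>t \<ge> 0\<close> matter. Stochastic
  continuity is not listed because it follows from stationarity and right-continuity.\<close>

locale levy_process = prob_space M for M :: "'a measure" +
  fixes X :: "real \<Rightarrow> 'a \<Rightarrow> real"
  assumes measurable_X: "0 \<le> t \<Longrightarrow> X t \<in> borel_measurable M"
    and start_zero: "AE \<omega> in M. X 0 \<omega> = 0"
    and indep_increments:
      "\<lbrakk>0 \<le> \<tau> 0; \<And>i. i < n \<Longrightarrow> \<tau> i \<le> \<tau> (Suc i)\<rbrakk> \<Longrightarrow>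
         indep_vars (\<lambda>_. borel) (\<lambda>i \<omega>. X (\<tau> (Suc i)) \<omega> - X (\<tau> i) \<omega>) {..<n::nat}"
    and stationary_increments:
      "\<lbrakk>0 \<le> s; 0 \<le> h\<rbrakk> \<Longrightarrow> distr M borel (\<lambda>\<omega>. X (s + h) \<omega> - X s \<omega>) = distr M borel (X h)"
    and cadlag_paths: "AE \<omega> in M. cadlag (\<lambda>t. X t \<omega>)"

locale subordinator = levy_process M T
  for M :: "'a measure" and T :: "real \<Rightarrow> 'a \<Rightarrow> real" +
  assumes nondecreasing_paths: "AE \<omega> in M. mono_on {0..} (\<lambda>t. T t \<omega>)"

definition is_laplace_exponent :: "'a measure \<Rightarrow> (real \<Rightarrow> 'a \<Rightarrow> real) \<Rightarrow> (real \<Rightarrow> real) \<Rightarrow> bool" where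
  "is_laplace_exponent M T \<phi> \<longleftrightarrow>
     (\<forall>t\<ge>0. \<forall>u\<ge>0. (LINT \<omega>|M. exp (- u * T t \<omega>)) = exp (- t * \<phi> u))"

text \<open>Since the identity holds for all \<open>t \<ge> 0\<close>, it determines the complex number \<open>\<psi> \<xi>\<close>
  uniquely: no branch of the logarithm has to be chosen.\<close>

definition is_levy_khintchine_exponent ::
    "'a measure \<Rightarrow> (real \<Rightarrow> 'a \<Rightarrow> real) \<Rightarrow> (real \<Rightarrow> complex) \<Rightarrow> bool" where
  "is_levy_khintchine_exponent M T \<psi> \<longleftrightarrow>
     (\<forall>t\<ge>0. \<forall>\<xi>. (CLINT \<omega>|M. iexp (\<xi> * T t \<omega>)) = exp (- complex_of_real t * \<psi> \<xi>))"

text \<open>A measure on \<open>(0, \<infinity>)\<close> is represented by a Borel measure on the real line that does not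
  charge \<open>(-\<infinity>, 0]\<close>.\<close>

definition subordinator_levy_measure :: "real measure \<Rightarrow> bool" where
  "subordinator_levy_measure \<nu> \<longleftrightarrow>
     sets \<nu> = sets borel \<and> emeasure \<nu> {..0} = 0 \<and>
     (\<integral>\<^sup>+ s\<in>{0<..}. ennreal (min 1 s) \<partial>\<nu>) < \<infinity>"

definition has_characteristics ::
    "(real \<Rightarrow> real) \<Rightarrow> (real \<Rightarrow> complex) \<Rightarrow> real \<Rightarrow> real measure \<Rightarrow> bool" where
  "has_characteristics \<phi> \<psi> b \<nu> \<longleftrightarrow>
     0 \<le> b \<and> subordinator_levy_measure \<nu> \<and>
     (\<forall>u\<ge>0. \<phi> u = b * u + (LINT s:{0<..}|\<nu>. 1 - exp (- u * s))) \<and>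
     (\<forall>\<xi>. \<psi> \<xi> = - \<i> * complex_of_real \<xi> * complex_of_real b
               - (CLINT s:{0<..}|\<nu>. iexp (\<xi> * s) - 1))"

definition has_levy_density :: "real measure \<Rightarrow> (real \<Rightarrow> real) \<Rightarrow> bool" where
  "has_levy_density \<nu> n \<longleftrightarrow>
     set_borel_measurable borel {0<..} n \<and> (\<forall>x>0. 0 \<le> n x) \<and>
     \<nu> = density lborel (\<lambda>x. ennreal (indicator {0<..} x * n x))"


section \<open>Scaling and almost monotonicity on the positive half-line\<close>

definition WLSC :: "real \<Rightarrow> real \<Rightarrow> real \<Rightarrow> (real \<Rightarrow> real) \<Rightarrow> bool" where
  "WLSC \<tau> c x0 f \<longleftrightarrow>
     0 < c \<and> c \<le> 1 \<and> 0 \<le> x0 \<and> (\<forall>x>0. 0 \<le> f x) \<and>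
     (\<forall>l\<ge>1. \<forall>x>x0. c * l powr \<tau> * f x \<le> f (l * x))"

definition almost_increasing :: "(real \<Rightarrow> real) \<Rightarrow> bool" where
  "almost_increasing f \<longleftrightarrow>
     (\<forall>x>0. 0 \<le> f x) \<and> (\<exists>c. 0 < c \<and> c \<le> 1 \<and> (\<forall>x>0. \<forall>y\<ge>x. c * f x \<le> f y))"

definition almost_decreasing :: "(real \<Rightarrow> real) \<Rightarrow> bool" where
  "almost_decreasing f \<longleftrightarrow>
     (\<forall>x>0. 0 \<le> f x) \<and> (\<exists>C\<ge>1. \<forall>x>0. \<forall>y\<ge>x. f y \<le> C * f x)"

definition almost_monotone :: "(real \<Rightarrow> real) \<Rightarrow> bool" where
  "almost_monotone f \<longleftrightarrow> almost_increasing f \<or> almost_decreasing f"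


section \<open>Functions derived from the exponents\<close>

text \<open>In each definition \<open>\<phi>\<close> is the Laplace exponent; \<open>vphi\<close> is the function usually written
  \<open>\<varphi>\<close>. The suprema are taken in the reals. For a Laplace exponent and a
  Levy--Khintchine exponent of a subordinator those in \<open>vphi_star\<close> (\<open>r > 0\<close>) and \<open>psi_star\<close>
  (\<open>r \<ge> 0\<close>) are over nonempty bounded sets; if moreover \<open>vphi\<close> is not bounded, the
  same is true of the generalised inverses at every positive argument.\<close>

definition vphi :: "(real \<Rightarrow> real) \<Rightarrow> real \<Rightarrow> real" where
  "vphi \<phi> x = x\<^sup>2 * (- deriv (deriv \<phi>) x)"

definition vphi_star :: "(real \<Rightarrow> real) \<Rightarrow> real \<Rightarrow> real" where
  "vphi_star \<phi> r = (SUP x\<in>{0<..r}. vphi \<phi> x)"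

definition vphi_inv :: "(real \<Rightarrow> real) \<Rightarrow> real \<Rightarrow> real" where
  "vphi_inv \<phi> s = Sup {r. 0 < r \<and> vphi_star \<phi> r = s}"

definition psi_star :: "(real \<Rightarrow> complex) \<Rightarrow> real \<Rightarrow> real" where
  "psi_star \<psi> r = (SUP z\<in>{z. \<bar>z\<bar> \<le> r}. Re (\<psi> z))"

definition psi_inv :: "(real \<Rightarrow> complex) \<Rightarrow> real \<Rightarrow> real" where
  "psi_inv \<psi> s = Sup {r. 0 < r \<and> psi_star \<psi> r = s}"

definition trunc_drift :: "real \<Rightarrow> real measure \<Rightarrow> real \<Rightarrow> real" where
  "trunc_drift b \<nu> r = b + (LINT s:{0<..<r}|\<nu>. s)"

text \<open>The value \<open>x0 = 0\<close> follows the convention \<open>1 / x0 = \<infinity>\<close>, so that the last branch is then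
  never taken; likewise \<open>1 / vphi \<phi> x0 = \<infinity>\<close> in \<open>time_bound\<close>. (In HOL, \<open>1 / 0 = 0\<close>.)\<close>

definition eta :: "(real \<Rightarrow> real) \<Rightarrow> real \<Rightarrow> real \<Rightarrow> ereal" where
  "eta \<phi> x0 s =
     (if s = 0 then \<infinity>
      else if x0 = 0 \<or> s \<le> 1 / x0 then ereal (vphi_star \<phi> (1 / s) / s)
      else ereal (vphi_star \<phi> x0 / \<phi> x0 * (\<phi> (1 / s) / s)))"

definition time_bound :: "(real \<Rightarrow> real) \<Rightarrow> real \<Rightarrow> ereal" where
  "time_bound \<phi> x0 = (if x0 = 0 then \<infinity> else ereal (1 / vphi \<phi> x0))"

text \<open>Continuity makes the density \<open>p t\<close> unique.\<close>

definition continuous_densities ::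
    "'a measure \<Rightarrow> (real \<Rightarrow> 'a \<Rightarrow> real) \<Rightarrow> (real \<Rightarrow> real \<Rightarrow> real) \<Rightarrow> bool" where
  "continuous_densities M T p \<longleftrightarrow>
     (\<forall>t>0. continuous_on UNIV (p t) \<and> (\<forall>x. 0 \<le> p t x) \<and>
            distributed M lborel (T t) (\<lambda>x. ennreal (p t x)))"

end

theory Submission
  imports Defs "HOL-Real_Asymp.Real_Asymp"
begin

text \<open>
  Write \<open>u = \<psi>\<^sup>-\<^sup>1(1/t)\<close> and cut the jumps at the length \<open>1/u\<close>, at which
  \<open>t \<integral> min 1 ((u s)\<^sup>2) \<nu>(ds)\<close> is comparable to \<open>1\<close>. By Fourier inversion
  \<open>p t\<close>, centred at \<open>t\<close> times the truncated drift, is an exponential series of convolutions of the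
  jumps longer than \<open>1/u\<close> with a function \<open>F\<^sub>0\<close> whose Fourier transform
  is the exponential of minus the compensated exponent of the short jumps. Three
  integrations by parts bound \<open>F\<^sub>0(x)\<close> by \<open>u / (1 + (u |x|)\<^sup>3)\<close>, which
  is at most a multiple of \<open>t \<eta>(|x|)\<close> because \<open>\<eta>\<close> decays no faster than
  \<open>|x|\<^sup>-\<^sup>3\<close>. Almost monotonicity of \<open>\<nu>\<close> gives \<open>\<nu>(x) \<le> C \<eta>(x)\<close>, and since
  \<open>\<eta>\<close> is decreasing and doubling, a convolution with the long jumps
  preserves a bound by \<open>t \<eta>\<close>: of two summands of \<open>x\<close> one is at least \<open>|x|/2\<close>.
  The weak scaling condition makes \<open>\<phi>\<^sup>*\<close>, \<open>\<psi>\<^sup>*\<close> and \<open>\<integral> min 1 ((u s)\<^sup>2) \<nu>(ds)\<close>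
  comparable and forces the decay of the characteristic function.
\<close>

section \<open>Fourier inversion for integrable characteristic functions\<close>

text \<open>The constant must be uniform in \<open>t\<close>. Hence every estimate is made after
  rescaling by \<open>u\<close>, where only the quantity \<open>t * h u\<close> is left, bounded
  above and below. It controls the moments of the short jumps of order two and more, but not the
  first one: this is why the density is centred at the truncated drift. Cubic decay is what matches
  \<open>\<eta>\<close>: \<open>Vs\<close> grows at most quadratically, and \<open>\<eta>\<close>
  divides it by one more power of |x|. Bounding \<open>V\<close> and \<open>\<rho>\<close> by
  \<open>h\<close> is a pointwise matter. The converses are the real work: \<open>h\<close> by
  \<open>V\<close> integrates the tail using the bound on the density and scaling, and
  \<open>V\<close> by \<open>\<rho>\<close> must cope with the zeros of \<open>1 - cos\<close>, by
  moving to a larger argument and absorbing an error. The generalised inverses are suprema that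
  might not be attained. No continuity of the running suprema is used, only a point of first passage
  and an element above half the supremum.\<close>

lemma has_vector_derivative_integral_dominated:
  fixes f f' :: "real \<Rightarrow> 'a \<Rightarrow> 'b::{banach, second_countable_topology}"
  assumes "0 < e"
    and int: "\<And>x. x \<in> ball x0 e \<Longrightarrow> integrable M (f x)"
    and der: "\<And>x s. x \<in> ball x0 e \<Longrightarrow> ((\<lambda>x. f x s) has_vector_derivative f' x s) (at x)"
    and bd: "\<And>x s. x \<in> ball x0 e \<Longrightarrow> norm (f' x s) \<le> g s"
    and g: "integrable M g"
    and meas: "f' x0 \<in> borel_measurable M"
  shows "((\<lambda>x. \<integral>s. f x s \<partial>M) has_vector_derivative (\<integral>s. f' x0 s \<partial>M)) (at x0)"
proof -
  let ?F = "\<lambda>x. \<integral>s. f x s \<partial>M" and ?L = "\<integral>s. f' x0 s \<partial>M"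
  \<comment> \<open>The mean value inequality on the ball makes \<open>g\<close> a majorant of all
    difference quotients, so dominated convergence applies along any sequence tending to
    \<open>x0\<close>.\<close>
  have lip: "norm (f y s - f x0 s) \<le> g s * \<bar>y - x0\<bar>" if "y \<in> ball x0 e" for y s
  proof -
    have "norm (f y s - f x0 s) \<le> g s * norm (y - x0)"
    proof (rule differentiable_bound[where S="ball x0 e" and f'="\<lambda>x h. h *\<^sub>R f' x s"])
      show "((\<lambda>x. f x s) has_derivative (\<lambda>h. h *\<^sub>R f' x s)) (at x within ball x0 e)" if "x \<in> ball x0 e" for x
        using has_vector_derivative_at_within[OF der[OF that]] by (simp add: has_vector_derivative_def)
      show "onorm (\<lambda>h. h *\<^sub>R f' x s) \<le> g s" if "x \<in> ball x0 e" for x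
        by (rule onorm_le) (use bd[OF that, of s] in \<open>simp add: mult.commute mult_right_mono mult_left_mono\<close>)
    qed (use that assms(1) in auto)
    then show ?thesis by simp
  qed
  have lim: "((\<lambda>y. (1 / (y - x0)) *\<^sub>R (?F y - ?F x0)) \<longlongrightarrow> ?L) (at x0)"
  proof (subst tendsto_at_iff_sequentially, intro allI impI)
    fix X :: "nat \<Rightarrow> real"
    assume X: "\<forall>i. X i \<in> UNIV - {x0}" "X \<longlonglongrightarrow> x0"
    then obtain N where N: "\<And>n. n \<ge> N \<Longrightarrow> X n \<in> ball x0 e"
      using assms(1) by (metis dist_commute lim_sequentially mem_ball)
    have "(\<lambda>n. \<integral>s. (1 / (X (n + N) - x0)) *\<^sub>R (f (X (n + N)) s - f x0 s) \<partial>M) \<longlonglongrightarrow> ?L"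
    proof (rule integral_dominated_convergence[where w=g])
      show "AE s in M. (\<lambda>n. (1 / (X (n + N) - x0)) *\<^sub>R (f (X (n + N)) s - f x0 s)) \<longlonglongrightarrow> f' x0 s"
      proof (rule AE_I2)
        fix s
        have "((\<lambda>y. (1 / (y - x0)) *\<^sub>R (f y s - f x0 s)) \<longlongrightarrow> f' x0 s) (at x0)"
        proof -
          have "((\<lambda>y. norm (f y s - f x0 s - (y - x0) *\<^sub>R f' x0 s) / norm (y - x0)) \<longlongrightarrow> 0) (at x0)"
            using der[of x0 s] assms(1) unfolding has_vector_derivative_def has_derivative_iff_norm by auto
          then have "((\<lambda>y. norm ((1 / (y - x0)) *\<^sub>R (f y s - f x0 s) - f' x0 s)) \<longlongrightarrow> 0) (at x0)"
          proof (rule Lim_transform_eventually)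
            show "\<forall>\<^sub>F y in at x0. norm (f y s - f x0 s - (y - x0) *\<^sub>R f' x0 s) / norm (y - x0)
              = norm ((1 / (y - x0)) *\<^sub>R (f y s - f x0 s) - f' x0 s)"
            proof (rule eventually_at_filter[THEN iffD2], rule always_eventually, intro allI impI)
              fix y assume "y \<noteq> x0"
              then have "(1 / (y - x0)) *\<^sub>R (f y s - f x0 s) - f' x0 s
                 = (1 / (y - x0)) *\<^sub>R (f y s - f x0 s - (y - x0) *\<^sub>R f' x0 s)"
                by (simp add: scaleR_diff_right)
              then show "norm (f y s - f x0 s - (y - x0) *\<^sub>R f' x0 s) / norm (y - x0)
                = norm ((1 / (y - x0)) *\<^sub>R (f y s - f x0 s) - f' x0 s)"
                by simp
            qed
          qed
          then show ?thesis using LIM_zero_cancel tendsto_norm_zero_iff by blast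
        qed
        moreover have "(\<lambda>n. X (n + N)) \<longlonglongrightarrow> x0" using X(2) by (simp add: LIMSEQ_ignore_initial_segment)
        ultimately show "(\<lambda>n. (1 / (X (n + N) - x0)) *\<^sub>R (f (X (n + N)) s - f x0 s)) \<longlonglongrightarrow> f' x0 s"
          using X(1) unfolding tendsto_at_iff_sequentially o_def by (elim allE[where x="\<lambda>n. X (n + N)"]) auto
      qed
      show "AE s in M. norm ((1 / (X (n + N) - x0)) *\<^sub>R (f (X (n + N)) s - f x0 s)) \<le> g s" for n
        using lip[OF N[of "n + N"]] X(1) by (auto simp: divide_simps mult.commute)
      show "(\<lambda>s. (1 / (X (n + N) - x0)) *\<^sub>R (f (X (n + N)) s - f x0 s)) \<in> borel_measurable M" for n
        using int[OF N[of "n + N"]] int[of x0] assms(1) by (auto intro!: borel_measurable_scaleR borel_measurable_diff borel_measurable_integrable)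
    qed (use meas g in auto)
    moreover have "(\<integral>s. (1 / (X (n + N) - x0)) *\<^sub>R (f (X (n + N)) s - f x0 s) \<partial>M)
        = (1 / (X (n + N) - x0)) *\<^sub>R (?F (X (n + N)) - ?F x0)" for n
      using int[OF N[of "n + N"]] int[of x0] assms(1) by simp
    ultimately have "(\<lambda>n. (1 / (X (n + N) - x0)) *\<^sub>R (?F (X (n + N)) - ?F x0)) \<longlonglongrightarrow> ?L" by (simp only:)
    then show "((\<lambda>y. (1 / (y - x0)) *\<^sub>R (?F y - ?F x0)) \<circ> X) \<longlonglongrightarrow> ?L"
      unfolding o_def by (rule LIMSEQ_offset)
  qed
  then have "((\<lambda>y. norm ((1 / (y - x0)) *\<^sub>R (?F y - ?F x0) - ?L)) \<longlongrightarrow> 0) (at x0)"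
    by (simp add: LIM_zero tendsto_norm_zero)
  then have "((\<lambda>y. norm (?F y - ?F x0 - (y - x0) *\<^sub>R ?L) / norm (y - x0)) \<longlongrightarrow> 0) (at x0)"
  proof (rule Lim_transform_eventually)
    show "\<forall>\<^sub>F y in at x0. norm ((1 / (y - x0)) *\<^sub>R (?F y - ?F x0) - ?L)
        = norm (?F y - ?F x0 - (y - x0) *\<^sub>R ?L) / norm (y - x0)"
    proof (rule eventually_at_filter[THEN iffD2], rule always_eventually, intro allI impI)
      fix y assume "y \<noteq> x0"
      then have "(1 / (y - x0)) *\<^sub>R (?F y - ?F x0) - ?L
         = (1 / (y - x0)) *\<^sub>R (?F y - ?F x0 - (y - x0) *\<^sub>R ?L)"
        by (simp add: scaleR_diff_right)
      then show "norm ((1 / (y - x0)) *\<^sub>R (?F y - ?F x0) - ?L)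
        = norm (?F y - ?F x0 - (y - x0) *\<^sub>R ?L) / norm (y - x0)"
        by simp
    qed
  qed
  then show ?thesis
    unfolding has_vector_derivative_def has_derivative_iff_norm by (auto intro: bounded_linear_scaleR_left)
qed

lemma iexp_difference_quotient_eq_integral:
  fixes a b t :: real
  assumes "a \<le> b" "t \<noteq> 0"
  shows "(CLINT x|lborel. indicator {a..b} x *\<^sub>R iexp (-(t * x))) = (iexp (-(t * a)) - iexp (-(t * b))) / (\<i> * t)"
proof -
  have "(CLINT x|lborel. indicator {a..b} x *\<^sub>R iexp (-(t * x)))
      = \<i> / t * iexp (-(t * b)) - \<i> / t * iexp (-(t * a))"
  proof (rule integral_FTC_atLeastAtMost[OF assms(1)])
    fix x
    show "((\<lambda>x. \<i> / t * iexp (-(t * x))) has_vector_derivative iexp (-(t * x))) (at x within {a..b})"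
    proof -
      have "((\<lambda>z. \<i> / t * exp (- (\<i> * t * z))) has_field_derivative exp (- (\<i> * t * of_real x))) (at (of_real x))"
        using assms(2) by (auto intro!: derivative_eq_intros simp: field_simps)
      from has_vector_derivative_real_field[OF this, of "{a..b}"] show ?thesis
        by (simp add: mult_ac)
    qed
  qed (intro continuous_intros)
  also have "\<dots> = (iexp (-(t * a)) - iexp (-(t * b))) / (\<i> * t)"
    using assms(2) by (simp add: field_simps)
  finally show ?thesis .
qed

text \<open>The inverse Fourier transform. The real part only fixes the type: for the characteristic
  function of a law on the line the integral is real by symmetry.\<close>

definition fourier_density :: "(real \<Rightarrow> complex) \<Rightarrow> real \<Rightarrow> real" where
  "fourier_density ch x = Re (CLINT t|lborel. iexp (-(t * x)) * ch t) / (2 * pi)"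

lemma continuous_fourier_integral:
  fixes ch :: "real \<Rightarrow> complex"
  assumes ch: "integrable lborel ch"
  shows "continuous_on UNIV (\<lambda>x. CLINT t|lborel. iexp (-(t * x)) * ch t)"
proof (rule continuous_at_imp_continuous_on, rule ballI)
  fix x :: real
  have [measurable]: "ch \<in> borel_measurable borel" using ch by (simp add: borel_measurable_integrable)
  show "isCont (\<lambda>x. CLINT t|lborel. iexp (-(t * x)) * ch t) x"
    unfolding continuous_at_sequentially o_def
  proof (intro allI impI)
    fix X assume X: "X \<longlonglongrightarrow> x"
    show "(\<lambda>n. CLINT t|lborel. iexp (-(t * X n)) * ch t) \<longlonglongrightarrow> (CLINT t|lborel. iexp (-(t * x)) * ch t)"
      by (rule integral_dominated_convergence[where w="\<lambda>t. norm (ch t)"])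
         (use ch X in \<open>auto simp: norm_mult intro!: AE_I2 tendsto_intros\<close>)
  qed
qed

context real_distribution begin

text \<open>Levy inversion gives the mass of an interval as a limit of truncated integrals.
  Integrability makes the integral over the whole line converge absolutely, and Fubini turns the
  difference quotient of exponentials into an integral over the interval.\<close>

lemma measure_interval_integrable_char:
  assumes ch: "integrable lborel (char M)" and ab: "a \<le> b" "measure M {a} = 0" "measure M {b} = 0"
  shows "measure M {a<..b} = (LINT x|lborel. indicator {a..b} x * fourier_density (char M) x)"
proof -
  let ?I = "\<lambda>t. (iexp (-(t * a)) - iexp (-(t * b))) / (\<i> * t) * char M t"
  let ?G = "\<lambda>t x. indicator {a..b} x *\<^sub>R (iexp (-(t * x)) * char M t)"
  have nI: "norm (?I t) \<le> (b - a) * norm (char M t)" for t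
  \<comment> \<open>At \<open>t = 0\<close> division by zero gives the value 0, so the bound holds
    there as well.\<close>
  proof (cases "t = 0")
    case False
    show ?thesis unfolding norm_mult
      by (rule mult_right_mono) (use Levy_Inversion_aux2[of "-b" "-a" t] False ab in auto)
  qed (use ab in auto)
  have intI: "integrable lborel ?I"
    by (rule Bochner_Integration.integrable_bound[of _ "\<lambda>t. (b - a) * norm (char M t)"])
       (use ch nI ab in \<open>auto intro!: AE_I2\<close>)
  have "(\<lambda>T. CLBINT t=-real T..real T. ?I t) \<longlonglongrightarrow> (CLINT t|lborel. ?I t)"
  proof -
    have "(\<lambda>T. CLINT t|lborel. indicator {-real T<..<real T} t *\<^sub>R ?I t) \<longlonglongrightarrow> (CLINT t|lborel. ?I t)"
    proof (rule integral_dominated_convergence[where w="\<lambda>t. norm (?I t)"])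
      show "AE t in lborel. (\<lambda>T. indicator {-real T<..<real T} t *\<^sub>R ?I t) \<longlonglongrightarrow> ?I t"
      proof (rule AE_I2)
        fix t :: real
        obtain N :: nat where "\<bar>t\<bar> < N" using reals_Archimedean2 by blast
        then have "\<forall>\<^sub>F T in sequentially. indicator {-real T<..<real T} t *\<^sub>R ?I t = ?I t"
          by (intro eventually_sequentiallyI[of N]) (auto simp: indicator_def)
        then show "(\<lambda>T. indicator {-real T<..<real T} t *\<^sub>R ?I t) \<longlonglongrightarrow> ?I t"
          by (rule tendsto_eventually)
      qed
    qed (use intI in \<open>auto simp: indicator_def intro!: AE_I2\<close>)
    then show ?thesis
      by (simp add: interval_lebesgue_integral_def set_lebesgue_integral_def)
  qed
  then have "(\<lambda>T. 1 / (2 * pi) * (CLBINT t=-real T..real T. ?I t)) \<longlonglongrightarrow> 1 / (2 * pi) * (CLINT t|lborel. ?I t)"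
    by (intro tendsto_intros)
  then have eq: "complex_of_real (measure M {a<..b}) = 1 / (2 * pi) * (CLINT t|lborel. ?I t)"
    by (rule LIMSEQ_unique[OF Levy_Inversion[OF ab, unfolded of_int_minus of_int_of_nat_eq]])
  have intG: "integrable (lborel \<Otimes>\<^sub>M lborel) (\<lambda>(t, x). ?G t x)"
  proof (rule lborel_pair.Fubini_integrable)
    show "(\<lambda>(t, x). ?G t x) \<in> borel_measurable (lborel \<Otimes>\<^sub>M lborel)"
      by measurable
    have "(LINT x|lborel. norm (?G t x)) = (b - a) * norm (char M t)" for t
      using ab by (simp add: norm_mult)
    then show "integrable lborel (\<lambda>t. LINT x|lborel. norm (case (t, x) of (t, x) \<Rightarrow> ?G t x))"
      using ch by simp
    show "AE t in lborel. integrable lborel (\<lambda>x. case (t, x) of (t, x) \<Rightarrow> ?G t x)"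
      by (rule AE_I2) (auto intro!: borel_integrable_compact[unfolded set_integrable_def] continuous_intros)
  qed
  have "(CLINT t|lborel. ?I t) = (CLINT t|lborel. CLINT x|lborel. ?G t x)"
  proof (rule integral_cong_AE)
    show "AE t in lborel. ?I t = (CLINT x|lborel. ?G t x)"
    proof (rule AE_mp[OF AE_lborel_singleton[of 0]], rule AE_I2, rule impI)
      fix t :: real assume "t \<noteq> 0"
      have "(CLINT x|lborel. ?G t x) = (CLINT x|lborel. (indicator {a..b} x *\<^sub>R iexp (-(t * x))) * char M t)"
        by (simp add: scaleR_conv_of_real mult.assoc)
      also have "\<dots> = ?I t"
        by (simp only: integral_mult_left_zero iexp_difference_quotient_eq_integral[OF ab(1) \<open>t \<noteq> 0\<close>])
      finally show "?I t = (CLINT x|lborel. ?G t x)" by simp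
    qed
  qed measurable
  also have "\<dots> = (CLINT x|lborel. CLINT t|lborel. ?G t x)"
    using lborel_pair.Fubini_integral[OF intG] by simp
  finally have "(CLINT t|lborel. ?I t) = (CLINT x|lborel. CLINT t|lborel. ?G t x)" .
  also have "\<dots> = (CLINT x|lborel. indicator {a..b} x *\<^sub>R (CLINT t|lborel. iexp (-(t * x)) * char M t))"
    by (simp add: integral_scaleR_right)
  finally have e2: "(CLINT t|lborel. ?I t) = (CLINT x|lborel. indicator {a..b} x *\<^sub>R (CLINT t|lborel. iexp (-(t * x)) * char M t))" .
  have i3: "integrable lborel (\<lambda>x. indicator {a..b} x *\<^sub>R (CLINT t|lborel. iexp (-(t * x)) * char M t))"
    by (intro borel_integrable_compact[unfolded set_integrable_def] compact_Icc continuous_on_subset[OF continuous_fourier_integral[OF ch]]) auto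
  have "measure M {a<..b} = Re (1 / (2 * pi) * (CLINT t|lborel. ?I t))"
    by (metis eq Re_complex_of_real)
  also have "\<dots> = Re (CLINT x|lborel. indicator {a..b} x *\<^sub>R (CLINT t|lborel. iexp (-(t * x)) * char M t)) / (2 * pi)"
    unfolding e2 by (simp add: Re_divide_of_real[of _ "2*pi", simplified])
  also have "\<dots> = (LINT x|lborel. Re (indicator {a..b} x *\<^sub>R (CLINT t|lborel. iexp (-(t * x)) * char M t)) / (2 * pi))"
    unfolding integral_divide_zero integral_Re[OF i3] ..
  also have "\<dots> = (LINT x|lborel. indicator {a..b} x * fourier_density (char M) x)"
    by (simp add: fourier_density_def)
  finally show ?thesis .
qed

text \<open>Every interval around an atom has at least the mass of the atom, whereas the inversion
  formula bounds the mass of an interval by a multiple of its length. Endpoints without mass exist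
  because there are at most countably many atoms.\<close>

lemma integrable_char_no_atoms:
  assumes ch: "integrable lborel (char M)"
  shows "measure M {x} = 0"
proof (rule ccontr)
  assume "measure M {x} \<noteq> 0"
  then have pos: "0 < measure M {x}" using measure_nonneg[of M "{x}"] by linarith
  have cnt: "countable {y. measure M {y} \<noteq> 0}" by (rule countable_support)
  define K where "K = (LINT t|lborel. norm (char M t)) / (2 * pi)"
  have K: "\<bar>fourier_density (char M) y\<bar> \<le> K" for y
  proof -
    have "\<bar>Re (CLINT t|lborel. iexp (-(t * y)) * char M t)\<bar> \<le> norm (CLINT t|lborel. iexp (-(t * y)) * char M t)"
      by (rule abs_Re_le_cmod)
    also have "\<dots> \<le> (LINT t|lborel. norm (iexp (-(t * y)) * char M t))" by (rule integral_norm_bound)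
    finally show ?thesis unfolding fourier_density_def K_def by (simp add: norm_mult divide_right_mono)
  qed
  have "0 \<le> K" using K[of 0] by linarith
  \<comment> \<open>An interval of length at most \<open>2 * d\<close> then has at most half the
    mass of the atom; \<open>K + 1\<close> keeps the denominator positive.\<close>
  define d where "d = measure M {x} / (4 * (K + 1))"
  have "0 < d" unfolding d_def using pos \<open>0 \<le> K\<close> by simp
  obtain a where a: "a \<in> {x - d<..<x}" "a \<notin> {y. measure M {y} \<noteq> 0}"
    using real_interval_avoid_countable_set[of "x - d" x, OF _ cnt] \<open>0 < d\<close> by auto
  obtain b where b: "b \<in> {x<..<x + d}" "b \<notin> {y. measure M {y} \<noteq> 0}"
    using real_interval_avoid_countable_set[of x "x + d", OF _ cnt] \<open>0 < d\<close> by auto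
  have "measure M {x} \<le> measure M {a<..b}" using a b by (intro finite_measure_mono) auto
  also have "\<dots> = (LINT y|lborel. indicator {a..b} y * fourier_density (char M) y)"
    using a b by (intro measure_interval_integrable_char[OF ch]) auto
  also have "\<dots> \<le> (LINT y|lborel. indicator {a..b} y * K)"
  proof (rule integral_mono')
    show "integrable lborel (\<lambda>y. indicator {a..b} y * K)"
      by (intro integrable_mult_left integrable_real_indicator) (auto simp: emeasure_lborel_Icc_eq)
    show "\<And>y. indicator {a..b} y * fourier_density (char M) y \<le> indicator {a..b} y * K"
      using K by (auto simp: indicator_def abs_le_iff)
  qed (use \<open>0 \<le> K\<close> in auto)
  also have "\<dots> = (b - a) * K" using a b by simp
  also have "\<dots> \<le> 2 * d * K" using a b \<open>0 \<le> K\<close> by (intro mult_right_mono) auto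
  also have "\<dots> \<le> measure M {x} / 2"
    unfolding d_def using pos \<open>0 \<le> K\<close> by (simp add: field_simps)
  finally show False using pos by simp
qed

text \<open>By continuity a negative value would persist on a small interval, whose mass would then
  be negative.\<close>

lemma fourier_density_nonneg:
  assumes ch: "integrable lborel (char M)"
  shows "0 \<le> fourier_density (char M) x"
proof (rule ccontr)
  let ?f = "fourier_density (char M)"
  assume neg: "\<not> 0 \<le> ?f x"
  have cont: "continuous_on UNIV ?f"
    unfolding fourier_density_def by (intro continuous_intros continuous_fourier_integral[OF ch]) auto
  then have "isCont ?f x" by (simp add: continuous_on_eq_continuous_at)
  then obtain d where d: "d > 0" "\<And>y. \<bar>y - x\<bar> < d \<Longrightarrow> \<bar>?f y - ?f x\<bar> < - ?f x / 2"
    using neg unfolding continuous_at_eps_delta by (metis dist_real_def half_gt_zero neg_0_less_iff_less not_le)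
  have "measure M {x<..x + d/2} = (LINT y|lborel. indicator {x..x + d/2} y * ?f y)"
    using d(1) by (intro measure_interval_integrable_char[OF ch] integrable_char_no_atoms[OF ch]) auto
  also have "\<dots> \<le> (LINT y|lborel. indicator {x..x + d/2} y * (?f x / 2))"
  proof (rule integral_mono)
    show "integrable lborel (\<lambda>y. indicator {x..x + d/2} y * ?f y)"
      using borel_integrable_compact[OF compact_Icc continuous_on_subset[OF cont], of x "x + d/2"]
      by (simp add: set_integrable_def)
    show "indicator {x..x + d/2} y * ?f y \<le> indicator {x..x + d/2} y * (?f x / 2)" for y
      using d(2)[of y] d(1) by (auto simp: indicator_def abs_less_iff)
    show "integrable lborel (\<lambda>y. indicator {x..x + d/2} y * (?f x / 2))"
      by (intro integrable_mult_left integrable_real_indicator) (auto simp: emeasure_lborel_Icc_eq)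
  qed
  also have "\<dots> = d / 2 * (?f x / 2)" using d(1) by simp
  also have "\<dots> < 0" using d(1) neg by (simp add: mult_pos_neg)
  finally show False using measure_nonneg[of M "{x<..x + d/2}"] by linarith
qed

text \<open>Half-lines determine a finite measure and are exhausted by bounded intervals, where the
  inversion formula applies.\<close>

lemma density_of_integrable_char:
  assumes ch: "integrable lborel (char M)"
  shows "M = density lborel (\<lambda>x. ennreal (fourier_density (char M) x))"
proof (rule measure_eqI_lessThan)
  let ?f = "fourier_density (char M)"
  let ?N = "density lborel (\<lambda>x. ennreal (?f x))"
  have cont: "continuous_on UNIV ?f"
    unfolding fourier_density_def by (intro continuous_intros continuous_fourier_integral[OF ch]) auto
  then have [measurable]: "?f \<in> borel_measurable borel" by (rule borel_measurable_continuous_onI)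
  fix x :: real
  have eq: "emeasure M {x<..x + real n} = emeasure ?N {x<..x + real n}" for n :: nat
  proof -
    have "integrable lborel (\<lambda>y. indicator {x..x + real n} y * ?f y)"
      using borel_integrable_compact[OF compact_Icc continuous_on_subset[OF cont], of x "x + real n"]
      by (simp add: set_integrable_def)
    then have "ennreal (measure M {x<..x + real n}) = (\<integral>\<^sup>+y. ennreal (indicator {x..x + real n} y * ?f y) \<partial>lborel)"
      using fourier_density_nonneg[OF ch]
      by (subst measure_interval_integrable_char[OF ch])
         (auto simp: nn_integral_eq_integral integrable_char_no_atoms[OF ch])
    also have "\<dots> = (\<integral>\<^sup>+y. ennreal (?f y) * indicator {x<..x + real n} y \<partial>lborel)"
      by (rule nn_integral_cong_AE, rule AE_mp[OF AE_lborel_singleton[of x]], rule AE_I2)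
         (auto simp: indicator_def)
    also have "\<dots> = emeasure ?N {x<..x + real n}"
      by (subst emeasure_density) auto
    finally show ?thesis by (simp add: emeasure_eq_measure)
  qed
  have U: "{x<..} = (\<Union>n::nat. {x<..x + real n})"
  proof (intro set_eqI iffI)
    fix y assume "y \<in> {x<..}"
    moreover obtain n :: nat where "y - x \<le> real n" using real_arch_simple by blast
    ultimately show "y \<in> (\<Union>n::nat. {x<..x + real n})" by (auto intro!: exI[of _ n])
  qed auto
  have inc: "incseq (\<lambda>n::nat. {x<..x + real n})" by (auto simp: incseq_def)
  have "emeasure M {x<..} = (SUP n. emeasure M {x<..x + real n})"
    unfolding U by (rule SUP_emeasure_incseq[symmetric]) (use inc in auto)
  also have "\<dots> = (SUP n. emeasure ?N {x<..x + real n})" by (simp add: eq)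
  also have "\<dots> = emeasure ?N {x<..}"
    unfolding U by (rule SUP_emeasure_incseq) (use inc in auto)
  finally show "emeasure M {x<..} = emeasure ?N {x<..}" .
qed (auto simp: emeasure_eq_measure)

end

section \<open>Convolution estimate at unit scale\<close>

text \<open>The common majorant on the Fourier side: its integral is \<open>pi\<close>, and it
  vanishes at infinity, which removes boundary terms.\<close>

definition cauchy_kernel :: "real \<Rightarrow> real" where
  "cauchy_kernel y = inverse (1 + y\<^sup>2)"

lemma cauchy_kernel_pos: "0 < cauchy_kernel y"
  by (simp add: cauchy_kernel_def add_pos_nonneg)

lemma cauchy_kernel_measurable [measurable]: "cauchy_kernel \<in> borel_measurable borel"
  unfolding cauchy_kernel_def by measurable

lemma integrable_cauchy_kernel: "integrable lborel cauchy_kernel"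
  using integrable_inverse_1_plus_square unfolding set_integrable_def cauchy_kernel_def
  by (simp add: einterval_eq)

lemma integral_cauchy_kernel: "(LINT y|lborel. cauchy_kernel y) = pi"
  using LBINT_inverse_1_plus_square unfolding cauchy_kernel_def
  by (simp add: interval_lebesgue_integral_def set_lebesgue_integral_def einterval_eq)

lemma integrable_of_cauchy_bound:
  fixes f :: "real \<Rightarrow> complex"
  assumes [measurable]: "f \<in> borel_measurable borel" and b: "\<And>y. norm (f y) \<le> B * cauchy_kernel y"
  shows "integrable lborel f" "(LINT y|lborel. norm (f y)) \<le> B * pi"
proof -
  have i: "integrable lborel (\<lambda>y. B * cauchy_kernel y)" using integrable_cauchy_kernel by simp
  show f: "integrable lborel f"
    by (rule Bochner_Integration.integrable_bound[OF i]) (use b in \<open>auto intro!: AE_I2 order_trans[OF b]\<close>)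
  have "(LINT y|lborel. norm (f y)) \<le> (LINT y|lborel. B * cauchy_kernel y)"
    by (rule integral_mono) (use f i b in auto)
  then show "(LINT y|lborel. norm (f y)) \<le> B * pi" by (simp add: integral_cauchy_kernel)
qed

lemma norm_fourier_integral_le:
  fixes f :: "real \<Rightarrow> complex"
  shows "norm (CLINT y|lborel. iexp (-(y * x)) * f y) \<le> (LINT y|lborel. norm (f y))"
  using integral_norm_bound[of lborel "\<lambda>y. iexp (-(y * x)) * f y"] by (simp add: norm_mult)

lemma cauchy_kernel_tendsto_0:
  "(cauchy_kernel \<longlongrightarrow> 0) at_top" "(cauchy_kernel \<longlongrightarrow> 0) at_bot"
  unfolding cauchy_kernel_def by real_asymp+

text \<open>The bound on \<open>G\<close> makes the boundary terms at \<open>n\<close> and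
  \<open>- n\<close> disappear in the limit, so a derivative is traded for a factor
  \<open>\<i> * x\<close>.\<close>

lemma fourier_integral_by_parts:
  fixes G G' :: "real \<Rightarrow> complex"
  assumes der: "\<And>y. (G has_vector_derivative G' y) (at y)" and cont: "continuous_on UNIV G'"
    and bd: "\<And>y. norm (G y) \<le> B * cauchy_kernel y" "\<And>y. norm (G' y) \<le> B * cauchy_kernel y"
  shows "(CLINT y|lborel. iexp (-(y * x)) * G' y) = \<i> * x * (CLINT y|lborel. iexp (-(y * x)) * G y)"
proof -
  have contG: "continuous_on UNIV G"
    using der by (meson continuous_at_imp_continuous_on has_vector_derivative_continuous)
  have [measurable]: "G \<in> borel_measurable borel" "G' \<in> borel_measurable borel"
    using contG cont by (auto intro: borel_measurable_continuous_onI)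
  define H where "H y = iexp (-(y * x)) * G y" for y
  define H' where "H' y = iexp (-(y * x)) * G' y - \<i> * x * (iexp (-(y * x)) * G y)" for y
  have iG: "integrable lborel (\<lambda>y. iexp (-(y * x)) * G y)"
    by (rule integrable_of_cauchy_bound[where B=B]) (use bd in \<open>auto simp: norm_mult\<close>)
  have iG': "integrable lborel (\<lambda>y. iexp (-(y * x)) * G' y)"
    by (rule integrable_of_cauchy_bound[where B=B]) (use bd in \<open>auto simp: norm_mult\<close>)
  have iH': "integrable lborel H'" unfolding H'_def using iG iG' by auto
  have derE: "((\<lambda>y. iexp (-(y * x))) has_vector_derivative (- \<i> * x * iexp (-(y * x)))) (at y)" for y
  proof -
    have "((\<lambda>z. exp (- (\<i> * z * x))) has_field_derivative (- \<i> * x * exp (- (\<i> * of_real y * x)))) (at (of_real y))"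
      by (auto intro!: derivative_eq_intros simp: field_simps)
    from has_vector_derivative_real_field[OF this, of UNIV] show ?thesis
      by (simp add: mult_ac)
  qed
  have derH: "(H has_vector_derivative H' y) (at y)" for y
    unfolding H_def[abs_def]
    by (rule has_vector_derivative_eq_rhs[OF has_vector_derivative_mult[OF derE der]])
       (simp add: H'_def algebra_simps)
  have contH': "continuous_on UNIV H'"
    unfolding H'_def by (intro continuous_intros cont contG)
  have "(\<lambda>n. CLINT y|lborel. indicator {- real n..real n} y *\<^sub>R H' y) \<longlonglongrightarrow> (CLINT y|lborel. H' y)"
  proof (rule integral_dominated_convergence[where w="\<lambda>y. norm (H' y)"])
    show "AE y in lborel. (\<lambda>n. indicator {- real n..real n} y *\<^sub>R H' y) \<longlonglongrightarrow> H' y"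
    proof (rule AE_I2)
      fix y :: real
      obtain N :: nat where "\<bar>y\<bar> < N" using reals_Archimedean2 by blast
      then have "\<forall>\<^sub>F n in sequentially. indicator {- real n..real n} y *\<^sub>R H' y = H' y"
        by (intro eventually_sequentiallyI[of N]) (auto simp: indicator_def)
      then show "(\<lambda>n. indicator {- real n..real n} y *\<^sub>R H' y) \<longlonglongrightarrow> H' y"
        by (rule tendsto_eventually)
    qed
  qed (use iH' in \<open>auto simp: indicator_def intro!: AE_I2\<close>)
  moreover have "(CLINT y|lborel. indicator {- real n..real n} y *\<^sub>R H' y) = H (real n) - H (- real n)" for n :: nat
    by (rule integral_FTC_atLeastAtMost)
       (auto intro: has_vector_derivative_at_within derH continuous_on_subset[OF contH'])
  ultimately have lim: "(\<lambda>n. H (real n) - H (- real n)) \<longlonglongrightarrow> (CLINT y|lborel. H' y)" by (simp only:)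
  have H_bd: "norm (H y) \<le> B * cauchy_kernel y" for y
    using bd(1)[of y] by (simp add: H_def norm_mult)
  have "(\<lambda>n. H (real n)) \<longlonglongrightarrow> 0"
  proof (rule Lim_null_comparison)
    show "(\<lambda>n. B * cauchy_kernel (real n)) \<longlonglongrightarrow> 0"
      by (intro tendsto_mult_right_zero filterlim_compose[OF cauchy_kernel_tendsto_0(1)] filterlim_real_sequentially)
  qed (use H_bd in auto)
  moreover have "(\<lambda>n. H (- real n)) \<longlonglongrightarrow> 0"
  proof (rule Lim_null_comparison)
    show "(\<lambda>n. B * cauchy_kernel (- real n)) \<longlonglongrightarrow> 0"
      by (intro tendsto_mult_right_zero filterlim_compose[OF cauchy_kernel_tendsto_0(2)])
         (simp add: filterlim_uminus_at_bot filterlim_real_sequentially)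
  qed (use H_bd in auto)
  ultimately have "(\<lambda>n. H (real n) - H (- real n)) \<longlonglongrightarrow> 0 - 0" by (intro tendsto_diff)
  then have "(CLINT y|lborel. H' y) = 0" using lim LIMSEQ_unique by fastforce
  then show ?thesis unfolding H'_def using iG iG' by simp
qed

text \<open>The Levy-Khintchine exponent for the jump density \<open>m\<close>, compensated for
  jumps shorter than 1. The one-sided test \<open>s < 1\<close> is enough since the densities it is
  used with vanish on the negative half-line.\<close>

definition compensated_exponent :: "(real \<Rightarrow> real) \<Rightarrow> real \<Rightarrow> complex" where
  "compensated_exponent m y =
     (CLINT s|lborel. (1 - iexp (y * s) + (if s < 1 then \<i> * of_real (y * s) else 0)) * of_real (m s))"

lemma norm_iexp_diff_1: "norm (iexp x - 1) \<le> \<bar>x\<bar>"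
  using iexp_approx1[of x 0] by simp

lemma norm_iexp_diff_2: "norm (1 - iexp x + \<i> * x) \<le> x\<^sup>2 / 2"
proof -
  have "norm (iexp x - (1 + \<i> * x)) \<le> x\<^sup>2 / 2"
    using iexp_approx1[of x 1] by (simp add: power2_eq_square)
  then show ?thesis using norm_minus_commute[of "iexp x" "1 + \<i> * x"] by (simp add: algebra_simps)
qed

text \<open>Here \<open>m\<close> is the jump density of the process after time and space have been rescaled, and \<open>W\<close>
  is the bound to be proved for the density. What matters is that the final constants depend on
  \<open>A\<close>, \<open>J\<close> and \<open>K\<close> only.\<close>

locale normalized_density =
  fixes m W :: "real \<Rightarrow> real" and A J K :: real
  assumes m_meas [measurable]: "m \<in> borel_measurable borel"
    and m_nonneg: "\<And>s. 0 \<le> m s"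
    and m_neg: "\<And>s. s \<le> 0 \<Longrightarrow> m s = 0"
    and m_int: "integrable lborel (\<lambda>s. min 1 (s\<^sup>2) * m s)"
    and m_A: "(LINT s|lborel. min 1 (s\<^sup>2) * m s) \<le> A"
    and K: "1 \<le> K"
    and W_nonneg: "\<And>x. 0 < x \<Longrightarrow> 0 \<le> W x"
    and W_doubling: "\<And>x z. 0 < x \<Longrightarrow> x / 2 \<le> z \<Longrightarrow> W z \<le> K * W x"
    and m_le_W: "\<And>s. 1 \<le> s \<Longrightarrow> m s \<le> K * W s"
    and W_lower: "\<And>x. 0 < x \<Longrightarrow> 1 \<le> K * (1 + x ^ 3) * W x"
    and decay: "\<And>y. (1 + \<bar>y\<bar>) ^ 3 * exp (- Re (compensated_exponent m y)) \<le> J * cauchy_kernel y"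
begin

section \<open>Short and long jumps, and moments of the short ones\<close>

definition sm where "sm s = indicator {..<1} s * m s" for s :: real
definition lg where "lg s = indicator {1..} s * m s" for s :: real

lemma sm_meas [measurable]: "sm \<in> borel_measurable borel" unfolding sm_def by measurable
lemma lg_meas [measurable]: "lg \<in> borel_measurable borel" unfolding lg_def by measurable
lemma sm_nonneg: "0 \<le> sm s" and lg_nonneg: "0 \<le> lg s" using m_nonneg by (auto simp: sm_def lg_def)

lemma A_nonneg: "0 \<le> A"
  by (rule order_trans[OF _ m_A], rule Bochner_Integration.integral_nonneg) (simp add: m_nonneg)

text \<open>The exponent has to be at least 2: the first moment of the short jumps is not controlled
  by \<open>A\<close>.\<close>

lemma sm_pow_le: "2 \<le> j \<Longrightarrow> \<bar>s\<bar> ^ j * sm s \<le> min 1 (s\<^sup>2) * m s"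
proof (cases "0 < s \<and> s < 1")
  case True
  assume "2 \<le> j"
  then have "s ^ j \<le> s\<^sup>2" using True by (intro power_decreasing) auto
  moreover have "s\<^sup>2 \<le> 1" using True by (simp add: power_le_one)
  ultimately show ?thesis using True m_nonneg[of s] by (simp add: sm_def mult_right_mono)
qed (use m_nonneg m_neg in \<open>auto simp: sm_def indicator_def not_less\<close>)

lemma sm_pow_integrable: assumes "2 \<le> j" shows "integrable lborel (\<lambda>s. \<bar>s\<bar> ^ j * sm s)"
  by (rule Bochner_Integration.integrable_bound[OF m_int])
     (use sm_pow_le[OF assms] sm_nonneg m_nonneg in \<open>auto intro!: AE_I2 simp: abs_mult\<close>)

lemma sm_pow_integral_le: assumes "2 \<le> j" shows "(LINT s|lborel. \<bar>s\<bar> ^ j * sm s) \<le> A"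
  by (rule order_trans[OF integral_mono m_A]) (use sm_pow_le[OF assms] sm_pow_integrable[OF assms] m_int in auto)

lemma lg_le: "lg s \<le> min 1 (s\<^sup>2) * m s"
  using m_nonneg[of s] by (auto simp: lg_def indicator_def)

lemma lg_integrable: "integrable lborel lg"
  by (rule Bochner_Integration.integrable_bound[OF m_int])
     (use lg_le lg_nonneg m_nonneg in \<open>auto intro!: AE_I2 simp: abs_mult\<close>)

definition \<Lambda> where "\<Lambda> = (LINT s|lborel. lg s)"

lemma \<Lambda>_bounds: "0 \<le> \<Lambda>" "\<Lambda> \<le> A"
proof -
  show "0 \<le> \<Lambda>" unfolding \<Lambda>_def by (simp add: lg_nonneg)
  show "\<Lambda> \<le> A" unfolding \<Lambda>_def
    by (rule order_trans[OF integral_mono m_A]) (use lg_le lg_integrable m_int in auto)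
qed

text \<open>Up to a power of \<open>\<i>\<close>, the derivatives of order two and higher of the
  exponent \<open>\<Psi>0\<close> of the short jumps.\<close>

definition mom :: "nat \<Rightarrow> real \<Rightarrow> complex" where
  "mom j y = (CLINT s|lborel. of_real (s ^ j) * iexp (y * s) * of_real (sm s))"

lemma mom_integrable:
  assumes "2 \<le> j" shows "integrable lborel (\<lambda>s. of_real (s ^ j) * iexp (y * s) * complex_of_real (sm s))"
  by (rule Bochner_Integration.integrable_bound[OF sm_pow_integrable[OF assms]])
     (auto intro!: AE_I2 simp: norm_mult norm_power power_abs)

lemma norm_mom: assumes "2 \<le> j" shows "norm (mom j y) \<le> A"
proof -
  have "norm (mom j y) \<le> (LINT s|lborel. norm (of_real (s ^ j) * iexp (y * s) * complex_of_real (sm s)))"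
    unfolding mom_def by (rule integral_norm_bound)
  also have "\<dots> = (LINT s|lborel. \<bar>s\<bar> ^ j * sm s)"
    using sm_nonneg by (simp add: norm_mult norm_power power_abs)
  finally show ?thesis using sm_pow_integral_le[OF assms] by linarith
qed

lemma iexp_scaled_derivative:
  "((\<lambda>y. iexp (y * s)) has_vector_derivative (\<i> * s * iexp (y * s))) (at y)"
proof -
  have "((\<lambda>z. exp (\<i> * (z * s))) has_field_derivative (\<i> * s * exp (\<i> * (of_real y * s)))) (at (of_real y))"
    by (auto intro!: derivative_eq_intros simp: field_simps)
  from has_vector_derivative_real_field[OF this, of UNIV] show ?thesis
    by (simp add: mult_ac)
qed

lemma mom_derivative:
  assumes "2 \<le> j" shows "(mom j has_vector_derivative \<i> * mom (Suc j) y) (at y)"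
proof -
  have "((\<lambda>y. CLINT s|lborel. of_real (s ^ j) * iexp (y * s) * of_real (sm s)) has_vector_derivative
      (CLINT s|lborel. \<i> * (of_real (s ^ Suc j) * iexp (y * s) * of_real (sm s)))) (at y)"
  proof (rule has_vector_derivative_integral_dominated[where e=1 and g="\<lambda>s. \<bar>s\<bar> ^ Suc j * sm s"
        and f'="\<lambda>y s. \<i> * (of_real (s ^ Suc j) * iexp (y * s) * of_real (sm s))"])
    fix x s
    show "((\<lambda>x. of_real (s ^ j) * iexp (x * s) * of_real (sm s)) has_vector_derivative
       \<i> * (of_real (s ^ Suc j) * iexp (x * s) * of_real (sm s))) (at x)"
      by (rule has_vector_derivative_eq_rhs[OF has_vector_derivative_mult_left[OF has_vector_derivative_mult_right[OF iexp_scaled_derivative]]])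
         (simp add: mult_ac)
    show "norm (\<i> * (of_real (s ^ Suc j) * iexp (x * s) * of_real (sm s))) \<le> \<bar>s\<bar> ^ Suc j * sm s"
      using sm_nonneg by (simp add: norm_mult norm_power power_abs)
  qed (use assms mom_integrable sm_pow_integrable[of "Suc j"] in auto)
  then show ?thesis unfolding mom_def[abs_def] by simp
qed

section \<open>The exponent of the short jumps and the derivatives of its exponential\<close>

definition \<Psi>0 where "\<Psi>0 y = (CLINT s|lborel. (1 - iexp (y * s) + \<i> * of_real (y * s)) * of_real (sm s))" for y :: real
definition \<Psi>1 where "\<Psi>1 y = (CLINT s|lborel. \<i> * of_real s * (1 - iexp (y * s)) * of_real (sm s))" for y :: real

lemma \<Psi>0_bound: "norm ((1 - iexp (y * s) + \<i> * of_real (y * s)) * complex_of_real (sm s)) \<le> y\<^sup>2 * (\<bar>s\<bar>\<^sup>2 * sm s)"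
proof -
  have "norm (1 - iexp (y * s) + \<i> * of_real (y * s)) \<le> y\<^sup>2 * s\<^sup>2"
    by (rule order_trans[OF norm_iexp_diff_2]) (simp add: power_mult_distrib)
  then show ?thesis using mult_right_mono[OF _ sm_nonneg[of s]] sm_nonneg
    by (simp add: norm_mult mult.assoc[symmetric] del: of_real_mult)
qed

lemma \<Psi>1_bound: "norm (\<i> * of_real s * (1 - iexp (y * s)) * complex_of_real (sm s)) \<le> \<bar>y\<bar> * (\<bar>s\<bar>\<^sup>2 * sm s)"
proof -
  have "norm (1 - iexp (y * s)) \<le> \<bar>y\<bar> * \<bar>s\<bar>"
    using norm_iexp_diff_1[of "y * s"] norm_minus_commute[of 1 "iexp (y * s)"] by (simp add: abs_mult)
  then have "\<bar>s\<bar> * norm (1 - iexp (y * s)) * sm s \<le> \<bar>s\<bar> * (\<bar>y\<bar> * \<bar>s\<bar>) * sm s"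
    by (intro mult_right_mono mult_left_mono sm_nonneg) auto
  then show ?thesis using sm_nonneg
    by (simp add: norm_mult power2_eq_square mult_ac del: of_real_mult)
qed

lemma \<Psi>0_integrable: "integrable lborel (\<lambda>s. (1 - iexp (y * s) + \<i> * of_real (y * s)) * complex_of_real (sm s))"
  by (rule Bochner_Integration.integrable_bound[OF integrable_mult_right[OF sm_pow_integrable[of 2], of "y\<^sup>2"]])
     (use \<Psi>0_bound sm_nonneg in \<open>auto intro!: AE_I2 simp: abs_mult\<close>)

lemma \<Psi>1_integrable: "integrable lborel (\<lambda>s. \<i> * of_real s * (1 - iexp (y * s)) * complex_of_real (sm s))"
  by (rule Bochner_Integration.integrable_bound[OF integrable_mult_right[OF sm_pow_integrable[of 2], of "\<bar>y\<bar>"]])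
     (use \<Psi>1_bound sm_nonneg in \<open>auto intro!: AE_I2 simp: abs_mult\<close>)

lemma norm_\<Psi>1: "norm (\<Psi>1 y) \<le> A * \<bar>y\<bar>"
proof -
  have "norm (\<Psi>1 y) \<le> (LINT s|lborel. norm (\<i> * of_real s * (1 - iexp (y * s)) * complex_of_real (sm s)))"
    unfolding \<Psi>1_def by (rule integral_norm_bound)
  also have "\<dots> \<le> (LINT s|lborel. \<bar>y\<bar> * (\<bar>s\<bar>\<^sup>2 * sm s))"
    by (rule integral_mono) (use \<Psi>1_bound \<Psi>1_integrable sm_pow_integrable[of 2] in \<open>auto simp del: power2_abs\<close>)
  also have "\<dots> \<le> \<bar>y\<bar> * A"
    using sm_pow_integral_le[of 2] by (simp add: mult_left_mono)
  finally show ?thesis by (simp add: mult.commute)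
qed

lemma \<Psi>0_derivative: "(\<Psi>0 has_vector_derivative \<Psi>1 y) (at y)"
  unfolding \<Psi>0_def[abs_def] \<Psi>1_def
proof (rule has_vector_derivative_integral_dominated[where e=1 and g="\<lambda>s. (\<bar>y\<bar> + 1) * (\<bar>s\<bar>\<^sup>2 * sm s)"
        and f'="\<lambda>y s. \<i> * of_real s * (1 - iexp (y * s)) * complex_of_real (sm s)"])
  fix x s :: real
  have l: "((\<lambda>x. \<i> * of_real (x * s)) has_vector_derivative \<i> * of_real s) (at x)"
    by (auto intro!: derivative_eq_intros has_vector_derivative_of_real)
  show "((\<lambda>x. (1 - iexp (x * s) + \<i> * of_real (x * s)) * complex_of_real (sm s)) has_vector_derivative
       \<i> * of_real s * (1 - iexp (x * s)) * complex_of_real (sm s)) (at x)"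
    by (rule has_vector_derivative_eq_rhs[OF has_vector_derivative_mult_left[OF
          has_vector_derivative_add[OF has_vector_derivative_diff[OF has_vector_derivative_const iexp_scaled_derivative] l]]])
       (simp add: algebra_simps)
  assume "x \<in> ball y 1"
  then have "\<bar>x\<bar> \<le> \<bar>y\<bar> + 1" by (auto simp: dist_real_def)
  then show "norm (\<i> * of_real s * (1 - iexp (x * s)) * complex_of_real (sm s)) \<le> (\<bar>y\<bar> + 1) * (\<bar>s\<bar>\<^sup>2 * sm s)"
    using sm_nonneg by (intro order_trans[OF \<Psi>1_bound] mult_right_mono) auto
qed (use \<Psi>0_integrable sm_pow_integrable[of 2] in auto)

lemma \<Psi>1_derivative: "(\<Psi>1 has_vector_derivative mom 2 y) (at y)"
  unfolding \<Psi>1_def[abs_def] mom_def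
proof (rule has_vector_derivative_integral_dominated[where e=1 and g="\<lambda>s. \<bar>s\<bar>\<^sup>2 * sm s"
        and f'="\<lambda>y s. of_real (s\<^sup>2) * iexp (y * s) * complex_of_real (sm s)"])
  fix x s :: real
  show "((\<lambda>x. \<i> * of_real s * (1 - iexp (x * s)) * complex_of_real (sm s)) has_vector_derivative
       of_real (s\<^sup>2) * iexp (x * s) * complex_of_real (sm s)) (at x)"
    by (rule has_vector_derivative_eq_rhs[OF has_vector_derivative_mult_left[OF has_vector_derivative_mult_right[OF
          has_vector_derivative_diff[OF has_vector_derivative_const iexp_scaled_derivative]]]])
       (simp add: algebra_simps power2_eq_square)
  show "norm (of_real (s\<^sup>2) * iexp (x * s) * complex_of_real (sm s)) \<le> \<bar>s\<bar>\<^sup>2 * sm s"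
    using sm_nonneg by (simp add: norm_mult norm_power)
qed (use \<Psi>1_integrable sm_pow_integrable[of 2] in auto)

definition g0 where "g0 y = exp (- \<Psi>0 y)" for y :: real
text \<open>\<open>g1\<close>, \<open>g2\<close>, \<open>g3\<close> are the successive derivatives
  of \<open>g0\<close>, each written as a polynomial in \<open>\<Psi>1\<close> and the moments times
  \<open>g0\<close>, so that it remains to bound the polynomial.\<close>

definition g1 where "g1 y = - \<Psi>1 y * g0 y" for y :: real
definition g2 where "g2 y = ((\<Psi>1 y)\<^sup>2 - mom 2 y) * g0 y" for y :: real
definition g3 where "g3 y = (- ((\<Psi>1 y) ^ 3) + 3 * \<Psi>1 y * mom 2 y - \<i> * mom 3 y) * g0 y" for y :: real

lemma g0_derivative: "(g0 has_vector_derivative g1 y) (at y)"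
proof -
  have "((exp \<circ> (\<lambda>y. - \<Psi>0 y)) has_vector_derivative (- \<Psi>1 y) * exp (- \<Psi>0 y)) (at y)"
    by (rule field_vector_diff_chain_at) (auto intro!: derivative_eq_intros \<Psi>0_derivative has_vector_derivative_minus)
  then show ?thesis by (simp add: g0_def[abs_def] g1_def o_def)
qed

lemma g1_derivative: "(g1 has_vector_derivative g2 y) (at y)"
  unfolding g1_def[abs_def]
  by (rule has_vector_derivative_eq_rhs[OF has_vector_derivative_mult[OF has_vector_derivative_minus[OF \<Psi>1_derivative] g0_derivative]])
     (simp add: g1_def g2_def algebra_simps power2_eq_square)

lemma g2_derivative: "(g2 has_vector_derivative g3 y) (at y)"
  unfolding g2_def[abs_def] power2_eq_square
  by (rule has_vector_derivative_eq_rhs[OF has_vector_derivative_mult[OF has_vector_derivative_diff[OF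
          has_vector_derivative_mult[OF \<Psi>1_derivative \<Psi>1_derivative] mom_derivative[of 2]] g0_derivative]])
     (auto simp: g1_def g3_def algebra_simps power2_eq_square power3_eq_cube numeral_3_eq_3)

lemma continuous_vector_derivative:
  "(\<And>y. (f has_vector_derivative f' y) (at y)) \<Longrightarrow> continuous_on UNIV (f :: real \<Rightarrow> complex)"
  by (meson continuous_at_imp_continuous_on has_vector_derivative_continuous)

lemma continuous_g: "continuous_on UNIV g0" "continuous_on UNIV g1" "continuous_on UNIV g2" "continuous_on UNIV g3"
proof -
  show "continuous_on UNIV g0" "continuous_on UNIV g1" "continuous_on UNIV g2"
    using continuous_vector_derivative g0_derivative g1_derivative g2_derivative by blast+
  then show "continuous_on UNIV g3" unfolding g3_def
    by (intro continuous_intros continuous_vector_derivative[OF \<Psi>1_derivative]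
        continuous_vector_derivative[OF mom_derivative]) auto
qed

lemma g_meas [measurable]:
  "g0 \<in> borel_measurable borel" "g1 \<in> borel_measurable borel" "g2 \<in> borel_measurable borel" "g3 \<in> borel_measurable borel"
  using continuous_g by (auto intro: borel_measurable_continuous_onI)

section \<open>The Fourier transform of the long jumps, and decay of the remaining factor\<close>

definition \<kappa> where "\<kappa> y = (CLINT s|lborel. iexp (y * s) * of_real (lg s))" for y :: real

lemma lg_iexp_integrable: "integrable lborel (\<lambda>s. iexp (y * s) * complex_of_real (lg s))"
  by (rule Bochner_Integration.integrable_bound[OF lg_integrable]) (auto intro!: AE_I2 simp: norm_mult)

lemma norm_\<kappa>: "norm (\<kappa> y) \<le> \<Lambda>"
proof -
  have "norm (\<kappa> y) \<le> (LINT s|lborel. norm (iexp (y * s) * complex_of_real (lg s)))"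
    unfolding \<kappa>_def by (rule integral_norm_bound)
  also have "\<dots> = \<Lambda>" unfolding \<Lambda>_def using lg_nonneg by (simp add: norm_mult)
  finally show ?thesis .
qed

lemma continuous_\<kappa>: "continuous_on UNIV \<kappa>"
proof -
  have i: "integrable lborel (\<lambda>s. complex_of_real (lg s))" using lg_integrable by simp
  have u: "continuous_on UNIV (uminus :: real \<Rightarrow> real)" by (rule continuous_on_minus[OF continuous_on_id])
  have "continuous_on UNIV (\<lambda>x. CLINT t|lborel. iexp (-(t * - x)) * complex_of_real (lg t))"
    by (rule continuous_on_compose2[OF continuous_fourier_integral[OF i] u]) simp
  then show ?thesis unfolding \<kappa>_def[abs_def] by (simp add: mult.commute)
qed

lemma \<kappa>_meas [measurable]: "\<kappa> \<in> borel_measurable borel"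
  using continuous_\<kappa> by (rule borel_measurable_continuous_onI)

text \<open>Long jumps are not compensated, so they contribute their total mass minus their Fourier
  transform.\<close>

lemma exponent_split: "compensated_exponent m y = \<Psi>0 y + (of_real \<Lambda> - \<kappa> y)"
proof -
  have i1: "integrable lborel (\<lambda>s. complex_of_real (lg s))" using lg_integrable by simp
  have "compensated_exponent m y = (CLINT s|lborel. (1 - iexp (y * s) + \<i> * of_real (y * s)) * complex_of_real (sm s)
      + (complex_of_real (lg s) - iexp (y * s) * of_real (lg s)))"
    unfolding compensated_exponent_def
    by (rule Bochner_Integration.integral_cong) (auto simp: sm_def lg_def indicator_def algebra_simps)
  also have "\<dots> = \<Psi>0 y + (of_real \<Lambda> - \<kappa> y)"
    unfolding \<Psi>0_def \<kappa>_def \<Lambda>_def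
    by (subst Bochner_Integration.integral_add[OF \<Psi>0_integrable Bochner_Integration.integrable_diff[OF i1 lg_iexp_integrable]])
       (simp only: Bochner_Integration.integral_diff[OF i1 lg_iexp_integrable] integral_complex_of_real)
  finally show ?thesis .
qed

definition B where "B = (1 + A) ^ 3 * (exp (2 * A) * J)"

text \<open>Removing the long jumps changes the real part of the exponent by at most
  \<open>2 * \<Lambda>\<close>, hence by at most \<open>2 * A\<close>. The decay assumed for the
  full exponent passes to the short jumps at the price of \<open>exp (2 * A)\<close>.\<close>

lemma norm_g0: "(1 + \<bar>y\<bar>) ^ 3 * norm (g0 y) \<le> exp (2 * A) * J * cauchy_kernel y"
proof -
  have "Re (compensated_exponent m y) = Re (\<Psi>0 y) + (\<Lambda> - Re (\<kappa> y))" by (simp add: exponent_split)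
  moreover have "\<bar>Re (\<kappa> y)\<bar> \<le> \<Lambda>" using abs_Re_le_cmod[of "\<kappa> y"] norm_\<kappa>[of y] by linarith
  ultimately have "Re (compensated_exponent m y) \<le> Re (\<Psi>0 y) + 2 * A" using \<Lambda>_bounds by linarith
  then have "norm (g0 y) \<le> exp (2 * A) * exp (- Re (compensated_exponent m y))"
    unfolding g0_def by (simp add: exp_add[symmetric])
  then have "(1 + \<bar>y\<bar>) ^ 3 * norm (g0 y) \<le> (1 + \<bar>y\<bar>) ^ 3 * (exp (2 * A) * exp (- Re (compensated_exponent m y)))"
    by (intro mult_left_mono) auto
  also have "\<dots> = exp (2 * A) * ((1 + \<bar>y\<bar>) ^ 3 * exp (- Re (compensated_exponent m y)))" by simp
  also have "\<dots> \<le> exp (2 * A) * (J * cauchy_kernel y)" by (intro mult_left_mono decay) auto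
  finally show ?thesis by simp
qed

lemma norm_mult_g0:
  assumes "norm z \<le> (1 + A) ^ 3 * (1 + \<bar>y\<bar>) ^ 3"
  shows "norm (z * g0 y) \<le> B * cauchy_kernel y"
proof -
  have "norm (z * g0 y) \<le> (1 + A) ^ 3 * ((1 + \<bar>y\<bar>) ^ 3 * norm (g0 y))"
    using mult_right_mono[OF assms, of "norm (g0 y)"] by (simp add: norm_mult mult.assoc)
  also have "\<dots> \<le> (1 + A) ^ 3 * (exp (2 * A) * J * cauchy_kernel y)"
    by (intro mult_left_mono norm_g0) (use A_nonneg in auto)
  finally show ?thesis by (simp add: B_def mult.assoc)
qed

text \<open>The polynomial factors have degree at most three in \<open>\<bar>y\<bar>\<close> and are
  dominated by \<open>(1 + A) ^ 3 * (1 + \<bar>y\<bar>) ^ 3\<close>; this is why the assumption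
  \<open>decay\<close> carries a cubic factor.\<close>

lemma norm_g:
  "norm (g0 y) \<le> B * cauchy_kernel y" "norm (g1 y) \<le> B * cauchy_kernel y"
  "norm (g2 y) \<le> B * cauchy_kernel y" "norm (g3 y) \<le> B * cauchy_kernel y"
proof -
  let ?a = "\<bar>y\<bar>"
  have e: "(1 + A) ^ 3 * (1 + ?a) ^ 3 = (1 + 3 * A + 3 * A\<^sup>2 + A ^ 3) * (1 + 3 * ?a + 3 * ?a\<^sup>2 + ?a ^ 3)"
    by (simp add: power2_eq_square power3_eq_cube algebra_simps)
  note nn = A_nonneg abs_ge_zero[of y]
  have p: "norm (\<Psi>1 y) ^ 2 \<le> A\<^sup>2 * ?a\<^sup>2" "norm (\<Psi>1 y) ^ 3 \<le> A ^ 3 * ?a ^ 3"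
    using power_mono[OF norm_\<Psi>1[of y] norm_ge_zero, of 2] power_mono[OF norm_\<Psi>1[of y] norm_ge_zero, of 3]
    by (simp_all add: power_mult_distrib)
  have m: "norm (mom 2 y) \<le> A" "norm (mom 3 y) \<le> A" using norm_mom by auto
  have 0: "norm (1 :: complex) \<le> (1 + A) ^ 3 * (1 + ?a) ^ 3"
    using mult_mono[OF one_le_power[of "1 + A" 3] one_le_power[of "1 + ?a" 3]] nn by simp
  show "norm (g0 y) \<le> B * cauchy_kernel y" using norm_mult_g0[OF 0] by simp
  have "A * ?a \<le> (1 + A) ^ 3 * (1 + ?a) ^ 3"
    unfolding e using nn by (simp add: algebra_simps)
  then have 1: "norm (- \<Psi>1 y) \<le> (1 + A) ^ 3 * (1 + ?a) ^ 3" using norm_\<Psi>1[of y] by simp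
  show "norm (g1 y) \<le> B * cauchy_kernel y" unfolding g1_def by (rule norm_mult_g0[OF 1])
  have "norm ((\<Psi>1 y)\<^sup>2 - mom 2 y) \<le> A\<^sup>2 * ?a\<^sup>2 + A"
    by (rule order_trans[OF norm_triangle_ineq4]) (use p m in \<open>simp add: norm_power\<close>)
  also have "\<dots> \<le> (1 + A) ^ 3 * (1 + ?a) ^ 3"
    unfolding e using nn by (simp add: algebra_simps)
  finally show "norm (g2 y) \<le> B * cauchy_kernel y" unfolding g2_def by (rule norm_mult_g0)
  have "norm (- ((\<Psi>1 y) ^ 3) + 3 * \<Psi>1 y * mom 2 y - \<i> * mom 3 y) \<le> norm (- ((\<Psi>1 y) ^ 3) + 3 * \<Psi>1 y * mom 2 y) + norm (\<i> * mom 3 y)"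
    by (rule norm_triangle_ineq4)
  also have "\<dots> \<le> norm (- ((\<Psi>1 y) ^ 3)) + norm (3 * \<Psi>1 y * mom 2 y) + norm (\<i> * mom 3 y)"
    by (intro add_right_mono norm_triangle_ineq)
  also have "\<dots> \<le> A ^ 3 * ?a ^ 3 + 3 * (A * ?a) * A + A"
  proof (intro add_mono)
    have "norm (\<Psi>1 y) * norm (mom 2 y) \<le> (A * ?a) * A"
      by (intro mult_mono norm_\<Psi>1 m mult_nonneg_nonneg nn norm_ge_zero)
    then show "norm (3 * \<Psi>1 y * mom 2 y) \<le> 3 * (A * ?a) * A" by (simp add: norm_mult)
  qed (use p(2) m(2) in \<open>simp_all add: norm_power norm_mult\<close>)
  also have "\<dots> \<le> (1 + A) ^ 3 * (1 + ?a) ^ 3"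
  proof -
    let ?P = "(1 + ?a) ^ 3"
    have P: "?a ^ 3 \<le> ?P" "?a \<le> ?P" "1 \<le> ?P"
      using power_mono[of ?a "1 + ?a" 3] one_le_power[of "1 + ?a" 3] self_le_power[of "1 + ?a" 3] by auto
    have "A ^ 3 * ?a ^ 3 \<le> A ^ 3 * ?P" "3 * A\<^sup>2 * ?a \<le> 3 * A\<^sup>2 * ?P" "A * 1 \<le> A * ?P" "0 \<le> A * ?P"
      using mult_left_mono[OF P(1), of "A ^ 3"] mult_left_mono[OF P(2), of "3 * A\<^sup>2"] mult_left_mono[OF P(3), of A]
        A_nonneg by simp_all
    moreover have "(1 + A) ^ 3 * ?P = ?P + 3 * (A * ?P) + 3 * A\<^sup>2 * ?P + A ^ 3 * ?P"
      by (simp add: power2_eq_square power3_eq_cube[of "1 + A"] power3_eq_cube[of A] ring_distribs)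
    moreover have "3 * (A * ?a) * A = 3 * A\<^sup>2 * ?a" by (simp add: power2_eq_square)
    ultimately show ?thesis using P(3) by linarith
  qed
  finally show "norm (g3 y) \<le> B * cauchy_kernel y" unfolding g3_def by (rule norm_mult_g0)
qed

lemma B_nonneg: "0 \<le> B"
  using order_trans[OF norm_ge_zero norm_g(1)[of 0]] cauchy_kernel_pos[of 0] by (simp add: zero_le_mult_iff)

section \<open>Repeated convolution with the long jumps\<close>

definition F :: "nat \<Rightarrow> real \<Rightarrow> complex" where
  "F k x = (CLINT y|lborel. iexp (-(y * x)) * (g0 y * \<kappa> y ^ k))"

lemma norm_g0_\<kappa>: "norm (g0 y * \<kappa> y ^ k) \<le> (B * \<Lambda> ^ k) * cauchy_kernel y"
  using mult_mono[OF norm_g(1)[of y] power_mono[OF norm_\<kappa>[of y] norm_ge_zero, of k]] B_nonneg cauchy_kernel_pos[of y]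
  by (simp add: norm_mult norm_power mult_ac)

lemma g0_\<kappa>_integrable:
  "integrable lborel (\<lambda>y. g0 y * \<kappa> y ^ k)" "(LINT y|lborel. norm (g0 y * \<kappa> y ^ k)) \<le> B * \<Lambda> ^ k * pi"
  using integrable_of_cauchy_bound[OF _ norm_g0_\<kappa>, of k] by auto

lemma continuous_F: "continuous_on UNIV (F k)"
  unfolding F_def[abs_def] by (rule continuous_fourier_integral[OF g0_\<kappa>_integrable(1)])

lemma F_meas [measurable]: "F k \<in> borel_measurable borel"
  using continuous_F by (rule borel_measurable_continuous_onI)

lemma F_bounded: "norm (F k x) \<le> B * \<Lambda> ^ k * pi"
  unfolding F_def by (rule order_trans[OF norm_fourier_integral_le g0_\<kappa>_integrable(2)])

lemma F0_decay: "(1 + \<bar>x\<bar> ^ 3) * norm (F 0 x) \<le> 2 * pi * B"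
proof -
  have "(CLINT y|lborel. iexp (-(y * x)) * g3 y) = (\<i> * x) * ((\<i> * x) * ((\<i> * x) * F 0 x))"
    using fourier_integral_by_parts[OF g2_derivative continuous_g(4) norm_g(3,4), of x]
      fourier_integral_by_parts[OF g1_derivative continuous_g(3) norm_g(2,3), of x]
      fourier_integral_by_parts[OF g0_derivative continuous_g(2) norm_g(1,2), of x]
    by (simp add: F_def)
  then have "\<bar>x\<bar> ^ 3 * norm (F 0 x) = norm (CLINT y|lborel. iexp (-(y * x)) * g3 y)"
    by (simp add: norm_mult power3_eq_cube mult.assoc)
  also have "\<dots> \<le> B * pi"
    by (rule order_trans[OF norm_fourier_integral_le integrable_of_cauchy_bound(2)[OF _ norm_g(4)]]) simp
  finally show ?thesis using F_bounded[of 0 x] by (simp add: algebra_simps)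
qed

text \<open>A weakening of the cubic decay, used to start the induction on \<open>L1\<close>
  norms.\<close>

lemma F0_cauchy: "norm (F 0 x) \<le> (4 * pi * B) * cauchy_kernel x"
proof -
  have "\<bar>x\<bar>\<^sup>2 \<le> 1 + \<bar>x\<bar> ^ 3"
  proof (cases "\<bar>x\<bar> \<le> 1")
    case True
    then have "\<bar>x\<bar>\<^sup>2 \<le> 1" by (simp only: power_le_one abs_ge_zero)
    then show ?thesis by (simp add: add_increasing2)
  next
    case False
    then have "\<bar>x\<bar>\<^sup>2 \<le> \<bar>x\<bar> ^ 3" by (intro power_increasing) auto
    then show ?thesis by linarith
  qed
  then have "1 + x\<^sup>2 \<le> 1 + (1 + \<bar>x\<bar> ^ 3)" by simp
  also have "\<dots> \<le> 2 * (1 + \<bar>x\<bar> ^ 3)" by simp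
  finally have "(1 + x\<^sup>2) * norm (F 0 x) \<le> 2 * ((1 + \<bar>x\<bar> ^ 3) * norm (F 0 x))"
    using mult_right_mono[of "1 + x\<^sup>2" "2 * (1 + \<bar>x\<bar> ^ 3)" "norm (F 0 x)"] by (simp only: norm_ge_zero mult.assoc)
  also have "\<dots> \<le> 4 * pi * B" using F0_decay[of x] by linarith
  finally have "norm (F 0 x) * (1 + x\<^sup>2) \<le> 4 * pi * B" by (simp only: mult.commute)
  then show ?thesis
    unfolding cauchy_kernel_def by (simp add: pos_le_divide_eq[of "1 + x\<^sup>2"] add_pos_nonneg field_simps)
qed

text \<open>Multiplication by \<open>\<kappa>\<close> on the Fourier side is convolution with
  \<open>lg\<close>; Fubini applies because \<open>g0 * \<kappa> ^ k\<close> and \<open>lg\<close>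
  are both integrable.\<close>

lemma F_Suc: "F (Suc k) x = (CLINT s|lborel. of_real (lg s) * F k (x - s))"
proof -
  let ?f = "\<lambda>y s. iexp (-(y * x)) * (g0 y * \<kappa> y ^ k) * (iexp (y * s) * complex_of_real (lg s))"
  have int: "integrable (lborel \<Otimes>\<^sub>M lborel) (\<lambda>(y, s). ?f y s)"
  proof (rule lborel_pair.Fubini_integrable)
    show "(\<lambda>(y, s). ?f y s) \<in> borel_measurable (lborel \<Otimes>\<^sub>M lborel)" by measurable
    have "(LINT s|lborel. norm (?f y s)) = norm (g0 y * \<kappa> y ^ k) * \<Lambda>" for y
      using lg_nonneg by (simp add: norm_mult \<Lambda>_def)
    then show "integrable lborel (\<lambda>y. LINT s|lborel. norm (case (y, s) of (y, s) \<Rightarrow> ?f y s))"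
      using g0_\<kappa>_integrable(1)[of k] by (simp add: integrable_norm)
    show "AE y in lborel. integrable lborel (\<lambda>s. case (y, s) of (y, s) \<Rightarrow> ?f y s)"
      by (rule AE_I2, unfold prod.case, rule integrable_mult_right, rule lg_iexp_integrable)
  qed
  have "F (Suc k) x = (CLINT y|lborel. CLINT s|lborel. ?f y s)"
    unfolding F_def
  proof (rule Bochner_Integration.integral_cong[OF refl])
    fix y
    have "(CLINT s|lborel. ?f y s) = iexp (-(y * x)) * (g0 y * \<kappa> y ^ k) * \<kappa> y"
      unfolding \<kappa>_def[of y] by (rule integral_mult_right_zero)
    then show "iexp (-(y * x)) * (g0 y * \<kappa> y ^ Suc k) = (CLINT s|lborel. ?f y s)"
      by (simp only: power_Suc mult_ac)
  qed
  also have "\<dots> = (CLINT s|lborel. CLINT y|lborel. ?f y s)"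
    using lborel_pair.Fubini_integral[OF int] by simp
  also have "\<dots> = (CLINT s|lborel. of_real (lg s) * F k (x - s))"
  proof (rule Bochner_Integration.integral_cong[OF refl])
    fix s
    have "?f y s = of_real (lg s) * (iexp (-(y * (x - s))) * (g0 y * \<kappa> y ^ k))" for y
      by (simp add: exp_add[symmetric] algebra_simps flip: exp_add)
    then show "(CLINT y|lborel. ?f y s) = of_real (lg s) * F k (x - s)"
      by (simp only: F_def integral_mult_right_zero)
  qed
  finally show ?thesis .
qed

lemma lg_F_integrable: "integrable lborel (\<lambda>s. complex_of_real (lg s) * F k (x - s))"
proof (rule Bochner_Integration.integrable_bound[OF integrable_mult_left[OF lg_integrable, of "B * \<Lambda> ^ k * pi"]])
  show "AE s in lborel. norm (complex_of_real (lg s) * F k (x - s)) \<le> norm (lg s * (B * \<Lambda> ^ k * pi))"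
    using lg_nonneg B_nonneg \<Lambda>_bounds F_bounded[of k]
    by (auto intro!: AE_I2 mult_left_mono simp: norm_mult abs_mult)
qed measurable

lemma norm_F_Suc: "norm (F (Suc k) x) \<le> (LINT s|lborel. lg s * norm (F k (x - s)))"
proof -
  have "norm (F (Suc k) x) \<le> (LINT s|lborel. norm (of_real (lg s) * F k (x - s)))"
    unfolding F_Suc by (rule integral_norm_bound)
  then show ?thesis using lg_nonneg by (simp add: norm_mult)
qed

lemma lg_normF_integrable: "integrable lborel (\<lambda>s. lg s * norm (F k (x - s)))"
  using integrable_norm[OF lg_F_integrable[of k x]] lg_nonneg by (simp add: norm_mult)

text \<open>Convolution with \<open>lg\<close> multiplies the \<open>L1\<close> norm by at most the
  mass \<open>\<Lambda>\<close>. The nonnegative integral is used because integrability of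
  \<open>F k\<close> is itself a consequence.\<close>

lemma F_L1: "(\<integral>\<^sup>+x. ennreal (norm (F k x)) \<partial>lborel) \<le> ennreal (4 * pi\<^sup>2 * B * \<Lambda> ^ k)"
proof (induction k)
  case 0
  have "(\<integral>\<^sup>+x. ennreal (norm (F 0 x)) \<partial>lborel) = ennreal (LINT x|lborel. norm (F 0 x))"
    by (rule nn_integral_eq_integral) (auto intro!: integrable_norm integrable_of_cauchy_bound(1)[OF _ F0_cauchy])
  also have "\<dots> \<le> ennreal (4 * pi\<^sup>2 * B * \<Lambda> ^ 0)"
    using integrable_of_cauchy_bound(2)[OF _ F0_cauchy]
    by (intro ennreal_leI) (simp add: power2_eq_square mult_ac)
  finally show ?case .
next
  case (Suc k)
  have "(\<integral>\<^sup>+x. ennreal (norm (F (Suc k) x)) \<partial>lborel)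
      \<le> (\<integral>\<^sup>+x. (\<integral>\<^sup>+s. ennreal (lg s) * ennreal (norm (F k (x - s))) \<partial>lborel) \<partial>lborel)"
  proof (rule nn_integral_mono)
    fix x
    have "ennreal (norm (F (Suc k) x)) \<le> ennreal (LINT s|lborel. lg s * norm (F k (x - s)))"
      by (intro ennreal_leI norm_F_Suc)
    also have "\<dots> = (\<integral>\<^sup>+s. ennreal (lg s * norm (F k (x - s))) \<partial>lborel)"
      by (rule nn_integral_eq_integral[symmetric, OF lg_normF_integrable]) (auto simp: lg_nonneg)
    finally show "ennreal (norm (F (Suc k) x)) \<le> (\<integral>\<^sup>+s. ennreal (lg s) * ennreal (norm (F k (x - s))) \<partial>lborel)"
      by (simp add: ennreal_mult lg_nonneg)
  qed
  also have "\<dots> = (\<integral>\<^sup>+s. (\<integral>\<^sup>+x. ennreal (lg s) * ennreal (norm (F k (x - s))) \<partial>lborel) \<partial>lborel)"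
    by (rule lborel_pair.Fubini') measurable
  also have "\<dots> = (\<integral>\<^sup>+s. ennreal (lg s) * (\<integral>\<^sup>+x. ennreal (norm (F k x)) \<partial>lborel) \<partial>lborel)"
  proof (rule nn_integral_cong)
    fix s
    have "(\<integral>\<^sup>+x. ennreal (norm (F k (x - s))) \<partial>lborel) = (\<integral>\<^sup>+x. ennreal (norm (F k x)) \<partial>lborel)"
      using nn_integral_real_affine[of "\<lambda>x. ennreal (norm (F k x))" 1 "-s"] by simp
    then show "(\<integral>\<^sup>+x. ennreal (lg s) * ennreal (norm (F k (x - s))) \<partial>lborel)
        = ennreal (lg s) * (\<integral>\<^sup>+x. ennreal (norm (F k x)) \<partial>lborel)"
      by (subst nn_integral_cmult) auto
  qed
  also have "\<dots> = ennreal \<Lambda> * (\<integral>\<^sup>+x. ennreal (norm (F k x)) \<partial>lborel)"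
    using nn_integral_eq_integral[OF lg_integrable] lg_nonneg
    by (subst nn_integral_multc) (auto simp: \<Lambda>_def)
  also have "\<dots> \<le> ennreal \<Lambda> * ennreal (4 * pi\<^sup>2 * B * \<Lambda> ^ k)" by (intro mult_left_mono Suc) auto
  also have "\<dots> = ennreal (4 * pi\<^sup>2 * B * \<Lambda> ^ Suc k)"
    using \<Lambda>_bounds B_nonneg by (subst ennreal_mult[symmetric]) (auto simp: mult_ac)
  finally show ?case .
qed

lemma F_L1_shift:
  "integrable lborel (\<lambda>s. norm (F k (x - s)))" "(LINT s|lborel. norm (F k (x - s))) \<le> 4 * pi\<^sup>2 * B * \<Lambda> ^ k"
proof -
  have i: "integrable lborel (\<lambda>s. norm (F k s))"
    by (rule integrableI_bounded) (use F_L1[of k] in \<open>auto simp: less_top[symmetric] top_unique\<close>)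
  have "ennreal (LINT s|lborel. norm (F k s)) \<le> ennreal (4 * pi\<^sup>2 * B * \<Lambda> ^ k)"
    using F_L1[of k] nn_integral_eq_integral[OF i] by simp
  then have le: "(LINT s|lborel. norm (F k s)) \<le> 4 * pi\<^sup>2 * B * \<Lambda> ^ k"
    using \<Lambda>_bounds B_nonneg by (simp add: ennreal_le_iff)
  show "integrable lborel (\<lambda>s. norm (F k (x - s)))"
    using lborel_integrable_real_affine[OF i, of "-1" x] by simp
  show "(LINT s|lborel. norm (F k (x - s))) \<le> 4 * pi\<^sup>2 * B * \<Lambda> ^ k"
    using le lborel_integral_real_affine[of "-1" "\<lambda>s. norm (F k s)" x] by simp
qed

text \<open>\<open>4 * pi\<^sup>2 * B\<close> is the \<open>L1\<close> bound of \<open>F 0\<close>,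
  and \<open>K\<^sup>2\<close> is lost when the density of a long jump is bounded by
  \<open>W\<close>. With this choice the two terms of the induction step below add up
  exactly.\<close>

definition D where "D = 4 * pi\<^sup>2 * B * K\<^sup>2"

lemma D_nonneg: "0 \<le> D"
  unfolding D_def using B_nonneg by simp

text \<open>If the jump is the large summand, its density is bounded by \<open>W\<close> and
  \<open>F k\<close> is integrated; otherwise the induction hypothesis bounds \<open>F k\<close> and
  the jumps are integrated. The factor \<open>1 + K * A\<close> per convolution is harmless against
  the factorials of the exponential series.\<close>

lemma F_le_W: "x \<noteq> 0 \<Longrightarrow> norm (F k x) \<le> D * (1 + K * A) ^ k * W \<bar>x\<bar>"
proof (induction k arbitrary: x)
  case 0
  then have x: "0 < \<bar>x\<bar>" by simp
  have "norm (F 0 x) \<le> norm (F 0 x) * (K * (1 + \<bar>x\<bar> ^ 3) * W \<bar>x\<bar>)"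
    using mult_left_mono[OF W_lower[OF x] norm_ge_zero, of "F 0 x"] by simp
  also have "\<dots> = (1 + \<bar>x\<bar> ^ 3) * norm (F 0 x) * (K * W \<bar>x\<bar>)" by (simp add: mult_ac)
  also have "\<dots> \<le> 2 * pi * B * (K * W \<bar>x\<bar>)"
    by (intro mult_right_mono F0_decay mult_nonneg_nonneg W_nonneg x) (use K in auto)
  also have "\<dots> \<le> D * W \<bar>x\<bar>"
  proof -
    have "2 * pi * B * K \<le> 4 * pi * pi * B * (K * K)"
      using mult_mono[of "2 * pi * B" "4 * pi * pi * B" K "K * K"] pi_ge_two K B_nonneg
        mult_right_mono[of "2 * pi" "4 * pi * pi" B] by simp
    then show ?thesis unfolding D_def using mult_right_mono[OF _ W_nonneg[OF x]]
      by (fastforce simp: power2_eq_square mult_ac)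
  qed
  finally show ?case by simp
next
  case (Suc k)
  then have x: "0 < \<bar>x\<bar>" by simp
  define R where "R = 1 + K * A"
  have R: "1 \<le> R" "A \<le> R" "0 \<le> R" unfolding R_def using K A_nonneg mult_right_mono[of 1 K A] by auto
  have W0: "0 \<le> W \<bar>x\<bar>" using W_nonneg[OF x] .
  have pt: "lg s * norm (F k (x - s)) \<le> (K\<^sup>2 * W \<bar>x\<bar>) * norm (F k (x - s)) + lg s * (D * R ^ k * (K * W \<bar>x\<bar>))" for s
  \<comment> \<open>For \<open>s < 1\<close> the function \<open>lg\<close> vanishes. In the other
    case \<open>s\<close> is positive and below \<open>\<bar>x\<bar> / 2\<close>, which keeps
    \<open>x - s\<close> away from 0.\<close>
  proof (cases "\<bar>x\<bar> / 2 \<le> s \<or> s < 1")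
    case True
    have "lg s \<le> K\<^sup>2 * W \<bar>x\<bar>"
    proof (cases "1 \<le> s")
      case 1: True
      then have h: "\<bar>x\<bar> / 2 \<le> s" using True by simp
      have "lg s \<le> K * W s" using m_le_W[OF 1] 1 by (simp add: lg_def)
      also have "\<dots> \<le> K * (K * W \<bar>x\<bar>)"
        using W_doubling[OF x h] K by (intro mult_left_mono) auto
      finally show ?thesis by (simp add: power2_eq_square mult.assoc)
    qed (use W0 in \<open>auto simp: lg_def\<close>)
    then have "lg s * norm (F k (x - s)) \<le> (K\<^sup>2 * W \<bar>x\<bar>) * norm (F k (x - s))"
      by (intro mult_right_mono) auto
    moreover have "0 \<le> lg s * (D * R ^ k * (K * W \<bar>x\<bar>))"
      using lg_nonneg[of s] D_nonneg R K W0 by simp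
    ultimately show ?thesis by linarith
  next
    case False
    then have h: "\<bar>x\<bar> / 2 \<le> \<bar>x - s\<bar>" by linarith
    then have "x - s \<noteq> 0" using x by linarith
    then have "norm (F k (x - s)) \<le> D * R ^ k * W \<bar>x - s\<bar>" using Suc.IH unfolding R_def by blast
    also have "\<dots> \<le> D * R ^ k * (K * W \<bar>x\<bar>)"
      using W_doubling[OF x h] D_nonneg R by (intro mult_left_mono) auto
    finally have "lg s * norm (F k (x - s)) \<le> lg s * (D * R ^ k * (K * W \<bar>x\<bar>))"
      by (intro mult_left_mono lg_nonneg)
    moreover have "0 \<le> (K\<^sup>2 * W \<bar>x\<bar>) * norm (F k (x - s))" using W0 by simp
    ultimately show ?thesis by linarith
  qed
  have "norm (F (Suc k) x) \<le> (LINT s|lborel. lg s * norm (F k (x - s)))" by (rule norm_F_Suc)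
  also have "\<dots> \<le> (LINT s|lborel. (K\<^sup>2 * W \<bar>x\<bar>) * norm (F k (x - s)) + lg s * (D * R ^ k * (K * W \<bar>x\<bar>)))"
    by (intro integral_mono lg_normF_integrable Bochner_Integration.integrable_add
        integrable_mult_right integrable_mult_left F_L1_shift lg_integrable pt)
  also have "\<dots> = K\<^sup>2 * W \<bar>x\<bar> * (LINT s|lborel. norm (F k (x - s))) + \<Lambda> * (D * R ^ k * (K * W \<bar>x\<bar>))"
    using F_L1_shift(1)[of k x] lg_integrable by (simp add: \<Lambda>_def)
  also have "\<dots> \<le> K\<^sup>2 * W \<bar>x\<bar> * (4 * pi\<^sup>2 * B * R ^ k) + A * (D * R ^ k * (K * W \<bar>x\<bar>))"
  proof (intro add_mono mult_left_mono mult_right_mono)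
    have "\<Lambda> ^ k \<le> R ^ k" using \<Lambda>_bounds R by (intro power_mono) auto
    then have "4 * pi\<^sup>2 * B * \<Lambda> ^ k \<le> 4 * pi\<^sup>2 * B * R ^ k"
      using B_nonneg by (intro mult_left_mono) auto
    then show "(LINT s|lborel. norm (F k (x - s))) \<le> 4 * pi\<^sup>2 * B * R ^ k"
      using F_L1_shift(2)[of k x] by linarith
  qed (use W0 K D_nonneg R \<Lambda>_bounds in auto)
  also have "\<dots> = D * R ^ Suc k * W \<bar>x\<bar>"
    unfolding D_def R_def by (simp add: algebra_simps)
  finally show ?case unfolding R_def .
qed

text \<open>Expanding \<open>exp \<kappa>\<close> and integrating term by term gives the series of
  \<open>F k x / k!\<close> with prefactor \<open>exp (- \<Lambda>)\<close>, which is at most 1 and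
  is dropped.\<close>

lemma fourier_integral_bound_W:
  assumes "x \<noteq> 0"
  shows "norm (CLINT y|lborel. iexp (-(y * x)) * exp (- compensated_exponent m y)) \<le> D * exp (1 + K * A) * W \<bar>x\<bar>"
proof -
  let ?f = "\<lambda>k y. iexp (-(y * x)) * (g0 y * \<kappa> y ^ k) /\<^sub>R fact k"
  have f_int: "integrable lborel (?f k)" for k
    by (intro integrable_scaleR_right Bochner_Integration.integrable_bound[OF g0_\<kappa>_integrable(1)[of k]])
       (auto simp: norm_mult intro!: AE_I2)
  have "(LINT y|lborel. norm (?f k y)) \<le> B * pi * (\<Lambda> ^ k /\<^sub>R fact k)" for k
    using g0_\<kappa>_integrable(2)[of k] by (simp add: norm_mult divide_simps mult_ac)
  then have f_sums: "summable (\<lambda>k. LINT y|lborel. norm (?f k y))"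
    by (intro summable_comparison_test[OF _ summable_mult[OF summable_exp_generic, of "B * pi" \<Lambda>]]) auto
  have pw: "(\<lambda>k. ?f k y) sums (iexp (-(y * x)) * g0 y * exp (\<kappa> y))" for y
    using sums_mult[OF exp_converges[of "\<kappa> y"], of "iexp (-(y * x)) * g0 y"] by (simp add: mult.assoc)
  have "(\<lambda>k. integral\<^sup>L lborel (?f k)) sums (CLINT y|lborel. \<Sum>k. ?f k y)"
  proof (rule sums_integral[OF f_int _ f_sums], rule AE_I2)
    fix y
    have "(\<lambda>k. norm (iexp (-(y * x)) * g0 y) * (norm (\<kappa> y) ^ k /\<^sub>R fact k)) sums (norm (iexp (-(y * x)) * g0 y) * exp (norm (\<kappa> y)))"
      by (intro sums_mult exp_converges)
    then show "summable (\<lambda>k. norm (?f k y))"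
      by (auto simp: norm_mult norm_power sums_iff mult.assoc mult.left_commute divide_inverse)
  qed
  moreover have "(\<Sum>k. ?f k y) = of_real (exp \<Lambda>) * (iexp (-(y * x)) * exp (- compensated_exponent m y))" for y
  proof -
    have "exp (- compensated_exponent m y) = g0 y * of_real (exp (- \<Lambda>)) * exp (\<kappa> y)"
      unfolding exponent_split g0_def by (simp only: exp_of_real[symmetric] exp_add[symmetric]) (simp add: algebra_simps)
    moreover have "of_real (exp \<Lambda>) * of_real (exp (- \<Lambda>)) = (1 :: complex)"
      by (simp add: exp_minus)
    ultimately show ?thesis using pw[of y] by (simp add: sums_iff mult_ac)
  qed
  moreover have "integral\<^sup>L lborel (?f k) = F k x /\<^sub>R fact k" for k
    by (simp add: F_def)
  ultimately have S: "(\<lambda>k. F k x /\<^sub>R fact k) sums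
      (of_real (exp \<Lambda>) * (CLINT y|lborel. iexp (-(y * x)) * exp (- compensated_exponent m y)))"
    by simp
  define R where "R = 1 + K * A"
  have Rs: "(\<lambda>k. D * W \<bar>x\<bar> * (R ^ k /\<^sub>R fact k)) sums (D * W \<bar>x\<bar> * exp R)"
    by (intro sums_mult exp_converges)
  have nb: "norm (F k x /\<^sub>R fact k) \<le> D * W \<bar>x\<bar> * (R ^ k /\<^sub>R fact k)" for k
    using F_le_W[OF assms, of k] by (simp add: R_def divide_simps mult_ac)
  have "norm (of_real (exp \<Lambda>) * (CLINT y|lborel. iexp (-(y * x)) * exp (- compensated_exponent m y))) \<le> D * W \<bar>x\<bar> * exp R"
    using norm_suminf_le[OF nb sums_summable[OF Rs]] S Rs by (simp add: sums_iff)
  moreover have "norm (CLINT y|lborel. iexp (-(y * x)) * exp (- compensated_exponent m y))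
      \<le> norm (of_real (exp \<Lambda>) * (CLINT y|lborel. iexp (-(y * x)) * exp (- compensated_exponent m y)))"
    using \<Lambda>_bounds(1) mult_right_mono[of 1 "exp \<Lambda>"] by (simp add: norm_mult)
  ultimately show ?thesis unfolding R_def by (simp add: mult_ac)
qed

end

section \<open>Functions derived from the jump density\<close>

lemma power_mult_exp_minus_le:
  fixes x :: real
  assumes "0 \<le> x" "0 < j"
  shows "x ^ j * exp (- x) \<le> real j ^ j"
proof -
  have "x / real j \<le> exp (x / real j)" using exp_ge_add_one_self[of "x / real j"] by linarith
  then have "(x / real j) ^ j \<le> exp (x / real j) ^ j" using assms by (intro power_mono) auto
  then have "x ^ j / real j ^ j \<le> exp x" using exp_divide_power_eq[of j x] assms by (simp add: power_divide)
  then show ?thesis using assms by (simp add: exp_minus field_simps)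
qed

lemma Re_iexp: "Re (iexp x) = cos x"
  by (simp add: Re_exp)

lemma one_minus_cos_upper: "1 - cos x \<le> 2 * min 1 ((x :: real)\<^sup>2)"
proof -
  have "\<bar>cos x - 1\<bar> \<le> x\<^sup>2 / 2"
    using order_trans[OF abs_Re_le_cmod iexp_approx1[of x 1]] Re_iexp[of x] by (simp add: power2_eq_square del: exp_of_real)
  then have "1 - cos x \<le> 2 * x\<^sup>2" using zero_le_power2[of x] by linarith
  moreover have "1 - cos x \<le> 2 * 1" using cos_ge_minus_one[of x] by linarith
  ultimately show ?thesis by (simp add: min_def)
qed

lemma one_minus_cos_lower:
  assumes "\<bar>x\<bar> \<le> 1" shows "x\<^sup>2 / 4 \<le> 1 - cos (x :: real)"
proof -
  have s: "(\<Sum>k\<le>3. (\<i> * complex_of_real x) ^ k / fact k) = 1 + \<i> * x - x\<^sup>2 / 2 - \<i> * x ^ 3 / 6"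
    by (simp add: numeral_3_eq_3 power2_eq_square power3_eq_cube fact_numeral algebra_simps eval_nat_numeral)
  have "\<bar>cos x - (1 - x\<^sup>2 / 2)\<bar> \<le> x ^ 4 / 24"
    using order_trans[OF abs_Re_le_cmod iexp_approx1[of x 3]] Re_iexp[of x] unfolding s
    by (simp add: fact_numeral eval_nat_numeral abs_mult_self_eq mult.assoc[symmetric])
  moreover have "x ^ 4 \<le> x\<^sup>2"
    using power_decreasing[of 2 4 "\<bar>x\<bar>"] assms by simp
  ultimately show ?thesis by linarith
qed

lemma half_square_exp_minus_le: "0 \<le> x \<Longrightarrow> x\<^sup>2 * exp (- x) / 2 \<le> 1 - exp (- x)" for x :: real
proof -
  assume "0 \<le> x"
  from exp_lower_Taylor_quadratic[OF this] have "x\<^sup>2 / 2 \<le> exp x - 1" using \<open>0 \<le> x\<close> by linarith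
  then have "x\<^sup>2 / 2 * exp (- x) \<le> (exp x - 1) * exp (- x)" by (intro mult_right_mono) auto
  then show ?thesis by (simp add: algebra_simps exp_minus_inverse flip: exp_add)
qed

lemma square_exp_minus_le: "0 \<le> x \<Longrightarrow> x\<^sup>2 * exp (- x) \<le> 2 * min 1 (x\<^sup>2)" for x :: real
proof -
  assume x: "0 \<le> x"
  have "x\<^sup>2 * exp (- x) \<le> 2" using half_square_exp_minus_le[OF x] exp_gt_zero[of "-x"] by linarith
  moreover have "x\<^sup>2 * exp (- x) \<le> x\<^sup>2 * 1" using x by (intro mult_left_mono) auto
  moreover have "x\<^sup>2 * exp (- x) \<le> 2 * x\<^sup>2" using calculation(2) zero_le_power2[of x] by linarith
  ultimately show ?thesis by (simp add: min_def)
qed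

text \<open>Made for the generalised inverses: at the first passage through the level
  \<open>s\<close> the running supremum of \<open>f\<close> also equals \<open>s\<close>, so the set
  defining the inverse is nonempty.\<close>

lemma attains_value_first:
  fixes f :: "real \<Rightarrow> real"
  assumes cont: "continuous_on {0..} f" and "f 0 = 0" "0 < s" "0 \<le> y" "s \<le> f y"
  obtains z where "0 < z" "f z = s" "\<And>x. 0 \<le> x \<Longrightarrow> x \<le> z \<Longrightarrow> f x \<le> s"
proof -
  define S where "S = {x \<in> {0..}. s \<le> f x}"
  have "closed S"
  proof -
    have "S = {0..} \<inter> f -` {s..}" by (auto simp: S_def)
    then show ?thesis using continuous_closed_preimage[OF cont, of "{s..}"] by simp
  qed
  moreover have "S \<noteq> {}" "bdd_below S" using assms by (auto simp: S_def bdd_below_def)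
  ultimately have zS: "Inf S \<in> S" by (intro closed_contains_Inf)
  let ?z = "Inf S"
  have below: "f x < s" if "0 \<le> x" "x < ?z" for x
    using that cInf_lower[OF _ \<open>bdd_below S\<close>, of x] by (fastforce simp: S_def)
  have "0 < ?z" using zS assms by (cases "?z = 0") (auto simp: S_def less_le)
  moreover have "f ?z = s"
  proof (rule ccontr)
    assume "f ?z \<noteq> s"
    then have gt: "s < f ?z" using zS by (auto simp: S_def)
    obtain x where "0 \<le> x" "x \<le> ?z" "f x = s"
      using IVT'[of f 0 s ?z] assms zS gt continuous_on_subset[OF cont, of "{0..?z}"] by (auto simp: S_def)
    then show False using below[of x] gt by (cases "x = ?z") auto
  qed
  moreover have "f x \<le> s" if "0 \<le> x" "x \<le> ?z" for x
    using below[OF that(1)] calculation(2) that(2) by (cases "x = ?z") auto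
  ultimately show ?thesis using that by blast
qed

locale levy_density =
  fixes k :: "real \<Rightarrow> real"
  assumes k_meas [measurable]: "k \<in> borel_measurable borel"
    and k_nonneg: "\<And>s. 0 \<le> k s"
    and k_neg: "\<And>s. s \<le> 0 \<Longrightarrow> k s = 0"
    and k_int: "integrable lborel (\<lambda>s. k s * min 1 s)"
begin

lemma integrable_k:
  fixes f :: "real \<Rightarrow> 'b :: {banach, second_countable_topology}"
  assumes [measurable]: "f \<in> borel_measurable borel" and b: "\<And>s. 0 < s \<Longrightarrow> norm (f s) \<le> C * min 1 s"
  shows "integrable lborel (\<lambda>s. k s *\<^sub>R f s)"
proof (rule Bochner_Integration.integrable_bound[OF integrable_mult_right[OF k_int, of C]])
  show "AE s in lborel. norm (k s *\<^sub>R f s) \<le> norm (C * (k s * min 1 s))"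
  proof (rule AE_I2)
    fix s
    show "norm (k s *\<^sub>R f s) \<le> norm (C * (k s * min 1 s))"
    proof (cases "0 < s")
      case True
      have "k s * norm (f s) \<le> k s * (C * min 1 s)" by (intro mult_left_mono b True k_nonneg)
      also have "\<dots> = C * (k s * min 1 s)" by simp
      also have "\<dots> \<le> norm (C * (k s * min 1 s))" by simp
      finally show ?thesis using k_nonneg[of s] by simp
    qed (simp add: k_neg)
  qed
qed measurable

lemma integral_k_mono:
  fixes f g :: "real \<Rightarrow> real"
  assumes "\<And>s. 0 < s \<Longrightarrow> f s \<le> g s" "\<And>s. 0 < s \<Longrightarrow> 0 \<le> g s" "integrable lborel (\<lambda>s. k s * g s)"
  shows "(LINT s|lborel. k s * f s) \<le> (LINT s|lborel. k s * g s)"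
proof (rule integral_mono'[OF assms(3)])
  show "k s * f s \<le> k s * g s" "0 \<le> k s * g s" for s
    using assms(1,2)[of s] k_nonneg[of s] k_neg[of s] by (cases "0 < s"; auto intro: mult_left_mono)+
qed

lemma integral_k_nonneg:
  fixes f :: "real \<Rightarrow> real"
  assumes "\<And>s. 0 < s \<Longrightarrow> 0 \<le> f s"
  shows "0 \<le> (LINT s|lborel. k s * f s)"
proof (rule Bochner_Integration.integral_nonneg)
  show "0 \<le> k s * f s" for s using assms[of s] k_nonneg[of s] k_neg[of s] by (cases "0 < s") auto
qed

lemma power_exp_le:
  assumes "0 < j" "0 < a" "a \<le> u" "0 < s"
  shows "\<bar>s ^ j * exp (- (u * s))\<bar> \<le> (1 + real j ^ j / a ^ j) * min 1 s"
proof -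
  have e: "exp (- (u * s)) \<le> exp (- (a * s))" using assms by (simp add: mult_right_mono)
  have p: "s ^ j * exp (- (a * s)) \<le> real j ^ j / a ^ j"
    using power_mult_exp_minus_le[of "a * s" j] assms by (simp add: power_mult_distrib field_simps)
  have c: "0 \<le> real j ^ j / a ^ j" using assms by simp
  have "s ^ j * exp (- (u * s)) \<le> (1 + real j ^ j / a ^ j) * min 1 s"
  proof (cases "s \<le> 1")
    case True
    have "s ^ j \<le> s" using assms True power_decreasing[of 1 j s] by simp
    then have "s ^ j * exp (- (u * s)) \<le> s * 1" using assms by (intro mult_mono) auto
    also have "\<dots> \<le> (1 + real j ^ j / a ^ j) * s" using c assms by (simp add: distrib_right)
    finally show ?thesis using True by (simp add: min_def)
  next
    case False
    have "s ^ j * exp (- (u * s)) \<le> s ^ j * exp (- (a * s))" using e assms by (intro mult_left_mono) auto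
    also have "\<dots> \<le> 1 + real j ^ j / a ^ j" using p by linarith
    finally show ?thesis using False by (simp add: min_def)
  qed
  then show ?thesis using assms by (simp add: abs_mult)
qed

text \<open>In the notation of the theorem, \<open>\<phi> u = b u + \<Phi> u\<close>, \<open>\<phi>' = b + P 1\<close>, \<open>- \<phi>'' = P 2\<close>,
  \<open>V\<close> is \<open>vphi \<phi>\<close>, \<open>Vs\<close> is \<open>vphi_star \<phi>\<close>, \<open>\<rho>\<close> is the real part of \<open>\<psi>\<close> and \<open>\<rho>s\<close> is
  \<open>psi_star \<psi>\<close>; \<open>h\<close> is the concentration function that they are compared with.\<close>

definition P where "P j u = (LINT s|lborel. k s * (s ^ j * exp (- (u * s))))" for j :: nat and u :: real

lemma P_integrable: "0 < j \<Longrightarrow> 0 < u \<Longrightarrow> integrable lborel (\<lambda>s. k s * (s ^ j * exp (- (u * s))))"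
proof -
  assume "0 < j" "0 < u"
  then have "integrable lborel (\<lambda>s. k s *\<^sub>R (s ^ j * exp (- (u * s))))"
    by (intro integrable_k[where C="1 + real j ^ j / u ^ j"]) (use power_exp_le[of j u u] in auto)
  then show ?thesis by simp
qed

lemma P_derivative:
  assumes "0 < j" "0 < u"
  shows "(P j has_real_derivative - P (Suc j) u) (at u)"
proof -
  have "((\<lambda>u. LINT s|lborel. k s * (s ^ j * exp (- (u * s)))) has_vector_derivative
      (LINT s|lborel. - (k s * (s ^ Suc j * exp (- (u * s)))))) (at u)"
  proof (rule has_vector_derivative_integral_dominated[where e="u / 2"
        and g="\<lambda>s. k s * (s ^ Suc j * exp (- (u / 2 * s)))" and f'="\<lambda>u s. - (k s * (s ^ Suc j * exp (- (u * s))))"])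
    fix x s :: real
    assume x: "x \<in> ball u (u / 2)"
    then have "\<bar>u - x\<bar> < u / 2" by (simp add: dist_real_def)
    then have xu: "u / 2 \<le> x" by linarith
    show "integrable lborel (\<lambda>s. k s * (s ^ j * exp (- (x * s))))"
      using P_integrable[OF assms(1), of x] xu assms by simp
    show "((\<lambda>x. k s * (s ^ j * exp (- (x * s)))) has_vector_derivative - (k s * (s ^ Suc j * exp (- (x * s))))) (at x)"
      by (auto intro!: derivative_eq_intros simp: has_real_derivative_iff_has_vector_derivative[symmetric])
    show "norm (- (k s * (s ^ Suc j * exp (- (x * s))))) \<le> k s * (s ^ Suc j * exp (- (u / 2 * s)))"
    proof (cases "0 < s")
      case True
      have "exp (- (x * s)) \<le> exp (- (u / 2 * s))" using mult_right_mono[OF xu, of s] True by simp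
      then have "k s * (s ^ Suc j * exp (- (x * s))) \<le> k s * (s ^ Suc j * exp (- (u / 2 * s)))"
        using True k_nonneg[of s] by (intro mult_left_mono) auto
      then show ?thesis using True k_nonneg[of s] by (simp add: abs_mult)
    qed (simp add: k_neg)
  qed (use assms P_integrable[of "Suc j" "u / 2"] in auto)
  then show ?thesis
    unfolding P_def[abs_def] by (simp add: has_real_derivative_iff_has_vector_derivative)
qed

lemma P_nonneg: "0 \<le> P j u"
  unfolding P_def by (rule integral_k_nonneg) simp

lemma P_antimono: "0 < j \<Longrightarrow> 0 < u \<Longrightarrow> u \<le> v \<Longrightarrow> P j v \<le> P j u"
  unfolding P_def by (rule integral_k_mono) (auto intro!: P_integrable mult_left_mono)

lemma one_minus_exp_le: assumes "0 \<le> u" "0 < s" shows "\<bar>1 - exp (- (u * s))\<bar> \<le> (1 + u) * min 1 (s :: real)"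
proof -
  have "1 - exp (- (u * s)) \<le> u * s" using exp_ge_add_one_self[of "- (u * s)"] by simp
  moreover have "0 \<le> u * s" "u * s \<le> (1 + u) * s" using assms by (auto simp: distrib_right)
  moreover have "1 - exp (- (u * s)) \<le> 1 + u" "0 \<le> 1 - exp (- (u * s))"
    using exp_gt_zero[of "- (u * s)"] assms by (auto simp del: exp_gt_zero)
  ultimately show ?thesis by (cases "s \<le> 1") (auto simp: min_def)
qed

lemma \<Phi>_integrable: assumes "0 \<le> u" shows "integrable lborel (\<lambda>s. k s * (1 - exp (- (u * s))))"
proof -
  have "integrable lborel (\<lambda>s. k s *\<^sub>R (1 - exp (- (u * s))))"
    by (rule integrable_k[where C="1 + u"]) (use one_minus_exp_le[OF assms] in auto)
  then show ?thesis by simp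
qed

definition \<Phi> where "\<Phi> u = (LINT s|lborel. k s * (1 - exp (- (u * s))))" for u :: real

lemma \<Phi>_derivative:
  assumes "0 < u"
  shows "(\<Phi> has_real_derivative P 1 u) (at u)"
proof -
  have "((\<lambda>u. LINT s|lborel. k s * (1 - exp (- (u * s)))) has_vector_derivative
      (LINT s|lborel. k s * (s ^ 1 * exp (- (u * s))))) (at u)"
  proof (rule has_vector_derivative_integral_dominated[where e="u / 2"
        and g="\<lambda>s. k s * (s ^ 1 * exp (- (u / 2 * s)))" and f'="\<lambda>u s. k s * (s ^ 1 * exp (- (u * s)))"])
    fix x s :: real
    assume x: "x \<in> ball u (u / 2)"
    then have "\<bar>u - x\<bar> < u / 2" by (simp add: dist_real_def)
    then have xu: "u / 2 \<le> x" by linarith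
    show "integrable lborel (\<lambda>s. k s * (1 - exp (- (x * s))))"
      using \<Phi>_integrable[of x] xu assms by simp
    show "((\<lambda>x. k s * (1 - exp (- (x * s)))) has_vector_derivative k s * (s ^ 1 * exp (- (x * s)))) (at x)"
      by (auto intro!: derivative_eq_intros simp: has_real_derivative_iff_has_vector_derivative[symmetric])
    show "norm (k s * (s ^ 1 * exp (- (x * s)))) \<le> k s * (s ^ 1 * exp (- (u / 2 * s)))"
    proof (cases "0 < s")
      case True
      have "exp (- (x * s)) \<le> exp (- (u / 2 * s))" using mult_right_mono[OF xu, of s] True by simp
      then have "k s * (s ^ 1 * exp (- (x * s))) \<le> k s * (s ^ 1 * exp (- (u / 2 * s)))"
        using True k_nonneg[of s] by (intro mult_left_mono) auto
      then show ?thesis using True k_nonneg[of s] by (simp add: abs_mult)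
    qed (simp add: k_neg)
  qed (use assms P_integrable[of 1 "u / 2"] in auto)
  then show ?thesis
    unfolding \<Phi>_def[abs_def] P_def by (simp add: has_real_derivative_iff_has_vector_derivative)
qed

definition V where "V u = u\<^sup>2 * P 2 u" for u :: real

lemma V_nonneg: "0 \<le> V u" unfolding V_def using P_nonneg by simp

lemma V_eq: "V u = (LINT s|lborel. k s * ((u * s)\<^sup>2 * exp (- (u * s))))"
  unfolding V_def P_def by (simp add: power_mult_distrib mult_ac flip: integral_mult_right_zero)

lemma continuous_on_V: "continuous_on {0<..} V"
proof -
  have "continuous_on {0<..} (P 2)"
    by (rule continuous_at_imp_continuous_on) (auto intro!: DERIV_isCont[OF P_derivative])
  then show ?thesis unfolding V_def[abs_def] by (intro continuous_intros)
qed

text \<open>\<open>P 2\<close> decreases, so only the factor \<open>u\<^sup>2\<close> can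
  grow.\<close>

lemma V_scale_upper: assumes "0 < u" "1 \<le> l" shows "V (l * u) \<le> l\<^sup>2 * V u"
proof -
  have "P 2 (l * u) \<le> P 2 u" using assms by (intro P_antimono) (auto simp: mult_le_cancel_right1)
  then have "(l\<^sup>2 * u\<^sup>2) * P 2 (l * u) \<le> (l\<^sup>2 * u\<^sup>2) * P 2 u" by (intro mult_left_mono) auto
  then show ?thesis by (simp add: V_def power_mult_distrib mult_ac)
qed

definition h where "h u = (LINT s|lborel. k s * min 1 ((u * s)\<^sup>2))" for u :: real

lemma min_square_le: assumes "0 < s" shows "min 1 ((u * s)\<^sup>2) \<le> (1 + u\<^sup>2) * min 1 (s :: real)"
proof (cases "s \<le> 1")
  case True
  have "(u * s)\<^sup>2 \<le> u\<^sup>2 * s" using True assms power_decreasing[of 1 2 s] by (simp add: power_mult_distrib mult_left_mono)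
  also have "\<dots> \<le> (1 + u\<^sup>2) * s" using assms by (simp add: distrib_right)
  finally show ?thesis using True by (simp add: min_def)
next
  case False
  then have "(1 + u\<^sup>2) * min 1 s = 1 + u\<^sup>2" by (simp add: min_def)
  then show ?thesis using min.cobounded1[of 1 "(u * s)\<^sup>2"] zero_le_power2[of u] by linarith
qed

lemma h_integrable: "integrable lborel (\<lambda>s. k s * min 1 ((u * s)\<^sup>2))"
proof -
  have "integrable lborel (\<lambda>s. k s *\<^sub>R min 1 ((u * s)\<^sup>2))"
    by (rule integrable_k[where C="1 + u\<^sup>2"]) (use min_square_le in auto)
  then show ?thesis by simp
qed

lemma h_nonneg: "0 \<le> h u" unfolding h_def by (rule integral_k_nonneg) simp

lemma h_mono: assumes "0 \<le> u" "u \<le> v" shows "h u \<le> h v"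
  unfolding h_def
proof (rule integral_k_mono[OF _ _ h_integrable])
  fix s :: real assume "0 < s"
  then have "(u * s)\<^sup>2 \<le> (v * s)\<^sup>2" using assms by (intro power_mono mult_right_mono) auto
  then show "min 1 ((u * s)\<^sup>2) \<le> min 1 ((v * s)\<^sup>2)" by auto
qed auto

lemma h_scale_upper: assumes "1 \<le> l" shows "h (l * u) \<le> l\<^sup>2 * h u"
proof -
  have "h (l * u) \<le> (LINT s|lborel. k s * (l\<^sup>2 * min 1 ((u * s)\<^sup>2)))"
    unfolding h_def
  proof (rule integral_k_mono)
    fix s :: real
    have "1 \<le> l\<^sup>2" using assms by (simp add: one_le_power)
    then show "min 1 ((l * u * s)\<^sup>2) \<le> l\<^sup>2 * min 1 ((u * s)\<^sup>2)"
      by (auto simp: min_def power_mult_distrib)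
    show "integrable lborel (\<lambda>s. k s * (l\<^sup>2 * min 1 ((u * s)\<^sup>2)))"
      using integrable_mult_right[OF h_integrable, of "l\<^sup>2" u] by (simp add: mult_ac)
  qed simp
  also have "\<dots> = l\<^sup>2 * h u" unfolding h_def by (simp add: mult_ac flip: integral_mult_right_zero)
  finally show ?thesis .
qed

lemma V_le_h: assumes "0 < u" shows "V u \<le> 2 * h u"
proof -
  have "V u \<le> (LINT s|lborel. k s * (2 * min 1 ((u * s)\<^sup>2)))"
    unfolding V_eq
  proof (rule integral_k_mono)
    show "(u * s)\<^sup>2 * exp (- (u * s)) \<le> 2 * min 1 ((u * s)\<^sup>2)" if "0 < s" for s
      using square_exp_minus_le[of "u * s"] that assms by simp
    show "integrable lborel (\<lambda>s. k s * (2 * min 1 ((u * s)\<^sup>2)))"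
      using integrable_mult_right[OF h_integrable, of 2 u] by (simp add: mult_ac)
  qed simp
  also have "\<dots> = 2 * h u" unfolding h_def by (simp add: mult_ac flip: integral_mult_right_zero)
  finally show ?thesis .
qed

lemma V_le_\<Phi>: assumes "0 < u" shows "V u \<le> 2 * \<Phi> u"
proof -
  have "V u \<le> (LINT s|lborel. k s * (2 * (1 - exp (- (u * s)))))"
    unfolding V_eq
  proof (rule integral_k_mono)
    show "(u * s)\<^sup>2 * exp (- (u * s)) \<le> 2 * (1 - exp (- (u * s)))" if "0 < s" for s
      using half_square_exp_minus_le[of "u * s"] that assms by simp
    show "integrable lborel (\<lambda>s. k s * (2 * (1 - exp (- (u * s)))))"
      using integrable_mult_right[OF \<Phi>_integrable[of u], of 2] assms
        by (simp only: mult.left_commute[of "2 :: real"] less_imp_le)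
  qed (use assms in auto)
  also have "\<dots> = 2 * \<Phi> u" unfolding \<Phi>_def by (simp add: mult_ac flip: integral_mult_right_zero)
  finally show ?thesis .
qed

lemma \<Phi>_mono: "0 \<le> u \<Longrightarrow> u \<le> v \<Longrightarrow> \<Phi> u \<le> \<Phi> v"
  unfolding \<Phi>_def by (rule integral_k_mono) (auto intro!: \<Phi>_integrable)

lemma \<Phi>_double: assumes "0 \<le> u" shows "\<Phi> (2 * u) \<le> 2 * \<Phi> u"
proof -
  have "\<Phi> (2 * u) \<le> (LINT s|lborel. k s * (2 * (1 - exp (- (u * s)))))"
    unfolding \<Phi>_def
  proof (rule integral_k_mono)
    fix s :: real
    have "0 \<le> (1 - exp (- (u * s)))\<^sup>2" by simp
    then show "1 - exp (- (2 * u * s)) \<le> 2 * (1 - exp (- (u * s)))"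
      by (simp add: power2_eq_square algebra_simps flip: exp_add)
    show "integrable lborel (\<lambda>s. k s * (2 * (1 - exp (- (u * s)))))"
      using integrable_mult_right[OF \<Phi>_integrable[of u], of 2] assms
        by (simp only: mult.left_commute[of "2 :: real"] less_imp_le)
  qed (use assms in auto)
  also have "\<dots> = 2 * \<Phi> u" unfolding \<Phi>_def by (simp add: mult_ac flip: integral_mult_right_zero)
  finally show ?thesis .
qed

text \<open>By dominated convergence \<open>h\<close> vanishes at the origin. This makes
  \<open>V\<close> continuous there and supplies points where \<open>h\<close> lies below a
  prescribed level.\<close>

lemma h_small: assumes "0 < e" obtains x where "0 < x" "x \<le> 1" "h x < e"
proof -
  have "(\<lambda>n. h (1 / real (Suc n))) \<longlonglongrightarrow> (LINT s|lborel. k s * min 1 ((0 * s)\<^sup>2))"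
    unfolding h_def
  proof (rule integral_dominated_convergence[where w="\<lambda>s. k s * min 1 ((1 * s)\<^sup>2)"])
    show "AE s in lborel. (\<lambda>n. k s * min 1 ((1 / real (Suc n) * s)\<^sup>2)) \<longlonglongrightarrow> k s * min 1 ((0 * s)\<^sup>2)"
      by (intro AE_I2 tendsto_intros LIMSEQ_Suc[OF lim_1_over_n])
    show "AE s in lborel. norm (k s * min 1 ((1 / real (Suc n) * s)\<^sup>2)) \<le> k s * min 1 ((1 * s)\<^sup>2)" for n
    proof (rule AE_I2)
      fix s :: real
      have "(1 / real (Suc n) * s)\<^sup>2 \<le> (1 * s)\<^sup>2"
      proof (rule abs_le_square_iff[THEN iffD1])
        have "1 / real (Suc n) * \<bar>s\<bar> \<le> 1 * \<bar>s\<bar>" by (intro mult_right_mono) auto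
        then show "\<bar>1 / real (Suc n) * s\<bar> \<le> \<bar>1 * s\<bar>" by (simp add: abs_mult)
      qed
      then have "min 1 ((1 / real (Suc n) * s)\<^sup>2) \<le> min 1 ((1 * s)\<^sup>2)" by auto
      then show "norm (k s * min 1 ((1 / real (Suc n) * s)\<^sup>2)) \<le> k s * min 1 ((1 * s)\<^sup>2)"
        using k_nonneg[of s] by (auto simp: abs_mult intro!: mult_left_mono)
    qed
  qed (use h_integrable[of 1] in auto)
  then have "(\<lambda>n. h (1 / real (Suc n))) \<longlonglongrightarrow> 0" by simp
  from order_tendstoD(2)[OF this assms] obtain n where "h (1 / real (Suc n)) < e"
    by (auto simp: eventually_sequentially)
  then show ?thesis using that[of "1 / real (Suc n)"] by simp
qed

definition \<rho> where "\<rho> y = (LINT s|lborel. k s * (1 - cos (y * s)))" for y :: real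

lemma \<rho>_integrable: "integrable lborel (\<lambda>s. k s * (1 - cos (y * s)))"
proof -
  have "integrable lborel (\<lambda>s. k s *\<^sub>R (1 - cos (y * s)))"
  proof (rule integrable_k[where C="2 * (1 + y\<^sup>2)"])
    fix s :: real assume "0 < s"
    then have "1 - cos (y * s) \<le> 2 * ((1 + y\<^sup>2) * min 1 s)"
      using one_minus_cos_upper[of "y * s"] min_square_le[of s y] by linarith
    then show "norm (1 - cos (y * s)) \<le> 2 * (1 + y\<^sup>2) * min 1 s"
      by (simp only: mult.assoc real_norm_def abs_of_nonneg[of "1 - cos (y * s)"] diff_ge_0_iff_ge cos_le_one)
  qed measurable
  then show ?thesis by simp
qed

lemma \<rho>_nonneg: "0 \<le> \<rho> y" unfolding \<rho>_def by (rule integral_k_nonneg) simp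

lemma \<rho>_le_h: "\<rho> y \<le> 2 * h y"
proof -
  have "\<rho> y \<le> (LINT s|lborel. k s * (2 * min 1 ((y * s)\<^sup>2)))"
    unfolding \<rho>_def
  proof (rule integral_k_mono)
    show "integrable lborel (\<lambda>s. k s * (2 * min 1 ((y * s)\<^sup>2)))"
      using integrable_mult_right[OF h_integrable, of 2 y] by (simp add: mult_ac)
  qed (use one_minus_cos_upper in auto)
  also have "\<dots> = 2 * h y" unfolding h_def by (simp add: mult_ac flip: integral_mult_right_zero)
  finally show ?thesis .
qed

lemma \<rho>_abs: "\<rho> \<bar>y\<bar> = \<rho> y"
  unfolding \<rho>_def by (cases "0 \<le> y") auto

lemma continuous_\<rho>: "continuous_on UNIV \<rho>"
proof (rule continuous_at_imp_continuous_on, rule ballI)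
  fix y :: real
  show "isCont \<rho> y"
    unfolding continuous_at_sequentially o_def
  proof (intro allI impI)
    fix X assume X: "X \<longlonglongrightarrow> y"
    then obtain N where N: "\<And>n. N \<le> n \<Longrightarrow> \<bar>X n\<bar> \<le> \<bar>y\<bar> + 1"
      using LIMSEQ_D[OF X, of 1] by fastforce
    have "(\<lambda>n. \<rho> (X (n + N))) \<longlonglongrightarrow> \<rho> y"
      unfolding \<rho>_def
    proof (rule integral_dominated_convergence[where w="\<lambda>s. 2 * (k s * min 1 (((\<bar>y\<bar> + 1) * s)\<^sup>2))"])
      show "AE s in lborel. (\<lambda>n. k s * (1 - cos (X (n + N) * s))) \<longlonglongrightarrow> k s * (1 - cos (y * s))"
        by (intro AE_I2 tendsto_intros LIMSEQ_ignore_initial_segment X)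
      show "AE s in lborel. norm (k s * (1 - cos (X (n + N) * s))) \<le> 2 * (k s * min 1 (((\<bar>y\<bar> + 1) * s)\<^sup>2))" for n
      proof (rule AE_I2)
        fix s :: real
        have "(X (n + N) * s)\<^sup>2 \<le> ((\<bar>y\<bar> + 1) * s)\<^sup>2"
          using N[of "n + N"] by (simp add: power_mult_distrib mult_right_mono abs_le_square_iff[symmetric])
        then have "min 1 ((X (n + N) * s)\<^sup>2) \<le> min 1 (((\<bar>y\<bar> + 1) * s)\<^sup>2)" by auto
        then have "1 - cos (X (n + N) * s) \<le> 2 * min 1 (((\<bar>y\<bar> + 1) * s)\<^sup>2)"
          using one_minus_cos_upper[of "X (n + N) * s"] by linarith
        then have "k s * (1 - cos (X (n + N) * s)) \<le> k s * (2 * min 1 (((\<bar>y\<bar> + 1) * s)\<^sup>2))"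
          using k_nonneg[of s] by (intro mult_left_mono)
        then show "norm (k s * (1 - cos (X (n + N) * s))) \<le> 2 * (k s * min 1 (((\<bar>y\<bar> + 1) * s)\<^sup>2))"
          using k_nonneg[of s] by (simp add: abs_mult mult_ac)
      qed
    qed (use h_integrable in auto)
    then show "(\<lambda>n. \<rho> (X n)) \<longlonglongrightarrow> \<rho> y" by (rule LIMSEQ_offset)
  qed
qed

end

section \<open>Consequences of weak lower scaling\<close>

lemma integral_powr_tail:
  fixes \<alpha> u :: real
  assumes "0 < \<alpha>" "0 < u"
  shows "integrable lborel (\<lambda>s. indicator {1 / u..} s * ((u * s) powr (- \<alpha>) / s))"
    "(LINT s|lborel. indicator {1 / u..} s * ((u * s) powr (- \<alpha>) / s)) = 1 / \<alpha>"
proof -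
  let ?f = "\<lambda>s. (u * s) powr (- \<alpha>) / s"
  have F: "(\<integral>\<^sup>+s. ennreal (?f s) * indicator {1 / u..} s \<partial>lborel) = ennreal (0 - (- ((u * (1 / u)) powr (- \<alpha>) / \<alpha>)))"
  proof (rule nn_integral_FTC_atLeast)
    fix s assume s: "1 / u \<le> s"
    then have "0 < s" using assms by (meson divide_pos_pos less_le_trans zero_less_one)
    then show "((\<lambda>s. - ((u * s) powr (- \<alpha>) / \<alpha>)) has_real_derivative ?f s) (at s)"
      using assms by (auto intro!: derivative_eq_intros simp: powr_diff powr_minus field_simps)
    show "0 \<le> ?f s" using \<open>0 < s\<close> by simp
  next
    have "((\<lambda>s. (u * s) powr (- \<alpha>)) \<longlongrightarrow> 0) at_top"
      using assms by (intro tendsto_neg_powr filterlim_tendsto_pos_mult_at_top[OF tendsto_const] filterlim_ident) auto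
    then have "((\<lambda>s. - ((u * s) powr (- \<alpha>) / \<alpha>)) \<longlongrightarrow> - (0 / \<alpha>)) at_top"
      using assms by (intro tendsto_minus tendsto_divide tendsto_const) auto
    then show "((\<lambda>s. - ((u * s) powr (- \<alpha>) / \<alpha>)) \<longlongrightarrow> 0) at_top" by simp
  qed measurable
  have nn: "(\<integral>\<^sup>+s. ennreal (indicator {1 / u..} s * ?f s) \<partial>lborel) = ennreal (1 / \<alpha>)"
  proof -
    have "(\<integral>\<^sup>+s. ennreal (indicator {1 / u..} s * ?f s) \<partial>lborel) = (\<integral>\<^sup>+s. ennreal (?f s) * indicator {1 / u..} s \<partial>lborel)"
      by (rule nn_integral_cong) (simp split: split_indicator)
    then show ?thesis using F assms by simp
  qed
  have pos: "0 \<le> indicator {1 / u..} s * ?f s" for s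
  proof (cases "1 / u \<le> s")
    case True
    then have "0 < s" using assms by (meson divide_pos_pos less_le_trans zero_less_one)
    then show ?thesis by simp
  qed simp
  show "integrable lborel (\<lambda>s. indicator {1 / u..} s * ?f s)"
    by (rule integrableI_nn_integral_finite[OF _ _ nn]) (use pos in auto)
  show "(LINT s|lborel. indicator {1 / u..} s * ?f s) = 1 / \<alpha>"
    using nn pos assms by (subst integral_eq_nn_integral) auto
qed

text \<open>If one of these integrals vanishes, then \<open>k\<close> is zero almost everywhere on
  the positive half-line and all of them vanish. Hence one point with nonzero second derivative
  makes \<open>P 2\<close> positive everywhere.\<close>

lemma (in levy_density) P_pos:
  assumes "0 < i" "0 < x" "P i x \<noteq> 0" "0 < j" "0 < u" shows "0 < P j u"
proof (rule ccontr)
  assume "\<not> 0 < P j u"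
  then have 0: "P j u = 0" using P_nonneg[of j u] by linarith
  have nn: "0 \<le> k s * (s ^ j * exp (- (u * s)))" for s
    using k_nonneg[of s] k_neg[of s] by (cases "0 < s") auto
  have "AE s in lborel. k s * (s ^ j * exp (- (u * s))) = 0"
    using integral_nonneg_eq_0_iff_AE[OF P_integrable[of j u]] 0 assms(4,5) nn by (simp add: P_def)
  then have "AE s in lborel. k s * (s ^ i * exp (- (x * s))) = 0"
    by eventually_elim (use assms(1) in auto)
  then have "P i x = 0" unfolding P_def by (rule integral_eq_zero_AE)
  then show False using assms by simp
qed

text \<open>Between \<open>x1\<close> and \<open>2 * x0\<close> the decreasing function
  \<open>P 2\<close> stays between two positive constants, so \<open>V\<close> behaves like a square
  there, and every index up to 2 is admissible at the price of a smaller constant. The index is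
  therefore cut down to \<open>min \<alpha> 2\<close>.\<close>

lemma (in levy_density) scaling_extend:
  assumes pos: "\<And>u. 0 < u \<Longrightarrow> 0 < P 2 u" and "0 < \<alpha>" "0 < c" "0 < x1" "x1 \<le> x0"
    and scale: "\<And>x l. x0 < x \<Longrightarrow> 1 \<le> l \<Longrightarrow> c * l powr \<alpha> * V x \<le> V (l * x)"
  obtains \<alpha>' c' where "0 < \<alpha>'" "0 < c'"
    "\<And>x l. x1 \<le> x \<Longrightarrow> 1 \<le> l \<Longrightarrow> c' * l powr \<alpha>' * V x \<le> V (l * x)"
proof -
  define a where "a = min \<alpha> 2"
  define c1 where "c1 = P 2 (2 * x0) / P 2 x1"
  define c2 where "c2 = c * (x1 / (2 * x0)) powr a * V (2 * x0) / (x0\<^sup>2 * P 2 x1)"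
  define c' where "c' = min c (min c1 c2)"
  have x0: "0 < x0" using assms by linarith
  have a: "0 < a" "a \<le> \<alpha>" "a \<le> 2" using assms by (auto simp: a_def)
  have Vpos: "0 < V u" if "0 < u" for u using pos[OF that] that by (simp add: V_def)
  have "0 < c1" "0 < c2" unfolding c1_def c2_def using pos Vpos assms x0 by auto
  then have c': "0 < c'" "c' \<le> c" "c' \<le> c1" "c' \<le> c2" using assms by (auto simp: c'_def)
  have scale_a: "c * l powr a * V x \<le> V (l * x)" if "x0 < x" "1 \<le> l" for x l
  proof -
    have "l powr a \<le> l powr \<alpha>" using that a by (intro powr_mono) auto
    then have "c * l powr a * V x \<le> c * l powr \<alpha> * V x"
      using assms V_nonneg by (intro mult_right_mono mult_left_mono) auto
    then show ?thesis using scale[OF that] by linarith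
  qed
  have "c' * l powr a * V x \<le> V (l * x)" if x: "x1 \<le> x" and l: "1 \<le> l" for x l
  proof -
    have la: "0 \<le> l powr a * V x" using V_nonneg by simp
    \<comment> \<open>The threshold is \<open>2 * x0\<close> because scaling is assumed only
      strictly above \<open>x0\<close>. In the last case scaling starts from \<open>2 * x0\<close>,
      and \<open>c2\<close> pays for the way from \<open>x\<close> to there.\<close>
    consider "x0 < x" | "x \<le> x0" "l * x \<le> 2 * x0" | "x \<le> x0" "2 * x0 < l * x" by linarith
    then show ?thesis
    proof cases
      case 1
      have "c' * l powr a * V x \<le> c * l powr a * V x"
        using mult_right_mono[OF c'(2) la] by (simp add: mult.assoc)
      then show ?thesis using scale_a[OF 1 l] by linarith
    next
      case 2
      have "l powr a \<le> l powr 2" using l a by (intro powr_mono) auto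
      then have l2: "l powr a \<le> l\<^sup>2" using l by simp
      have "c' * l powr a * V x \<le> c1 * l powr a * V x"
        using mult_right_mono[OF c'(3) la] by (simp add: mult.assoc)
      also have "\<dots> \<le> c1 * l\<^sup>2 * V x"
        using l2 \<open>0 < c1\<close> V_nonneg by (intro mult_right_mono mult_left_mono) auto
      also have "\<dots> \<le> c1 * l\<^sup>2 * (x\<^sup>2 * P 2 x1)"
        unfolding V_def using \<open>0 < c1\<close> x assms by (intro mult_left_mono P_antimono) auto
      also have "\<dots> = (l * x)\<^sup>2 * P 2 (2 * x0)"
        unfolding c1_def using less_imp_neq[OF pos[OF assms(4)]] by (simp add: power_mult_distrib)
      also have "\<dots> \<le> V (l * x)"
        unfolding V_def using 2 x l assms by (intro mult_left_mono P_antimono) auto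
      finally show ?thesis .
    next
      case 3
      define l' where "l' = l * x / (2 * x0)"
      have l': "1 \<le> l'" "l * x = l' * (2 * x0)" using 3 x0 by (auto simp: l'_def)
      have "V x \<le> x0\<^sup>2 * P 2 x1"
        unfolding V_def using 3 x assms by (intro mult_mono power_mono P_antimono P_nonneg) auto
      then have "c' * l powr a * V x \<le> c2 * l powr a * (x0\<^sup>2 * P 2 x1)"
        using c' V_nonneg by (intro mult_mono) auto
      also have "\<dots> = c * (l * (x1 / (2 * x0))) powr a * V (2 * x0)"
      proof -
        have "(l * (x1 / (2 * x0))) powr a = l powr a * (x1 / (2 * x0)) powr a"
          by (rule powr_mult)
        then show ?thesis unfolding c2_def using less_imp_neq[OF pos[OF assms(4)]] x0 by simp
      qed
      also have "\<dots> \<le> c * l' powr a * V (2 * x0)"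
        using x l a assms x0 V_nonneg unfolding l'_def
        by (intro mult_right_mono mult_left_mono powr_mono2) (auto simp: divide_right_mono mult_left_mono)
      also have "\<dots> \<le> V (l * x)" unfolding l'(2) by (rule scale_a) (use l' x0 in auto)
      finally show ?thesis .
    qed
  qed
  then show ?thesis using that[of a c'] a c' by blast
qed

text \<open>Almost monotonicity of the jump density enters only through \<open>k_le\<close>. For
  \<open>x1 = 0\<close> the scaling holds on the whole open half-line.\<close>

locale scaled_density = levy_density k for k +
  fixes \<alpha> c x1 Cn :: real
  assumes \<alpha>: "0 < \<alpha>" and c: "0 < c" and x1: "0 \<le> x1" and Cn: "0 < Cn"
    and scale: "\<And>x l. 0 < x \<Longrightarrow> x1 \<le> x \<Longrightarrow> 1 \<le> l \<Longrightarrow> c * l powr \<alpha> * V x \<le> V (l * x)"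
    and k_le: "\<And>s. 0 < s \<Longrightarrow> k s \<le> Cn * V (1 / s) / s"
    and V_pos: "\<And>u. 0 < u \<Longrightarrow> 0 < V u"
begin

lemma V_almost_mono: assumes "0 < x" "x1 \<le> x" "x \<le> y" shows "c * V x \<le> V y"
proof -
  have "c * 1 * V x \<le> c * (y / x) powr \<alpha> * V x"
    using assms c \<alpha> V_nonneg by (intro mult_right_mono mult_left_mono ge_one_powr_ge_zero) auto
  also have "\<dots> \<le> V (y / x * x)" by (rule scale) (use assms in auto)
  finally show ?thesis using assms by simp
qed

text \<open>There are three ranges of jumps. For \<open>u * s \<le> 1\<close> the integrand of
  \<open>h\<close> is at most \<open>exp 1\<close> times that of \<open>V\<close>. For longer jumps
  with \<open>x1 * s \<le> 1\<close>, \<open>k_le\<close> and scaling from \<open>1 / s\<close> up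
  to \<open>u\<close> bound the density by a multiple of
  \<open>V u * (u * s) powr (- \<alpha>) / s\<close>, whose integral is explicit. The rest, present
  only for positive \<open>x1\<close>, has mass at most \<open>h x1\<close>, which is absorbed since
  \<open>c * V x1 \<le> V u\<close>.\<close>

lemma h_le_V: obtains C where "0 < C" "\<And>u. 0 < u \<Longrightarrow> x1 \<le> u \<Longrightarrow> h u \<le> C * V u"
proof -
  define C0 where "C0 = (if x1 = 0 then 0 else h x1 / (c * V x1))"
  define C where "C = exp 1 + Cn / c * (1 / \<alpha>) + C0"
  have "0 \<le> C0" unfolding C0_def using h_nonneg c V_nonneg by simp
  then have "0 < C" unfolding C_def using Cn c \<alpha> by (intro add_pos_nonneg) auto
  moreover have "h u \<le> C * V u" if u: "0 < u" "x1 \<le> u" for u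
  proof -
    let ?a = "\<lambda>s. k s * ((u * s)\<^sup>2 * exp (- (u * s)))"
    let ?b = "\<lambda>s. indicator {1 / u..} s * ((u * s) powr (- \<alpha>) / s)"
    let ?d = "\<lambda>s. k s * min 1 ((x1 * s)\<^sup>2)"
    have ia: "integrable lborel ?a"
      using integrable_mult_right[OF P_integrable[of 2 u], of "u\<^sup>2"] u by (simp add: power_mult_distrib mult_ac)
    note ib = integral_powr_tail[OF \<alpha> u(1)]
    have int: "integrable lborel (\<lambda>s. exp 1 * ?a s + (Cn / c * V u) * ?b s + ?d s)"
      by (intro Bochner_Integration.integrable_add integrable_mult_right ia ib(1) h_integrable)
    have pt: "k s * min 1 ((u * s)\<^sup>2) \<le> exp 1 * ?a s + (Cn / c * V u) * ?b s + ?d s" for s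
    proof (cases "0 < s")
      case True
      have na: "0 \<le> ?a s" "0 \<le> (Cn / c * V u) * ?b s" "0 \<le> ?d s"
        using True k_nonneg[of s] Cn c V_nonneg[of u] by (auto simp: indicator_def)
      show ?thesis
      proof (cases "u * s \<le> 1")
        case 1: True
        have "1 \<le> exp 1 * exp (- (u * s))" using 1 by (simp flip: exp_add)
        then have "k s * (u * s)\<^sup>2 * 1 \<le> k s * (u * s)\<^sup>2 * (exp 1 * exp (- (u * s)))"
          using k_nonneg[of s] by (intro mult_left_mono) auto
        moreover have "k s * min 1 ((u * s)\<^sup>2) \<le> k s * (u * s)\<^sup>2"
          using k_nonneg[of s] by (intro mult_left_mono) auto
        ultimately have "k s * min 1 ((u * s)\<^sup>2) \<le> exp 1 * ?a s" by (simp add: mult_ac)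
        then show ?thesis using na by linarith
      next
        case 2: False
        have km: "k s * min 1 ((u * s)\<^sup>2) \<le> k s * 1" using k_nonneg[of s] by (intro mult_left_mono) auto
        show ?thesis
        proof (cases "x1 * s \<le> 1")
          case 3: True
          have "c * (u * s) powr \<alpha> * V (1 / s) \<le> V (u * s * (1 / s))"
            by (rule scale) (use True 2 3 in \<open>auto simp: field_simps\<close>)
          then have "V (1 / s) \<le> V u * (u * s) powr (- \<alpha>) / c"
            using True u c by (simp add: powr_minus field_simps)
          then have "Cn * V (1 / s) / s \<le> Cn * (V u * (u * s) powr (- \<alpha>) / c) / s"
            using True Cn by (intro divide_right_mono mult_left_mono) auto
          then have "k s \<le> Cn * (V u * (u * s) powr (- \<alpha>) / c) / s" using k_le[OF True] by linarith
          moreover have "1 / u \<le> s" using 2 u True by (simp add: field_simps)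
          ultimately have "k s \<le> (Cn / c * V u) * ?b s" by (simp add: mult_ac)
          then show ?thesis using km na(1,3) mult_nonneg_nonneg[OF exp_ge_zero na(1), of 1] by linarith
        next
          case 3: False
          then have "1 \<le> (x1 * s)\<^sup>2" by (simp add: one_le_power)
          then have "?d s = k s" by simp
          then show ?thesis using km na(2) mult_nonneg_nonneg[OF exp_ge_zero na(1), of 1] by linarith
        qed
      qed
    next
      case False
      then have "\<not> 1 / u \<le> s" using u by (smt (verit) divide_pos_pos)
      then show ?thesis using False by (simp add: k_neg)
    qed
    have "h u \<le> (LINT s|lborel. exp 1 * ?a s + (Cn / c * V u) * ?b s + ?d s)"
      unfolding h_def by (rule integral_mono[OF h_integrable int pt])
    also have "\<dots> = exp 1 * V u + (Cn / c * V u) * (1 / \<alpha>) + h x1"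
      unfolding Bochner_Integration.integral_add[OF Bochner_Integration.integrable_add[OF
          integrable_mult_right[OF ia] integrable_mult_right[OF ib(1)]] h_integrable]
        Bochner_Integration.integral_add[OF integrable_mult_right[OF ia] integrable_mult_right[OF ib(1)]]
        integral_mult_right_zero ib(2) V_eq[symmetric] h_def[symmetric] ..
    also have "h x1 \<le> C0 * V u"
    proof (cases "x1 = 0")
      case False
      then have "0 < x1" using x1 by simp
      have "h x1 / (c * V x1) * (c * V x1) \<le> h x1 / (c * V x1) * V u"
        using V_almost_mono[of x1 u] \<open>0 < x1\<close> u h_nonneg[of x1] V_nonneg[of x1] c by (intro mult_left_mono) auto
      then show ?thesis using False V_pos[OF \<open>0 < x1\<close>] c by (simp add: C0_def)
    qed (simp add: C0_def h_def)
    finally show ?thesis by (simp add: C_def algebra_simps)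
  qed
  ultimately show ?thesis using that by blast
qed

text \<open>Jumps with \<open>u * s > 1\<close> cannot be compared directly, as
  \<open>1 - cos\<close> has zeros there. At the larger argument \<open>M * u\<close> they carry a
  weight of at most \<open>1 / (4 * C)\<close>, so by \<open>h_le_V\<close> they contribute at most
  a quarter of \<open>V (M * u)\<close> and are absorbed. Almost monotonicity of \<open>V\<close>
  leads back to \<open>u\<close>.\<close>

lemma V_le_\<rho>: obtains a where "0 < a" "\<And>u. 0 < u \<Longrightarrow> x1 \<le> u \<Longrightarrow> a * V u \<le> \<rho> u"
proof -
  obtain C where C: "0 < C" "\<And>u. 0 < u \<Longrightarrow> x1 \<le> u \<Longrightarrow> h u \<le> C * V u" using h_le_V by blast
  \<comment> \<open>Since \<open>x ^ 3 * exp (- x)\<close> is at most 27, the weight is at most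
    \<open>27 / x\<close>, and 27 / 108 is the wanted quarter.\<close>
  define M where "M = max 1 (108 * C)"
  have M: "1 \<le> M" "108 * C \<le> M" "0 < M" by (auto simp: M_def)
  have tail: "x\<^sup>2 * exp (- x) \<le> 1 / (4 * C)" if "M \<le> x" for x
  proof -
    have x: "0 < x" "108 * C \<le> x" using that M by auto
    have "x ^ 3 * exp (- x) \<le> 27" using power_mult_exp_minus_le[of x 3] x by simp
    then have "x\<^sup>2 * exp (- x) \<le> 27 / x" using x by (simp add: field_simps power2_eq_square power3_eq_cube)
    also have "\<dots> \<le> 27 / (108 * C)" using x C by (intro divide_left_mono) auto
    finally show ?thesis by simp
  qed
  have "c / (8 * M\<^sup>2) * V u \<le> \<rho> u" if u: "0 < u" "x1 \<le> u" for u
  proof -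
    have Mu: "0 < M * u" "u \<le> M * u" using M u by auto
    let ?g = "\<lambda>s. 4 * M\<^sup>2 * (1 - cos (u * s)) + 1 / (4 * C) * min 1 ((M * u * s)\<^sup>2)"
    have int: "integrable lborel (\<lambda>s. k s * ?g s)"
      using Bochner_Integration.integrable_add[OF integrable_mult_right[OF \<rho>_integrable[of u], of "4 * M\<^sup>2"]
          integrable_mult_right[OF h_integrable[of "M * u"], of "1 / (4 * C)"]]
      by (simp add: algebra_simps)
    have "V (M * u) \<le> (LINT s|lborel. k s * ?g s)"
      unfolding V_eq
    proof (rule integral_k_mono[OF _ _ int])
      fix s :: real assume s: "0 < s"
      show "0 \<le> ?g s" using C by simp
      show "(M * u * s)\<^sup>2 * exp (- (M * u * s)) \<le> ?g s"
      proof (cases "u * s \<le> 1")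
        case True
        have "(u * s)\<^sup>2 / 4 \<le> 1 - cos (u * s)" using one_minus_cos_lower[of "u * s"] True u s by simp
        then have "4 * M\<^sup>2 * ((u * s)\<^sup>2 / 4) \<le> 4 * M\<^sup>2 * (1 - cos (u * s))" by (intro mult_left_mono) auto
        moreover have "(M * u * s)\<^sup>2 * exp (- (M * u * s)) \<le> (M * u * s)\<^sup>2 * 1"
          using M u s by (intro mult_left_mono) auto
        moreover have "0 \<le> 1 / (4 * C) * min 1 ((M * u * s)\<^sup>2)" using C by simp
        ultimately show ?thesis by (simp add: power_mult_distrib)
      next
        case False
        then have Ms: "M \<le> M * u * s" using M mult_left_mono[of 1 "u * s" M] by (simp add: mult.assoc)
        then have "1 \<le> M * u * s" using M by linarith
        then have "1 \<le> (M * u * s)\<^sup>2" by (rule one_le_power)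
        then have m: "min 1 ((M * u * s)\<^sup>2) = 1" by simp
        have "0 \<le> 4 * M\<^sup>2 * (1 - cos (u * s))" by simp
        then show ?thesis using tail[OF Ms] unfolding m by linarith
      qed
    qed
    also have "\<dots> = 4 * M\<^sup>2 * \<rho> u + 1 / (4 * C) * h (M * u)"
    proof -
      have "(LINT s|lborel. k s * ?g s) = (LINT s|lborel. 4 * M\<^sup>2 * (k s * (1 - cos (u * s))) + 1 / (4 * C) * (k s * min 1 ((M * u * s)\<^sup>2)))"
        by (rule Bochner_Integration.integral_cong) (auto simp: algebra_simps)
      also have "\<dots> = 4 * M\<^sup>2 * \<rho> u + 1 / (4 * C) * h (M * u)"
        unfolding \<rho>_def h_def
        by (subst Bochner_Integration.integral_add[OF integrable_mult_right[OF \<rho>_integrable] integrable_mult_right[OF h_integrable]])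
           (simp only: integral_mult_right_zero)
      finally show ?thesis .
    qed
    also have "1 / (4 * C) * h (M * u) \<le> V (M * u) / 4"
      using C(2)[OF Mu(1)] Mu u C(1) by (simp add: field_simps)
    finally have "V (M * u) \<le> 8 * M\<^sup>2 * \<rho> u" using mult_nonneg_nonneg[OF zero_le_power2 \<rho>_nonneg, of M u] by simp
    then have "c * V u \<le> 8 * M\<^sup>2 * \<rho> u" using V_almost_mono[OF u Mu(2)] by linarith
    then show ?thesis using M by (simp add: field_simps)
  qed
  moreover have "0 < c / (8 * M\<^sup>2)" using c M by simp
  ultimately show ?thesis using that by blast
qed

end

text \<open>\<open>J\<close> is obtained before \<open>f\<close>, because a single constant has to
  serve all times and scales.\<close>

lemma stretched_exponential_decay:
  fixes a \<alpha> y0 :: real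
  assumes "0 < a" "0 < \<alpha>"
  obtains J where "\<And>f y. (\<And>y. 0 \<le> f y) \<Longrightarrow> (\<And>y. y0 \<le> \<bar>y\<bar> \<Longrightarrow> a * \<bar>y\<bar> powr \<alpha> \<le> f y) \<Longrightarrow>
    (1 + \<bar>y\<bar>) ^ 3 * exp (- f y) \<le> J * cauchy_kernel y"
proof -
  define Y where "Y = max 1 y0"
  \<comment> \<open>Degree five is three from the polynomial factor plus two from the reciprocal of
    the Cauchy kernel.\<close>
  obtain j :: nat where "5 / \<alpha> < real j" using reals_Archimedean2 by blast
  then have j: "5 < \<alpha> * real j" using assms by (simp add: field_simps)
  then have j0: "0 < j" using assms by (cases j) auto
  define J where "J = (1 + Y) ^ 3 * (1 + Y\<^sup>2) + 16 * (real j ^ j / a ^ j)"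
  have "(1 + \<bar>y\<bar>) ^ 3 * exp (- f y) \<le> J * cauchy_kernel y"
    if f: "\<And>y. 0 \<le> f y" "\<And>y. y0 \<le> \<bar>y\<bar> \<Longrightarrow> a * \<bar>y\<bar> powr \<alpha> \<le> f y" for f y
  proof -
    have "(1 + \<bar>y\<bar>) ^ 3 * (1 + \<bar>y\<bar>\<^sup>2) * exp (- f y) \<le> J"
    proof (cases "\<bar>y\<bar> \<le> Y")
      case True
      have "(1 + \<bar>y\<bar>) ^ 3 * (1 + \<bar>y\<bar>\<^sup>2) * exp (- f y) \<le> (1 + Y) ^ 3 * (1 + Y\<^sup>2) * 1"
        using True f(1)[of y] by (intro mult_mono power_mono add_left_mono) (auto simp del: power2_abs)
      moreover have "0 \<le> 16 * (real j ^ j / a ^ j)" using assms by simp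
      ultimately show ?thesis unfolding J_def by linarith
    next
      case False
      let ?y = "\<bar>y\<bar>"
      have y: "1 \<le> ?y" "y0 \<le> ?y" using False by (auto simp: Y_def)
      let ?x = "a * ?y powr \<alpha>"
      have x: "0 \<le> ?x" using assms by simp
      have "(?y powr \<alpha>) ^ j = ?y powr (\<alpha> * real j)" using y by (simp add: powr_powr flip: powr_realpow)
      also have "\<dots> \<ge> ?y powr 5" using y j by (intro powr_mono) auto
      finally have "?y powr 5 \<le> (?y powr \<alpha>) ^ j" .
      moreover have "?y powr 5 = ?y ^ 5" using y powr_realpow[of ?y 5] by simp
      ultimately have y5: "?y ^ 5 \<le> (?y powr \<alpha>) ^ j" by simp
      have "exp (- f y) \<le> exp (- ?x)" using f(2)[OF y(2)] by simp
      have "(1 + ?y) ^ 3 * (1 + ?y\<^sup>2) \<le> (2 * ?y) ^ 3 * (2 * ?y\<^sup>2)"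
        using y one_le_power[OF y(1), of 2] by (intro mult_mono power_mono) auto
      also have "\<dots> = 16 * ?y ^ 5" by (simp add: eval_nat_numeral)
      finally have "(1 + ?y) ^ 3 * (1 + ?y\<^sup>2) \<le> 16 * (?y powr \<alpha>) ^ j" using y5 by linarith
      then have "(1 + ?y) ^ 3 * (1 + ?y\<^sup>2) * exp (- f y) \<le> 16 * (?y powr \<alpha>) ^ j * exp (- ?x)"
        using \<open>exp (- f y) \<le> exp (- ?x)\<close> by (rule mult_mono) auto
      also have "\<dots> = 16 * (?x ^ j * exp (- ?x) / a ^ j)" using assms by (simp add: power_mult_distrib)
      also have "\<dots> \<le> 16 * (real j ^ j / a ^ j)"
        using power_mult_exp_minus_le[OF x j0] assms by (intro mult_left_mono divide_right_mono) auto
      also have "\<dots> \<le> J" unfolding J_def Y_def by simp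
      finally show ?thesis .
    qed
    then show ?thesis
      unfolding cauchy_kernel_def by (simp add: add_pos_nonneg field_simps)
  qed
  then show ?thesis using that by blast
qed

context levy_density begin

lemma set_integral_density:
  fixes f :: "real \<Rightarrow> 'b :: {banach, second_countable_topology}"
  assumes [measurable]: "f \<in> borel_measurable borel" "B \<in> sets borel"
  shows "(LINT s:B|density lborel (\<lambda>x. ennreal (k x)). f s) = (LINT s|lborel. k s *\<^sub>R (indicator B s *\<^sub>R f s))"
  unfolding set_lebesgue_integral_def by (rule integral_density) (auto simp: k_nonneg)

lemma k_indicator: "k s *\<^sub>R (indicator {0<..} s *\<^sub>R (x :: 'b :: real_vector)) = k s *\<^sub>R x"
  using k_neg[of s] by (cases "0 < s") auto

definition Vs where "Vs r = (SUP x\<in>{0<..r}. V x)" for r :: real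

lemma bdd_V: "bdd_above (V ` {0<..r})"
proof (rule bdd_aboveI2)
  show "V x \<le> 2 * h r" if "x \<in> {0<..r}" for x using that V_le_h[of x] h_mono[of x r] by auto
qed

lemma V_le_Vs: "0 < x \<Longrightarrow> x \<le> r \<Longrightarrow> V x \<le> Vs r"
  unfolding Vs_def by (intro cSUP_upper bdd_V) auto

lemma Vs_least: "0 < r \<Longrightarrow> (\<And>x. 0 < x \<Longrightarrow> x \<le> r \<Longrightarrow> V x \<le> B) \<Longrightarrow> Vs r \<le> B"
  unfolding Vs_def by (intro cSUP_least) auto

lemma Vs_mono: "0 < r \<Longrightarrow> r \<le> r' \<Longrightarrow> Vs r \<le> Vs r'"
  by (intro Vs_least V_le_Vs) auto

lemma Vs_nonneg: "0 < r \<Longrightarrow> 0 \<le> Vs r"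
  using V_le_Vs[of r r] V_nonneg[of r] by auto

lemma Vs_scale_upper: assumes "0 < r" "1 \<le> l" shows "Vs (l * r) \<le> l\<^sup>2 * Vs r"
proof (rule Vs_least)
  fix x assume x: "0 < x" "x \<le> l * r"
  have "V x = V (l * (x / l))" using assms by simp
  also have "\<dots> \<le> l\<^sup>2 * V (x / l)" by (rule V_scale_upper) (use x assms in auto)
  also have "\<dots> \<le> l\<^sup>2 * Vs r" using x assms by (intro mult_left_mono V_le_Vs) (auto simp: field_simps)
  finally show "V x \<le> l\<^sup>2 * Vs r" .
qed (use assms in auto)

text \<open>Continuity at 0 follows from \<open>V \<le> 2 * h\<close>; it lets the search for a
  first passage start at the origin.\<close>

lemma continuous_on_V_0: "continuous_on {0..} V"
  unfolding continuous_on_eq_continuous_within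
proof
  fix x :: real assume "x \<in> {0..}"
  show "continuous (at x within {0..}) V"
  proof (cases "x = 0")
    case False
    then have "0 < x" using \<open>x \<in> {0..}\<close> by simp
    then have "isCont V x" using continuous_on_V by (simp add: continuous_on_eq_continuous_at)
    then show ?thesis by (rule continuous_at_imp_continuous_at_within)
  next
    case True
    have V0: "V 0 = 0" by (simp add: V_def)
    show ?thesis unfolding True continuous_within_eps_delta
    proof (intro allI impI)
      fix e :: real assume "0 < e"
      then obtain d where d: "0 < d" "h d < e / 2" using h_small[of "e / 2"] by auto
      have "\<bar>V y\<bar> < e" if "y \<in> {0..}" "\<bar>y\<bar> < d" for y
      proof (cases "y = 0")
        case False
        then show ?thesis using that V_le_h[of y] h_mono[of y d] V_nonneg[of y] d by auto
      qed (use V0 \<open>0 < e\<close> in auto)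
      then show "\<exists>d>0. \<forall>x'\<in>{0..}. dist x' 0 < d \<longrightarrow> dist (V x') (V 0) < e"
        using d V0 by (auto simp: dist_real_def)
    qed
  qed
qed

lemma integrable_k_iexp: "integrable lborel (\<lambda>s. k s *\<^sub>R (1 - iexp (y * s)))"
proof (rule integrable_k[where C="2 + \<bar>y\<bar>"])
  fix s :: real assume s: "0 < s"
  have "norm (1 - iexp (y * s)) \<le> \<bar>y\<bar> * s"
    using norm_iexp_diff_1[of "y * s"] norm_minus_commute[of 1 "iexp (y * s)"] s by (simp add: abs_mult)
  moreover have "norm (1 - iexp (y * s)) \<le> 2"
    using norm_triangle_ineq4[of 1 "iexp (y * s)"] by simp
  ultimately show "norm (1 - iexp (y * s)) \<le> (2 + \<bar>y\<bar>) * min 1 s"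
    using s abs_ge_zero[of "y"] by (cases "s \<le> 1") (auto simp: distrib_right simp del: abs_ge_zero)
qed measurable

text \<open>\<open>t / u * k (s / u)\<close> is the density of the image of \<open>t * k\<close>
  under multiplication by \<open>u\<close>, which takes jumps shorter than \<open>1 / u\<close> to
  jumps shorter than 1.\<close>

lemma compensated_exponent_rescaled:
  assumes "0 < t" "0 < u"
  shows "compensated_exponent (\<lambda>s. t / u * k (s / u)) y = t * ((CLINT s|lborel. k s *\<^sub>R (1 - iexp (u * y * s)))
     + \<i> * (u * y) * (LINT s|lborel. k s * (indicator {..<1 / u} s * s)))"
proof -
  let ?f = "\<lambda>s. (1 - iexp (y * s) + (if s < 1 then \<i> * of_real (y * s) else 0)) * complex_of_real (t / u * k (s / u))"
  have i2: "integrable lborel (\<lambda>s. k s *\<^sub>R (indicator {..<1 / u} s * s))"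
  proof (rule integrable_k[where C="1 + 1 / u"])
    fix s :: real assume s: "0 < s"
    have "indicator {..<1 / u} s * s \<le> 1 / u" using s assms by (auto simp: indicator_def)
    moreover have "indicator {..<1 / u} s * s \<le> s" using s by (auto simp: indicator_def)
    ultimately show "norm (indicator {..<1 / u} s * s) \<le> (1 + 1 / u) * min 1 s"
      using s assms by (cases "s \<le> 1") (auto simp: distrib_right indicator_def)
  qed measurable
  have "compensated_exponent (\<lambda>s. t / u * k (s / u)) y = u *\<^sub>R (CLINT s|lborel. ?f (0 + u * s))"
    unfolding compensated_exponent_def using assms by (subst lborel_integral_real_affine[of u _ 0]) auto
  also have "\<dots> = (CLINT s|lborel. of_real t * (k s *\<^sub>R (1 - iexp (u * y * s)))
      + (of_real t * (\<i> * (u * y))) * of_real (k s *\<^sub>R (indicator {..<1 / u} s * s)))"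
    unfolding integral_scaleR_right[symmetric]
  proof (rule Bochner_Integration.integral_cong[OF refl])
    fix s
    have "u * s < 1 \<longleftrightarrow> s < 1 / u" using assms by (simp add: field_simps)
    then show "u *\<^sub>R ?f (0 + u * s) = of_real t * (k s *\<^sub>R (1 - iexp (u * y * s)))
      + (of_real t * (\<i> * (u * y))) * of_real (k s *\<^sub>R (indicator {..<1 / u} s * s))"
      using assms by (simp add: scaleR_conv_of_real field_simps indicator_def)
  qed
  also have "\<dots> = of_real t * (CLINT s|lborel. k s *\<^sub>R (1 - iexp (u * y * s)))
      + (of_real t * (\<i> * (u * y))) * of_real (LINT s|lborel. k s *\<^sub>R (indicator {..<1 / u} s * s))"
    by (subst Bochner_Integration.integral_add[OF integrable_mult_right[OF integrable_k_iexp] integrable_mult_right[OF integrable_of_real[OF i2]]])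
       (simp only: integral_mult_right_zero integral_complex_of_real)
  finally show ?thesis by (simp add: algebra_simps)
qed

lemma Re_integral_iexp: "Re (CLINT s|lborel. k s *\<^sub>R (1 - iexp (y * s))) = \<rho> y"
proof -
  have "Re (CLINT s|lborel. k s *\<^sub>R (1 - iexp (y * s))) = (LINT s|lborel. Re (k s *\<^sub>R (1 - iexp (y * s))))"
    by (rule integral_Re[OF integrable_k_iexp, symmetric])
  also have "\<dots> = \<rho> y" unfolding \<rho>_def by (simp add: Re_exp)
  finally show ?thesis .
qed

text \<open>Only the jumps in \<open>{p..q}\<close> are kept in the integral for
  \<open>V (1 / s)\<close>; there the density is comparable to \<open>k s\<close> and the weight is
  bounded below.\<close>

lemma k_le_of_interval:
  assumes s: "0 < s" and pq: "0 < p" "p \<le> q" and d: "0 \<le> d" "\<And>r. p \<le> r \<Longrightarrow> r \<le> q \<Longrightarrow> d * k s \<le> k r"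
    and w: "0 \<le> w" "\<And>r. p \<le> r \<Longrightarrow> r \<le> q \<Longrightarrow> w \<le> (1 / s * r)\<^sup>2 * exp (- (1 / s * r))"
  shows "d * w * (q - p) * k s \<le> V (1 / s)"
proof -
  have "(LINT r|lborel. indicator {p..q} r * (d * k s * w)) \<le> (LINT r|lborel. k r * ((1 / s * r)\<^sup>2 * exp (- (1 / s * r))))"
  proof (rule integral_mono')
    show "integrable lborel (\<lambda>r. k r * ((1 / s * r)\<^sup>2 * exp (- (1 / s * r))))"
      using integrable_mult_right[OF P_integrable[of 2 "1 / s"], of "(1 / s)\<^sup>2"] s
      by (simp add: power_mult_distrib power_divide mult_ac)
    fix r
    show "0 \<le> k r * ((1 / s * r)\<^sup>2 * exp (- (1 / s * r)))" using k_nonneg by simp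
    show "indicator {p..q} r * (d * k s * w) \<le> k r * ((1 / s * r)\<^sup>2 * exp (- (1 / s * r)))"
    proof (cases "p \<le> r \<and> r \<le> q")
      case True
      then have "d * k s * w \<le> k r * ((1 / s * r)\<^sup>2 * exp (- (1 / s * r)))"
        using d w k_nonneg by (intro mult_mono) auto
      then show ?thesis using True by simp
    qed (use k_nonneg in auto)
  qed
  then show ?thesis unfolding V_eq using pq by (simp add: mult_ac)
qed

end

context scaled_density begin

lemma \<rho>_scale_lower:
  obtains d where "0 < d" "\<And>x l. 0 < x \<Longrightarrow> x1 \<le> x \<Longrightarrow> 1 \<le> l \<Longrightarrow> d * l powr \<alpha> * V x \<le> \<rho> (l * x)"
proof -
  obtain a where a: "0 < a" "\<And>u. 0 < u \<Longrightarrow> x1 \<le> u \<Longrightarrow> a * V u \<le> \<rho> u" using V_le_\<rho> by blast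
  have "a * c * l powr \<alpha> * V x \<le> \<rho> (l * x)" if x: "0 < x" "x1 \<le> x" and l: "1 \<le> l" for x l
  proof -
    have lx: "x \<le> l * x" using x l by simp
    have "a * (c * l powr \<alpha> * V x) \<le> a * V (l * x)" using scale[OF x l] a by (intro mult_left_mono) auto
    also have "\<dots> \<le> \<rho> (l * x)" using a(2)[of "l * x"] x lx by linarith
    finally show ?thesis by (simp add: mult.assoc)
  qed
  then show ?thesis using that[of "a * c"] a c by auto
qed

lemma \<rho>_stretched_lower:
  assumes "0 < t"
  obtains a y0 where "0 < a" "\<And>y. y0 \<le> \<bar>y\<bar> \<Longrightarrow> a * \<bar>y\<bar> powr \<alpha> \<le> t * \<rho> y"
proof -
  obtain d where d: "0 < d" "\<And>x l. 0 < x \<Longrightarrow> x1 \<le> x \<Longrightarrow> 1 \<le> l \<Longrightarrow> d * l powr \<alpha> * V x \<le> \<rho> (l * x)"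
    using \<rho>_scale_lower by blast
  define z where "z = max x1 1"
  have z: "0 < z" "x1 \<le> z" by (auto simp: z_def)
  have "t * d * V z / z powr \<alpha> * \<bar>y\<bar> powr \<alpha> \<le> t * \<rho> y" if "z \<le> \<bar>y\<bar>" for y
  proof -
    have "d * (\<bar>y\<bar> / z) powr \<alpha> * V z \<le> \<rho> (\<bar>y\<bar> / z * z)" by (rule d(2)) (use z that in auto)
    also have "\<dots> = \<rho> y" using z \<rho>_abs by simp
    finally have "t * (d * (\<bar>y\<bar> / z) powr \<alpha> * V z) \<le> t * \<rho> y" using assms by (intro mult_left_mono) auto
    then show ?thesis using z by (simp add: powr_divide mult_ac)
  qed
  moreover have "0 < t * d * V z / z powr \<alpha>" using assms d V_pos z by simp
  ultimately show ?thesis using that by blast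
qed

lemma exp_\<rho>_integrable:
  fixes f :: "real \<Rightarrow> complex"
  assumes "0 < t" and [measurable]: "f \<in> borel_measurable borel" and f: "\<And>y. norm (f y) = exp (- (t * \<rho> y))"
  shows "integrable lborel f"
proof -
  obtain a y0 where a: "0 < a" "\<And>y. y0 \<le> \<bar>y\<bar> \<Longrightarrow> a * \<bar>y\<bar> powr \<alpha> \<le> t * \<rho> y"
    using \<rho>_stretched_lower[OF assms(1)] by metis
  obtain J where J: "\<And>f y. (\<And>y. 0 \<le> f y) \<Longrightarrow> (\<And>y. y0 \<le> \<bar>y\<bar> \<Longrightarrow> a * \<bar>y\<bar> powr \<alpha> \<le> f y) \<Longrightarrow>
    (1 + \<bar>y\<bar>) ^ 3 * exp (- f y) \<le> J * cauchy_kernel y"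
    using stretched_exponential_decay[OF a(1) \<alpha>] by metis
  have "norm (f y) \<le> J * cauchy_kernel y" for y
  proof -
    have "(1 + \<bar>y\<bar>) ^ 3 * exp (- (t * \<rho> y)) \<le> J * cauchy_kernel y"
      by (rule J) (use a \<rho>_nonneg assms(1) in auto)
    moreover have "1 * exp (- (t * \<rho> y)) \<le> (1 + \<bar>y\<bar>) ^ 3 * exp (- (t * \<rho> y))"
      by (intro mult_right_mono one_le_power) auto
    ultimately show ?thesis unfolding f by linarith
  qed
  then show ?thesis by (rule integrable_of_cauchy_bound(1)[OF assms(2)])
qed

text \<open>\<open>g\<close> stands for the numerator of \<open>\<eta>\<close>, which is
  \<open>g (1 / s) / s\<close>; working with it hides the two branches. In rescaled variables the
  target is \<open>t * g (u / x) / x\<close>. The two-sided bound on \<open>t * h u\<close> makes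
  the constants of \<open>normalized_density\<close> the same for all \<open>t\<close> and
  \<open>u\<close>.\<close>

lemma normalized_bound:
  fixes g :: "real \<Rightarrow> real"
  assumes cg: "0 < cg" and A0: "0 < A0" and B0: "0 < B0"
    and g_mono: "\<And>v w. 0 < v \<Longrightarrow> v \<le> w \<Longrightarrow> g v \<le> g w"
    and g_double: "\<And>v. 0 < v \<Longrightarrow> g (2 * v) \<le> 8 * g v"
    and g_lower: "\<And>v. 0 < v \<Longrightarrow> cg * Vs v \<le> g v"
  obtains C where "0 < C"
    "\<And>t u x. 0 < t \<Longrightarrow> 0 < u \<Longrightarrow> x1 \<le> u \<Longrightarrow> t * h u \<le> A0 \<Longrightarrow> 1 \<le> B0 * (t * h u) \<Longrightarrow>
      norm (CLINT y|lborel. iexp (-(y * x)) * exp (- compensated_exponent (\<lambda>s. t / u * k (s / u)) y)) \<le> C"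
    "\<And>t u x. 0 < t \<Longrightarrow> 0 < u \<Longrightarrow> x1 \<le> u \<Longrightarrow> t * h u \<le> A0 \<Longrightarrow> 1 \<le> B0 * (t * h u) \<Longrightarrow> x \<noteq> 0 \<Longrightarrow>
      norm (CLINT y|lborel. iexp (-(y * x)) * exp (- compensated_exponent (\<lambda>s. t / u * k (s / u)) y))
        \<le> C * (t * g (u / \<bar>x\<bar>) / \<bar>x\<bar>)"
proof -
  obtain d where d: "0 < d" "\<And>x l. 0 < x \<Longrightarrow> x1 \<le> x \<Longrightarrow> 1 \<le> l \<Longrightarrow> d * l powr \<alpha> * V x \<le> \<rho> (l * x)"
    using \<rho>_scale_lower by blast
  obtain Ch where Ch: "0 < Ch" "\<And>u. 0 < u \<Longrightarrow> x1 \<le> u \<Longrightarrow> h u \<le> Ch * V u" using h_le_V by blast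
  define a where "a = d / (B0 * Ch)"
  have a: "0 < a" unfolding a_def using d B0 Ch by simp
  obtain J where J: "\<And>f y. (\<And>y. 0 \<le> f y) \<Longrightarrow> (\<And>y. 1 \<le> \<bar>y\<bar> \<Longrightarrow> a * \<bar>y\<bar> powr \<alpha> \<le> f y) \<Longrightarrow>
    (1 + \<bar>y\<bar>) ^ 3 * exp (- f y) \<le> J * cauchy_kernel y"
    using stretched_exponential_decay[OF a \<alpha>, of 1] by metis
  \<comment> \<open>Here 16 = 8 * 2: halving \<open>x\<close> costs 8 in \<open>g\<close> and 2 in
    the division. The other two entries serve \<open>m_le_W\<close> and
    \<open>W_lower\<close>.\<close>
  define K where "K = max 16 (max (Cn / cg) (B0 * Ch / cg))"
  have K: "16 \<le> K" "Cn / cg \<le> K" "B0 * Ch / cg \<le> K" by (auto simp: K_def)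
  \<comment> \<open>\<open>normalized_density.D\<close> does not involve \<open>m\<close> and
    \<open>W\<close>, so the constant is fixed before \<open>t\<close> and \<open>u\<close>
    are.\<close>
  define D where "D = normalized_density.D A0 J K * exp (1 + K * A0)"
  define C where "C = max 1 (max D (J * pi))"
  have C: "0 < C" "D \<le> C" "J * pi \<le> C" by (auto simp: C_def)
  have main: "norm (CLINT y|lborel. iexp (-(y * x)) * exp (- compensated_exponent (\<lambda>s. t / u * k (s / u)) y)) \<le> C
    \<and> (x \<noteq> 0 \<longrightarrow> norm (CLINT y|lborel. iexp (-(y * x)) * exp (- compensated_exponent (\<lambda>s. t / u * k (s / u)) y))
        \<le> C * (t * g (u / \<bar>x\<bar>) / \<bar>x\<bar>))"
    if t: "0 < t" and u: "0 < u" "x1 \<le> u" and tu: "t * h u \<le> A0" "1 \<le> B0 * (t * h u)" for t u x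
  proof -
    let ?m = "\<lambda>s. t / u * k (s / u)" and ?W = "\<lambda>x. t * g (u / x) / x"
    have g_nonneg: "0 \<le> g v" if "0 < v" for v
      using g_lower[OF that] mult_nonneg_nonneg[OF less_imp_le[OF cg] Vs_nonneg[OF that]] by linarith
    have Re: "Re (compensated_exponent ?m y) = t * \<rho> (u * y)" for y
      unfolding compensated_exponent_rescaled[OF t u(1)] using Re_integral_iexp[of "u * y"]
      by (simp add: Re_iexp mult.assoc)
    have m_eq: "(\<lambda>s. min 1 ((u * s)\<^sup>2) * ?m (u * s)) = (\<lambda>s. t / u * (k s * min 1 ((u * s)\<^sup>2)))"
      using u by (auto simp: mult_ac)
    have m_integrable: "integrable lborel (\<lambda>s. min 1 (s\<^sup>2) * ?m s)"
    proof -
      have "integrable lborel (\<lambda>s. min 1 ((0 + u * s)\<^sup>2) * ?m (0 + u * s))"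
        using m_eq h_integrable[of u] by simp
      then show ?thesis
        using lborel_integrable_real_affine_iff[of u "\<lambda>s. min 1 (s\<^sup>2) * ?m s" 0] u by simp
    qed
    have m_integral: "(LINT s|lborel. min 1 (s\<^sup>2) * ?m s) = t * h u"
    proof -
      have "(LINT s|lborel. min 1 (s\<^sup>2) * ?m s) = \<bar>u\<bar> *\<^sub>R (LINT s|lborel. min 1 ((0 + u * s)\<^sup>2) * ?m (0 + u * s))"
        by (rule lborel_integral_real_affine) (use u in simp)
      also have "\<dots> = u * (LINT s|lborel. t / u * (k s * min 1 ((u * s)\<^sup>2)))"
        using u by (simp only: add_0 m_eq abs_of_pos real_scaleR_def)
      also have "\<dots> = t * h u" unfolding integral_mult_right_zero h_def using u by simp
      finally show ?thesis .
    qed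
    have tV: "1 / (B0 * Ch) \<le> t * V u"
    proof -
      have "B0 * (t * h u) \<le> B0 * (t * (Ch * V u))"
        using B0 t by (intro mult_left_mono Ch(2)[OF u]) auto
      then have "1 \<le> B0 * (t * (Ch * V u))" using tu(2) by linarith
      then show ?thesis using B0 Ch by (simp add: field_simps)
    qed
    interpret N: normalized_density ?m ?W A0 J K
    proof
      show "?m \<in> borel_measurable borel" by measurable
      show "0 \<le> ?m s" for s using t u k_nonneg by simp
      show "?m s = 0" if "s \<le> 0" for s using k_neg[of "s / u"] that u by (simp add: divide_le_0_iff)
      show "integrable lborel (\<lambda>s. min 1 (s\<^sup>2) * ?m s)" by (rule m_integrable)
      show "(LINT s|lborel. min 1 (s\<^sup>2) * ?m s) \<le> A0" using m_integral tu by simp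
      show "1 \<le> K" using K by simp
      show W0: "0 \<le> ?W x" if "0 < x" for x using that t u g_nonneg[of "u / x"] by simp
      show "?W z \<le> K * ?W x" if "0 < x" "x / 2 \<le> z" for x z
      proof -
        have z: "0 < z" "u / z \<le> 2 * (u / x)" using that u by (auto simp: field_simps)
        have "g (u / z) \<le> 8 * g (u / x)"
          using g_mono[of "u / z" "2 * (u / x)"] g_double[of "u / x"] z u that by auto
        then have "t * g (u / z) / z \<le> t * (8 * g (u / x)) / (x / 2)"
          using that t u z g_nonneg[of "u / x"] by (intro frac_le mult_left_mono) auto
        also have "\<dots> = 16 * ?W x" by simp
        also have "\<dots> \<le> K * ?W x" using K W0[OF that(1)] by (intro mult_right_mono) auto
        finally show ?thesis .
      qed
      show "?m s \<le> K * ?W s" if "1 \<le> s" for s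
      proof -
        have s: "0 < s / u" "0 < s" using that u by auto
        have "k (s / u) \<le> Cn * V (u / s) / (s / u)" using k_le[OF s(1)] by simp
        also have "\<dots> \<le> Cn * (g (u / s) / cg) / (s / u)"
        proof (intro divide_right_mono mult_left_mono)
          have "cg * V (u / s) \<le> cg * Vs (u / s)" using cg s u by (intro mult_left_mono V_le_Vs) auto
          also have "\<dots> \<le> g (u / s)" using s u that by (intro g_lower) auto
          finally show "V (u / s) \<le> g (u / s) / cg" using cg by (simp add: field_simps)
        qed (use Cn s in auto)
        finally have "t / u * k (s / u) \<le> t / u * (Cn * (g (u / s) / cg) / (s / u))"
          using t u by (intro mult_left_mono) auto
        also have "\<dots> = (Cn / cg) * ?W s" using u by (simp add: field_simps)
        also have "\<dots> \<le> K * ?W s" using K W0[of s] that by (intro mult_right_mono) auto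
        finally show ?thesis .
      qed
      show "1 \<le> K * (1 + x ^ 3) * ?W x" if x: "0 < x" for x
      proof -
        \<comment> \<open>For \<open>x \<ge> 1\<close>, two powers of \<open>x\<close> compensate
          the passage from \<open>u\<close> to \<open>u / x\<close> in \<open>Vs\<close>, and the
          third one the division by \<open>x\<close> in the target.\<close>
        have "t * (cg * V u) \<le> (1 + x ^ 3) * ?W x"
        proof (cases "1 \<le> x")
          case True
          have "V u \<le> Vs (x * (u / x))" using u x by (intro V_le_Vs) auto
          also have "\<dots> \<le> x\<^sup>2 * Vs (u / x)" using u x True by (intro Vs_scale_upper) auto
          finally have "cg * V u \<le> x\<^sup>2 * (cg * Vs (u / x))" using mult_left_mono[of "V u" _ cg] cg by (simp add: mult_ac)
          also have "\<dots> \<le> x\<^sup>2 * g (u / x)" using u x by (intro mult_left_mono g_lower) auto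
          finally have "t * (cg * V u) \<le> t * (x\<^sup>2 * g (u / x))" using t by (intro mult_left_mono) auto
          also have "\<dots> = x ^ 3 * ?W x" using x by (simp add: power2_eq_square power3_eq_cube)
          also have "\<dots> \<le> (1 + x ^ 3) * ?W x" using W0[OF x] by (intro mult_right_mono) auto
          finally show ?thesis .
        next
          case False
          have "V u \<le> Vs (u / x)" using u x False by (intro V_le_Vs) (auto simp: field_simps)
          then have "cg * V u \<le> cg * Vs (u / x)" using cg by (intro mult_left_mono) auto
          also have "\<dots> \<le> g (u / x)" using u x by (intro g_lower) auto
          also have "\<dots> \<le> g (u / x) / x" using x False mult_right_mono[OF _ g_nonneg[of "u / x"], of x 1] u
            by (simp add: field_simps)
          finally have "t * (cg * V u) \<le> t * (g (u / x) / x)" using t by (intro mult_left_mono) auto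
          also have "\<dots> = 1 * ?W x" by simp
          also have "\<dots> \<le> (1 + x ^ 3) * ?W x" using W0[OF x] x by (intro mult_right_mono) auto
          finally show ?thesis .
        qed
        then have "cg * (1 / (B0 * Ch)) \<le> (1 + x ^ 3) * ?W x"
          using mult_left_mono[OF tV, of cg] cg by (simp add: mult_ac)
        moreover have "0 \<le> B0 * Ch / cg" using B0 Ch cg by simp
        ultimately have "B0 * Ch / cg * (cg * (1 / (B0 * Ch))) \<le> B0 * Ch / cg * ((1 + x ^ 3) * ?W x)"
          by (intro mult_left_mono)
        moreover have "B0 * Ch / cg * (cg * (1 / (B0 * Ch))) = 1" using B0 Ch cg by simp
        moreover have "B0 * Ch / cg * ((1 + x ^ 3) * ?W x) \<le> K * ((1 + x ^ 3) * ?W x)"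
          by (rule mult_right_mono[OF K(3) mult_nonneg_nonneg[OF _ W0[OF x]]]) (use x in simp)
        ultimately show ?thesis by (simp only: mult.assoc)
      qed
      show "(1 + \<bar>y\<bar>) ^ 3 * exp (- Re (compensated_exponent ?m y)) \<le> J * cauchy_kernel y" for y
        unfolding Re
      proof (rule J)
        show "0 \<le> t * \<rho> (u * y)" for y using t \<rho>_nonneg by simp
        show "a * \<bar>y\<bar> powr \<alpha> \<le> t * \<rho> (u * y)" if y: "1 \<le> \<bar>y\<bar>" for y
        proof -
          have "d * \<bar>y\<bar> powr \<alpha> * V u \<le> \<rho> (\<bar>y\<bar> * u)" by (rule d(2)[OF u y])
          also have "\<dots> = \<rho> (u * y)" using \<rho>_abs[of "u * y"] u by (simp add: abs_mult mult.commute)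
          finally have "t * (d * \<bar>y\<bar> powr \<alpha> * V u) \<le> t * \<rho> (u * y)" using t by (intro mult_left_mono) auto
          moreover have "(d * \<bar>y\<bar> powr \<alpha>) * (1 / (B0 * Ch)) \<le> (d * \<bar>y\<bar> powr \<alpha>) * (t * V u)"
            using tV d by (intro mult_left_mono) auto
          ultimately show ?thesis unfolding a_def by (simp add: mult_ac)
        qed
      qed
    qed
    have Wx: "0 \<le> ?W \<bar>x\<bar>" if "x \<noteq> 0" using that N.W_nonneg[of "\<bar>x\<bar>"] by simp
    have 1: "norm (CLINT y|lborel. iexp (-(y * x)) * exp (- compensated_exponent ?m y)) \<le> C * ?W \<bar>x\<bar>" if "x \<noteq> 0"
    proof -
      have "norm (CLINT y|lborel. iexp (-(y * x)) * exp (- compensated_exponent ?m y)) \<le> D * ?W \<bar>x\<bar>"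
        using N.fourier_integral_bound_W[OF that] by (simp add: D_def)
      also have "\<dots> \<le> C * ?W \<bar>x\<bar>" using C Wx[OF that] by (intro mult_right_mono) auto
      finally show ?thesis .
    qed
    have "norm (CLINT y|lborel. iexp (-(y * x)) * exp (- compensated_exponent ?m y)) \<le> J * pi"
    proof (rule order_trans[OF norm_fourier_integral_le integrable_of_cauchy_bound(2)])
      show "(\<lambda>y. exp (- compensated_exponent ?m y)) \<in> borel_measurable borel"
        unfolding compensated_exponent_def by measurable
      fix y
      have "1 * exp (- Re (compensated_exponent ?m y)) \<le> (1 + \<bar>y\<bar>) ^ 3 * exp (- Re (compensated_exponent ?m y))"
        by (intro mult_right_mono one_le_power) auto
      moreover have "norm (exp (- compensated_exponent ?m y)) = exp (- Re (compensated_exponent ?m y))"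
        by (simp only: norm_exp_eq_Re uminus_complex.simps)
      ultimately show "norm (exp (- compensated_exponent ?m y)) \<le> J * cauchy_kernel y"
        using N.decay[of y] by linarith
    qed
    then show ?thesis using 1 C by auto
  qed
  show ?thesis by (rule that[OF C(1)]) (use main in blast)+
qed

end

lemma powr_unbounded:
  fixes \<alpha> a s :: real
  assumes "0 < \<alpha>" "0 < a" "0 < s"
  obtains l where "1 \<le> l" "s \<le> a * l powr \<alpha>"
proof
  define l where "l = max 1 ((s / a) powr (1 / \<alpha>))"
  show "1 \<le> l" by (simp add: l_def)
  have "s / a = ((s / a) powr (1 / \<alpha>)) powr \<alpha>" using assms by (simp add: powr_powr)
  also have "\<dots> \<le> l powr \<alpha>" using assms by (intro powr_mono2) (auto simp: l_def)
  finally show "s \<le> a * l powr \<alpha>" using assms by (simp add: field_simps)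
qed

definition (in levy_density) \<rho>s where "\<rho>s r = (SUP z\<in>{z. \<bar>z\<bar> \<le> r}. \<rho> z)" for r :: real

section \<open>Generalised inverses\<close>

lemma (in levy_density) \<rho>_le_h_abs: "\<bar>z\<bar> \<le> r \<Longrightarrow> \<rho> z \<le> 2 * h r"
  using \<rho>_le_h[of "\<bar>z\<bar>"] \<rho>_abs[of z] h_mono[of "\<bar>z\<bar>" r] by simp

lemma (in levy_density) \<rho>_le_\<rho>s: assumes "\<bar>z\<bar> \<le> r" shows "\<rho> z \<le> \<rho>s r"
  unfolding \<rho>s_def
proof (rule cSUP_upper)
  show "bdd_above (\<rho> ` {z. \<bar>z\<bar> \<le> r})"
    by (rule bdd_aboveI2[where M="2 * h r"]) (use \<rho>_le_h_abs in auto)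
qed (use assms in auto)

lemma (in levy_density) \<rho>s_least: assumes "0 \<le> r" "\<And>z. 0 \<le> z \<Longrightarrow> z \<le> r \<Longrightarrow> \<rho> z \<le> B" shows "\<rho>s r \<le> B"
  unfolding \<rho>s_def
proof (rule cSUP_least)
  show "{z. \<bar>z\<bar> \<le> r} \<noteq> {}" using assms(1) by (auto intro!: exI[of _ 0])
  show "\<rho> z \<le> B" if "z \<in> {z. \<bar>z\<bar> \<le> r}" for z using assms(2)[of "\<bar>z\<bar>"] that \<rho>_abs[of z] by simp
qed

text \<open>An almost increasing density is at least a multiple of \<open>k s\<close> on
  \<open>{s..2 * s}\<close>, an almost decreasing one on \<open>{s / 2..s}\<close>. The weight of
  \<open>V (1 / s)\<close> is at least \<open>exp (- 2)\<close> on the former interval and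
  \<open>exp (- 1) / 4\<close> on the latter.\<close>

lemma (in levy_density) k_le_V_of_almost_monotone:
  assumes "almost_monotone n" and kn: "\<And>s. 0 < s \<Longrightarrow> k s = n s"
  obtains C where "0 < C" "\<And>s. 0 < s \<Longrightarrow> k s \<le> C * V (1 / s) / s"
proof -
  consider "almost_increasing n" | "almost_decreasing n" using assms(1) by (auto simp: almost_monotone_def)
  then show ?thesis
  proof cases
    case 1
    then obtain d where d: "0 < d" "\<And>x y. 0 < x \<Longrightarrow> x \<le> y \<Longrightarrow> d * n x \<le> n y"
      unfolding almost_increasing_def by blast
    have "k s \<le> exp 2 / d * V (1 / s) / s" if s: "0 < s" for s
    proof -
      have "d * exp (- 2) * (2 * s - s) * k s \<le> V (1 / s)"
      proof (rule k_le_of_interval[OF s])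
        show "d * k s \<le> k r" if "s \<le> r" "r \<le> 2 * s" for r
          using d(2)[of s r] kn[of s] kn[of r] s that by simp
        show "exp (- 2) \<le> (1 / s * r)\<^sup>2 * exp (- (1 / s * r))" if "s \<le> r" "r \<le> 2 * s" for r
        proof -
          have "1 \<le> 1 / s * r" "1 / s * r \<le> 2" using that s by (auto simp: field_simps)
          then have "1 * exp (- 2) \<le> (1 / s * r)\<^sup>2 * exp (- (1 / s * r))"
            by (intro mult_mono one_le_power) auto
          then show ?thesis by simp
        qed
      qed (use s d in auto)
      then show ?thesis using s d by (simp add: exp_minus field_simps)
    qed
    then show ?thesis using that[of "exp 2 / d"] d by auto
  next
    case 2
    then obtain D where D: "1 \<le> D" "\<And>x y. 0 < x \<Longrightarrow> x \<le> y \<Longrightarrow> n y \<le> D * n x"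
      unfolding almost_decreasing_def by blast
    have "k s \<le> 8 * exp 1 * D * V (1 / s) / s" if s: "0 < s" for s
    proof -
      have "1 / D * (exp (- 1) / 4) * (s - s / 2) * k s \<le> V (1 / s)"
      proof (rule k_le_of_interval[OF s])
        show "1 / D * k s \<le> k r" if "s / 2 \<le> r" "r \<le> s" for r
          using D(2)[of r s] D(1) kn[of s] kn[of r] s that by (simp add: field_simps)
        show "exp (- 1) / 4 \<le> (1 / s * r)\<^sup>2 * exp (- (1 / s * r))" if "s / 2 \<le> r" "r \<le> s" for r
        proof -
          have y: "1 / 2 \<le> 1 / s * r" "1 / s * r \<le> 1" using that s by (auto simp: field_simps)
          have "(1 / 2)\<^sup>2 * exp (- 1) \<le> (1 / s * r)\<^sup>2 * exp (- (1 / s * r))"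
            by (intro mult_mono power_mono) (use y in auto)
          then show ?thesis by (simp add: power2_eq_square)
        qed
      qed (use s D in auto)
      then show ?thesis using s D by (simp add: exp_minus field_simps)
    qed
    then show ?thesis using that[of "8 * exp 1 * D"] D by auto
  qed
qed

context scaled_density begin

lemma V_unbounded: obtains y where "0 < y" "s \<le> V y"
proof -
  define z where "z = max x1 1"
  have z: "0 < z" "x1 \<le> z" by (auto simp: z_def)
  have "0 < c * V z" "0 < max s 1" using c V_pos[OF z(1)] by auto
  then obtain l where l: "1 \<le> l" "max s 1 \<le> c * V z * l powr \<alpha>"
    using powr_unbounded[OF \<alpha>] by blast
  then have "s \<le> V (l * z)" using scale[OF z l(1)] by (simp add: mult_ac)
  then show ?thesis using that[of "l * z"] l z by simp
qed

lemma \<rho>_unbounded: obtains y where "0 < y" "s \<le> \<rho> y"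
proof -
  obtain d where d: "0 < d" "\<And>x l. 0 < x \<Longrightarrow> x1 \<le> x \<Longrightarrow> 1 \<le> l \<Longrightarrow> d * l powr \<alpha> * V x \<le> \<rho> (l * x)"
    using \<rho>_scale_lower by blast
  define z where "z = max x1 1"
  have z: "0 < z" "x1 \<le> z" by (auto simp: z_def)
  have "0 < d * V z" "0 < max s 1" using d V_pos[OF z(1)] by auto
  then obtain l where l: "1 \<le> l" "max s 1 \<le> d * V z * l powr \<alpha>"
    using powr_unbounded[OF \<alpha>] by blast
  then have "s \<le> \<rho> (l * z)" using d(2)[OF z l(1)] by (simp add: mult_ac)
  then show ?thesis using that[of "l * z"] l z by simp
qed

text \<open>Since the supremum is not known to be attained, the estimates are made at an element
  \<open>r\<close> above half of it and carried over by \<open>h (2 * r) \<le> 4 * h r\<close>. The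
  condition \<open>2 * h x1 < s\<close> forces \<open>x1 \<le> r\<close>, where
  \<open>\<rho>\<close>, \<open>V\<close> and \<open>h\<close> are comparable.\<close>

lemma \<rho>s_inverse:
  obtains A where "0 < A" "\<And>s. 0 < s \<Longrightarrow> 2 * h x1 < s \<Longrightarrow>
    0 < Sup {r. 0 < r \<and> \<rho>s r = s} \<and> x1 \<le> Sup {r. 0 < r \<and> \<rho>s r = s} \<and>
    s \<le> 2 * h (Sup {r. 0 < r \<and> \<rho>s r = s}) \<and> h (Sup {r. 0 < r \<and> \<rho>s r = s}) \<le> A * s"
proof -
  obtain a where a: "0 < a" "\<And>u. 0 < u \<Longrightarrow> x1 \<le> u \<Longrightarrow> a * V u \<le> \<rho> u" using V_le_\<rho> by blast
  obtain Ch where Ch: "0 < Ch" "\<And>u. 0 < u \<Longrightarrow> x1 \<le> u \<Longrightarrow> h u \<le> Ch * V u" using h_le_V by blast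
  have "0 < Sup {r. 0 < r \<and> \<rho>s r = s} \<and> x1 \<le> Sup {r. 0 < r \<and> \<rho>s r = s} \<and>
    s \<le> 2 * h (Sup {r. 0 < r \<and> \<rho>s r = s}) \<and> h (Sup {r. 0 < r \<and> \<rho>s r = s}) \<le> 4 * Ch / a * s"
    if s: "0 < s" "2 * h x1 < s" for s
  proof -
    define S where "S = {r. 0 < r \<and> \<rho>s r = s}"
    define u where "u = Sup S"
    obtain y where y: "0 < y" "s \<le> \<rho> y" using \<rho>_unbounded by blast
    obtain z where z: "0 < z" "\<rho> z = s" "\<And>x. 0 \<le> x \<Longrightarrow> x \<le> z \<Longrightarrow> \<rho> x \<le> s"
      using attains_value_first[of \<rho> s y] continuous_on_subset[OF continuous_\<rho>] y s
      by (auto simp: \<rho>_def)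
    have "\<rho>s z = s" using \<rho>_le_\<rho>s[of z z] z \<rho>s_least[of z s] by auto
    then have zS: "z \<in> S" using z by (simp add: S_def)
    \<comment> \<open>From \<open>Y\<close> on the running supremum exceeds \<open>s\<close>, so the
      set is bounded and its supremum in the reals is meaningful.\<close>
    obtain Y where Y: "0 < Y" "s + 1 \<le> \<rho> Y" using \<rho>_unbounded by blast
    have bdd: "bdd_above S"
    proof (rule bdd_aboveI)
      fix r assume "r \<in> S"
      then have "\<rho>s r < s + 1" by (simp add: S_def)
      then show "r \<le> Y" using \<rho>_le_\<rho>s[of Y r] Y by (cases "Y \<le> r") auto
    qed
    have "z \<le> u" unfolding u_def by (rule cSup_upper[OF zS bdd])
    then have u: "0 < u" using z by simp
    then have "u / 2 < Sup S" by (simp add: u_def[symmetric])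
    then obtain r where r: "r \<in> S" "u / 2 < r" using less_cSup_iff[OF _ bdd, of "u / 2"] zS by auto
    have ru: "r \<le> u" unfolding u_def by (rule cSup_upper[OF r(1) bdd])
    have r0: "0 < r" "\<rho>s r = s" using r by (auto simp: S_def)
    have "x1 \<le> r"
    proof (rule ccontr)
      assume "\<not> x1 \<le> r"
      have "\<rho>s r \<le> 2 * h r" using r0 \<rho>_le_h_abs by (intro \<rho>s_least) auto
      also have "\<dots> \<le> 2 * h x1" using \<open>\<not> x1 \<le> r\<close> r0 h_mono[of r x1] by simp
      finally show False using r0 s by simp
    qed
    have "s \<le> 2 * h r" using r0 \<rho>_le_h_abs \<rho>s_least[of r "2 * h r"] by auto
    then have s2: "s \<le> 2 * h u" using h_mono[OF _ ru] r0 by simp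
    have "h u \<le> h (2 * r)" using u r by (intro h_mono) auto
    also have "\<dots> \<le> 4 * h r" using h_scale_upper[of 2 r] by simp
    also have "\<dots> \<le> 4 * (Ch * V r)" using Ch(2)[OF r0(1) \<open>x1 \<le> r\<close>] by simp
    also have "\<dots> \<le> 4 * (Ch * (s / a))"
    proof -
      have "a * V r \<le> s" using a(2)[OF r0(1) \<open>x1 \<le> r\<close>] \<rho>_le_\<rho>s[of r r] r0 by auto
      then have "V r \<le> s / a" using a by (simp add: field_simps)
      then show ?thesis using Ch(1) by (intro mult_left_mono) auto
    qed
    finally show ?thesis using u s2 \<open>x1 \<le> r\<close> ru by (simp add: u_def S_def)
  qed
  then show ?thesis using that[of "4 * Ch / a"] a Ch by auto
qed

text \<open>What is wanted is a lower bound for this inverse. The first passage \<open>w\<close>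
  belongs to the set, and as a point with \<open>V w = s\<close> it can be compared with others by
  scaling.\<close>

lemma Vs_inverse:
  assumes s: "0 < s" "2 * h x1 < s"
  obtains w where "0 < w" "x1 \<le> w" "V w = s" "w \<le> Sup {r. 0 < r \<and> Vs r = s}"
proof -
  let ?S = "{r. 0 < r \<and> Vs r = s}"
  obtain y where y: "0 < y" "s \<le> V y" using V_unbounded by blast
  obtain w where w: "0 < w" "V w = s" "\<And>x. 0 \<le> x \<Longrightarrow> x \<le> w \<Longrightarrow> V x \<le> s"
    using attains_value_first[of V s y] continuous_on_V_0 y s by (auto simp: V_def)
  have "Vs w = s" using V_le_Vs[of w w] w Vs_least[of w s] by auto
  then have wS: "w \<in> ?S" using w by simp
  obtain Y where Y: "0 < Y" "s + 1 \<le> V Y" using V_unbounded by blast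
  have bdd: "bdd_above ?S"
  proof (rule bdd_aboveI)
    fix r assume "r \<in> ?S"
    then have "Vs r < s + 1" by simp
    then show "r \<le> Y" using V_le_Vs[of Y r] Y by (cases "Y \<le> r") auto
  qed
  have "x1 \<le> w"
  proof (rule ccontr)
    assume "\<not> x1 \<le> w"
    then have "V w \<le> 2 * h x1" using V_le_h[of w] w h_mono[of w x1] by simp
    then show False using w s by simp
  qed
  then show ?thesis using that[OF w(1) _ w(2) cSup_upper[OF wS bdd]] by blast
qed

text \<open>If \<open>u\<close> exceeds \<open>w\<close>, then \<open>c * (u / w) powr \<alpha> * s
  \<le> V u \<le> 2 * h u \<le> 2 * A * s\<close>, which bounds the ratio
  \<open>u / w\<close>.\<close>

lemma inverse_comparison:
  assumes "0 < A" "0 < s" "0 < w" "x1 \<le> w" "V w = s" "0 < u" "h u \<le> A * s"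
  shows "u \<le> max 1 ((2 * A / c) powr (1 / \<alpha>)) * w"
proof (cases "u \<le> w")
  case True
  then have "u \<le> 1 * w" by simp
  also have "1 * w \<le> max 1 ((2 * A / c) powr (1 / \<alpha>)) * w" using assms by (intro mult_right_mono) auto
  finally show ?thesis by simp
next
  case False
  define l where "l = u / w"
  have l: "1 \<le> l" "u = l * w" using False assms by (auto simp: l_def)
  have "c * l powr \<alpha> * s \<le> V u" using scale[OF assms(3,4) l(1)] l(2) assms by simp
  also have "\<dots> \<le> 2 * A * s" using V_le_h[OF assms(6)] assms(7) by simp
  finally have "c * l powr \<alpha> \<le> 2 * A" using assms by simp
  then have "l powr \<alpha> \<le> 2 * A / c" using c by (simp add: field_simps)
  then have "(l powr \<alpha>) powr (1 / \<alpha>) \<le> (2 * A / c) powr (1 / \<alpha>)" using \<alpha> by (intro powr_mono2) auto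
  moreover have "(l powr \<alpha>) powr (1 / \<alpha>) = l" using \<alpha> l by (simp add: powr_powr)
  ultimately have "l \<le> max 1 ((2 * A / c) powr (1 / \<alpha>))" by simp
  then show ?thesis unfolding l(2) using assms by (intro mult_right_mono) auto
qed

end

context levy_density begin

lemma \<Phi>_exponent_derivatives:
  assumes phi: "\<And>u. 0 \<le> u \<Longrightarrow> \<phi> u = b * u + \<Phi> u" and u: "0 < u"
  shows "deriv \<phi> u = b + P 1 u" "deriv (deriv \<phi>) u = - P 2 u"
proof -
  have 1: "(\<phi> has_real_derivative b + P 1 v) (at v)" if "0 < v" for v
  proof (rule has_field_derivative_transform_within_open[where S="{0<..}"])
    show "((\<lambda>u. b * u + \<Phi> u) has_real_derivative b + P 1 v) (at v)"
      using that by (auto intro!: derivative_eq_intros \<Phi>_derivative)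
  qed (use that phi in auto)
  then show "deriv \<phi> u = b + P 1 u" using u by (intro DERIV_imp_deriv)
  have "(deriv \<phi> has_real_derivative - P 2 u) (at u)"
  proof (rule has_field_derivative_transform_within_open[where S="{0<..}"])
    show "((\<lambda>u. b + P 1 u) has_real_derivative - P 2 u) (at u)"
      using u P_derivative[of 1 u] by (auto intro!: derivative_eq_intros simp: numeral_2_eq_2)
    show "b + P 1 v = deriv \<phi> v" if "v \<in> {0<..}" for v
      using 1 that by (intro DERIV_imp_deriv[symmetric]) auto
  qed (use u in auto)
  then show "deriv (deriv \<phi>) u = - P 2 u" by (rule DERIV_imp_deriv)
qed

text \<open>For \<open>u * s < 1\<close> the factor \<open>exp 1 * exp (- (u * s))\<close> is at
  least 1. This is the origin of the number e in the range of \<open>x\<close> in the second bound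
  of the theorem.\<close>

lemma integral_truncated_le: assumes "0 < u"
  shows "(LINT s|lborel. k s * (indicator {..<1 / u} s * s)) \<le> exp 1 * P 1 u"
    "0 \<le> (LINT s|lborel. k s * (indicator {..<1 / u} s * s))"
proof -
  have "(LINT s|lborel. k s * (indicator {..<1 / u} s * s)) \<le> (LINT s|lborel. k s * (exp 1 * (s ^ 1 * exp (- (u * s)))))"
  proof (rule integral_k_mono)
    show "integrable lborel (\<lambda>s. k s * (exp 1 * (s ^ 1 * exp (- (u * s)))))"
      using integrable_mult_right[OF P_integrable[of 1 u], of "exp 1"] assms
      by (simp only: mult.left_commute[of "exp 1 :: real"] zero_less_one)
    fix s :: real assume s: "0 < s"
    show "indicator {..<1 / u} s * s \<le> exp 1 * (s ^ 1 * exp (- (u * s)))"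
    proof (cases "s < 1 / u")
      case True
      then have "u * s \<le> 1" using assms by (simp add: field_simps)
      then have "1 \<le> exp 1 * exp (- (u * s))" by (simp flip: exp_add)
      then have "s * 1 \<le> s * (exp 1 * exp (- (u * s)))" using s by (intro mult_left_mono) auto
      then show ?thesis using True by (simp add: mult_ac)
    qed (use s in simp)
  qed simp
  also have "\<dots> = exp 1 * P 1 u"
    unfolding P_def integral_mult_right_zero[symmetric] by (simp add: mult_ac)
  finally show "(LINT s|lborel. k s * (indicator {..<1 / u} s * s)) \<le> exp 1 * P 1 u" .
  show "0 \<le> (LINT s|lborel. k s * (indicator {..<1 / u} s * s))"
    by (rule integral_k_nonneg) simp
qed

text \<open>After substituting \<open>u * y\<close> for the frequency, the shift by \<open>t\<close>
  times the truncated drift cancels \<open>b\<close> and supplies exactly the compensation. The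
  factor \<open>1 / (2 * pi)\<close> is replaced by 1.\<close>

lemma fourier_density_rescaled:
  fixes \<psi> :: "real \<Rightarrow> complex"
  assumes t: "0 < t" and u: "0 < u"
    and psi: "\<And>y. \<psi> y = - \<i> * y * b + (CLINT s|lborel. k s *\<^sub>R (1 - iexp (y * s)))"
  shows "fourier_density (\<lambda>y. exp (- of_real t * \<psi> y)) (x + t * (b + (LINT s|lborel. k s * (indicator {..<1 / u} s * s))))
    \<le> u * norm (CLINT y|lborel. iexp (-(y * (u * x))) * exp (- compensated_exponent (\<lambda>s. t / u * k (s / u)) y))"
    (is "fourier_density _ (x + t * (b + ?\<beta>)) \<le> u * norm ?I")
proof -
  let ?z = "x + t * (b + ?\<beta>)"
  have "(CLINT y|lborel. iexp (-(y * ?z)) * exp (- of_real t * \<psi> y))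
      = \<bar>u\<bar> *\<^sub>R (CLINT y|lborel. iexp (-((0 + u * y) * ?z)) * exp (- of_real t * \<psi> (0 + u * y)))"
    by (rule lborel_integral_real_affine) (use u in simp)
  also have "(\<lambda>y. iexp (-((0 + u * y) * ?z)) * exp (- of_real t * \<psi> (0 + u * y)))
      = (\<lambda>y. iexp (-(y * (u * x))) * exp (- compensated_exponent (\<lambda>s. t / u * k (s / u)) y))"
  proof
    fix y
    show "iexp (-((0 + u * y) * ?z)) * exp (- of_real t * \<psi> (0 + u * y))
      = iexp (-(y * (u * x))) * exp (- compensated_exponent (\<lambda>s. t / u * k (s / u)) y)"
      unfolding compensated_exponent_rescaled[OF t u] psi exp_add[symmetric] add_0
      by (rule arg_cong[where f=exp]) (simp add: algebra_simps)
  qed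
  finally have eq: "(CLINT y|lborel. iexp (-(y * ?z)) * exp (- of_real t * \<psi> y)) = \<bar>u\<bar> *\<^sub>R ?I" .
  have "fourier_density (\<lambda>y. exp (- of_real t * \<psi> y)) ?z = u * Re ?I / (2 * pi)"
    unfolding fourier_density_def eq using u by simp
  also have "\<dots> \<le> u * norm ?I / (2 * pi)"
    using u by (intro divide_right_mono mult_left_mono complex_Re_le_cmod) auto
  also have "\<dots> \<le> u * norm ?I / 1"
    using u pi_ge_two by (intro divide_left_mono) auto
  finally show ?thesis by simp
qed

end

section \<open>Transition densities of subordinators\<close>

lemma levy_density_of_levy_measure:
  assumes "subordinator_levy_measure \<nu>" "has_levy_density \<nu> n"
  defines "k \<equiv> \<lambda>s. indicator {0<..} s * n s"
  shows "levy_density k" "\<nu> = density lborel (\<lambda>x. ennreal (k x))"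
proof -
  show eq: "\<nu> = density lborel (\<lambda>x. ennreal (k x))"
    using assms(2) by (simp add: has_levy_density_def k_def)
  have km [measurable]: "k \<in> borel_measurable borel"
    using assms(2) by (simp add: has_levy_density_def k_def set_borel_measurable_def)
  have k0: "0 \<le> k s" for s using assms(2) by (auto simp: has_levy_density_def k_def indicator_def)
  show "levy_density k"
  proof
    show "integrable lborel (\<lambda>s. k s * min 1 s)"
    proof (rule integrableI_bounded)
      have "(\<integral>\<^sup>+s. ennreal (norm (k s * min 1 s)) \<partial>lborel) = (\<integral>\<^sup>+s. ennreal (k s) * (ennreal (min 1 s) * indicator {0<..} s) \<partial>lborel)"
      proof (rule nn_integral_cong)
        fix s
        show "ennreal (norm (k s * min 1 s)) = ennreal (k s) * (ennreal (min 1 s) * indicator {0<..} s)"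
          using k0[of s] by (cases "0 < s") (auto simp: k_def abs_mult ennreal_mult)
      qed
      also have "\<dots> = (\<integral>\<^sup>+s\<in>{0<..}. ennreal (min 1 s) \<partial>\<nu>)"
        unfolding eq by (subst nn_integral_density) auto
      also have "\<dots> < \<infinity>" using assms(1) by (simp add: subordinator_levy_measure_def)
      finally show "(\<integral>\<^sup>+s. ennreal (norm (k s * min 1 s)) \<partial>lborel) < \<infinity>" .
    qed measurable
  qed (use k0 km in \<open>auto simp: k_def\<close>)
qed

text \<open>For \<open>x0 > 0\<close> the inverses at \<open>1/t > V x0\<close> may lie below \<open>x0\<close>, so scaling is needed
  down to a smaller \<open>x1\<close>; the bound on \<open>h x1\<close> keeps both inverses above \<open>x1\<close>.\<close>

lemma (in levy_density) scaling_below: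
  assumes pos: "\<And>u. 0 < u \<Longrightarrow> 0 < P 2 u"
    and "0 < \<alpha>" "0 < c" "0 \<le> x0"
    and wlsc: "\<And>l x. 1 \<le> l \<Longrightarrow> x0 < x \<Longrightarrow> c * l powr (\<alpha> - 2) * P 2 x \<le> P 2 (l * x)"
  obtains \<alpha>' c' x1 where "0 < \<alpha>'" "0 < c'" "0 \<le> x1" "x0 = 0 \<longrightarrow> x1 = 0" "x0 \<noteq> 0 \<longrightarrow> 2 * h x1 < V x0"
    "\<And>x l. 0 < x \<Longrightarrow> x1 \<le> x \<Longrightarrow> 1 \<le> l \<Longrightarrow> c' * l powr \<alpha>' * V x \<le> V (l * x)"
proof -
  have sc: "c * l powr \<alpha> * V x \<le> V (l * x)" if "x0 < x" "1 \<le> l" for x l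
  proof -
    have "l powr \<alpha> = l powr (\<alpha> - 2) * l\<^sup>2" using that powr_add[of l "\<alpha> - 2" 2] by simp
    then have "c * l powr \<alpha> * V x = (l * x)\<^sup>2 * (c * l powr (\<alpha> - 2) * P 2 x)"
      by (simp add: V_def power_mult_distrib)
    also have "\<dots> \<le> (l * x)\<^sup>2 * P 2 (l * x)" by (intro mult_left_mono wlsc that) auto
    finally show ?thesis by (simp add: V_def)
  qed
  show ?thesis
  proof (cases "x0 = 0")
    case True
    show ?thesis by (rule that[of \<alpha> c 0]) (use assms sc True in auto)
  next
    case False
    then have x0: "0 < x0" "0 < V x0" using assms pos[of x0] by (auto simp: V_def)
    obtain y where y: "0 < y" "h y < V x0 / 2" using h_small[of "V x0 / 2"] x0 by auto
    define x1 where "x1 = min y x0"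
    have x1: "0 < x1" "x1 \<le> x0" "2 * h x1 < V x0"
      using y x0 h_mono[of x1 y] by (auto simp: x1_def)
    obtain \<alpha>' c' where *: "0 < \<alpha>'" "0 < c'" "\<And>x l. x1 \<le> x \<Longrightarrow> 1 \<le> l \<Longrightarrow> c' * l powr \<alpha>' * V x \<le> V (l * x)"
      using scaling_extend[OF pos \<open>0 < \<alpha>\<close> \<open>0 < c\<close> x1(1,2) sc] by metis
    show ?thesis by (rule that[of \<alpha>' c' x1]) (use * x1 False in auto)
  qed
qed

theorem theorem4p8:
  fixes M :: "'a measure" and T :: "real \<Rightarrow> 'a \<Rightarrow> real"
    and \<phi> :: "real \<Rightarrow> real" and \<psi> :: "real \<Rightarrow> complex"
    and b :: real and \<nu> :: "real measure" and n :: "real \<Rightarrow> real"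
    and \<alpha> c x0 :: real
  assumes "subordinator M T"
    and "is_laplace_exponent M T \<phi>"
    and "is_levy_khintchine_exponent M T \<psi>"
    and "has_characteristics \<phi> \<psi> b \<nu>"
    and "\<exists>x>0. deriv (deriv \<phi>) x \<noteq> 0"
    and "0 < \<alpha>" and "0 < c" and "c \<le> 1" and "0 \<le> x0"
    and "WLSC (\<alpha> - 2) c x0 (\<lambda>x. - deriv (deriv \<phi>) x)"
    and "has_levy_density \<nu> n"
    and "almost_monotone n"
  shows "\<exists>p. continuous_densities M T p \<and>
    (\<exists>C>0.
      (\<forall>t x. 0 < t \<and> ereal t < time_bound \<phi> x0 \<longrightarrow>
         ereal (p t (x + t * trunc_drift b \<nu> (1 / psi_inv \<psi> (1 / t))))
           \<le> ereal C * min (ereal (vphi_inv \<phi> (1 / t))) (ereal t * eta \<phi> x0 \<bar>x\<bar>)) \<and>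
      (\<forall>t x. 0 < t \<and> ereal t < time_bound \<phi> x0 \<and>
             2 * exp 1 * t * deriv \<phi> (psi_inv \<psi> (1 / t)) \<le> x \<longrightarrow>
         ereal (p t (x + t * b))
           \<le> ereal C * min (ereal (vphi_inv \<phi> (1 / t))) (ereal t * eta \<phi> x0 x)))"
proof -
  define k where "k s = indicator {0<..} s * n s" for s
  from assms(4) have nu: "subordinator_levy_measure \<nu>" and b: "0 \<le> b" by (auto simp: has_characteristics_def)
  interpret levy_density k
    using levy_density_of_levy_measure(1)[OF nu assms(11)] unfolding k_def[abs_def] .
  have nu_eq: "\<nu> = density lborel (\<lambda>x. ennreal (k x))"
    using levy_density_of_levy_measure(2)[OF nu assms(11)] unfolding k_def .
  interpret subordinator M T by (rule assms(1))

  \<comment> \<open>The given exponents expressed through the jump density\<close>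
  have phi: "\<phi> u = b * u + \<Phi> u" if "0 \<le> u" for u
  proof -
    have "(LINT s:{0<..}|\<nu>. 1 - exp (- u * s)) = \<Phi> u"
    proof -
      have "(LINT s:{0<..}|\<nu>. 1 - exp (- u * s)) = (LINT s|lborel. k s *\<^sub>R (indicator {0<..} s *\<^sub>R (1 - exp (- u * s))))"
        unfolding nu_eq by (rule set_integral_density) measurable
      then show ?thesis unfolding k_indicator by (simp add: \<Phi>_def)
    qed
    then show ?thesis using assms(4) that by (simp add: has_characteristics_def)
  qed
  have dphi: "deriv \<phi> u = b + P 1 u" "deriv (deriv \<phi>) u = - P 2 u" if "0 < u" for u
    using \<Phi>_exponent_derivatives[of \<phi> b u] phi that by blast+
  have vphi_V: "vphi \<phi> u = V u" if "0 < u" for u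
    using dphi(2)[OF that] by (simp add: vphi_def V_def)
  have vphi_star_Vs: "vphi_star \<phi> r = Vs r" for r
    unfolding vphi_star_def Vs_def by (rule SUP_cong) (auto simp: vphi_V)
  have psi: "\<psi> y = - \<i> * y * b + (CLINT s|lborel. k s *\<^sub>R (1 - iexp (y * s)))" for y
  proof -
    have "(CLINT s:{0<..}|\<nu>. iexp (y * s) - 1) = (CLINT s|lborel. k s *\<^sub>R (iexp (y * s) - 1))"
    proof -
      have "(CLINT s:{0<..}|\<nu>. iexp (y * s) - 1) = (CLINT s|lborel. k s *\<^sub>R (indicator {0<..} s *\<^sub>R (iexp (y * s) - 1)))"
        unfolding nu_eq by (rule set_integral_density) measurable
      then show ?thesis unfolding k_indicator .
    qed
    moreover have "(CLINT s|lborel. k s *\<^sub>R (1 - iexp (y * s))) = - (CLINT s|lborel. k s *\<^sub>R (iexp (y * s) - 1))"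
      by (simp add: scaleR_diff_right flip: Bochner_Integration.integral_minus)
    ultimately show ?thesis using assms(4) by (simp add: has_characteristics_def)
  qed
  have Re_psi: "Re (\<psi> y) = \<rho> y" for y
    unfolding psi using Re_integral_iexp[of y] by simp
  have psi_star_\<rho>s: "psi_star \<psi> r = \<rho>s r" for r
    unfolding psi_star_def \<rho>s_def Re_psi ..
  have drift: "trunc_drift b \<nu> r = b + (LINT s|lborel. k s * (indicator {..<r} s * s))" for r
  proof -
    have "(LINT s:{0<..<r}|\<nu>. s) = (LINT s|lborel. k s * (indicator {..<r} s * s))"
    proof -
      have "(LINT s:{0<..<r}|\<nu>. s) = (LINT s|lborel. k s *\<^sub>R (indicator {0<..<r} s *\<^sub>R s))"
        unfolding nu_eq by (rule set_integral_density) measurable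
      also have "\<dots> = (LINT s|lborel. k s * (indicator {..<r} s * s))"
        by (rule Bochner_Integration.integral_cong) (auto simp: indicator_def k_neg)
      finally show ?thesis .
    qed
    then show ?thesis by (simp add: trunc_drift_def)
  qed

  \<comment> \<open>Scaling of the second derivative and the range of admissible times\<close>
  obtain v where v: "0 < v" "P 2 v \<noteq> 0" using assms(5) dphi(2) by fastforce
  have P2: "0 < P 2 u" if "0 < u" for u by (rule P_pos[of 2]) (use v that in auto)
  have wlsc: "c * l powr (\<alpha> - 2) * P 2 x \<le> P 2 (l * x)" if "1 \<le> l" "x0 < x" for l x
  proof -
    have "0 < x" "0 < l * x" using that assms(9) by auto
    moreover have "c * l powr (\<alpha> - 2) * (- deriv (deriv \<phi>) x) \<le> - deriv (deriv \<phi>) (l * x)"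
      using assms(10) that unfolding WLSC_def by blast
    ultimately show ?thesis by (simp only: dphi(2) minus_minus)
  qed
  obtain \<alpha>' c' x1 where sc: "0 < \<alpha>'" "0 < c'" "0 \<le> x1" "x0 = 0 \<longrightarrow> x1 = 0" "x0 \<noteq> 0 \<longrightarrow> 2 * h x1 < V x0"
    "\<And>x l. 0 < x \<Longrightarrow> x1 \<le> x \<Longrightarrow> 1 \<le> l \<Longrightarrow> c' * l powr \<alpha>' * V x \<le> V (l * x)"
    using scaling_below[OF P2 assms(6,7,9) wlsc] by metis
  obtain Cn where Cn: "0 < Cn" "\<And>s. 0 < s \<Longrightarrow> k s \<le> Cn * V (1 / s) / s"
    using k_le_V_of_almost_monotone[OF assms(12)] by (auto simp: k_def)
  interpret scaled_density k \<alpha>' c' x1 Cn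
    by unfold_locales (use sc Cn P2 in \<open>auto simp: V_def\<close>)

  \<comment> \<open>This is the threshold at which both lemmas on inverses apply. For
    \<open>x0 = 0\<close> also \<open>x1 = 0\<close>, and \<open>h 0 = 0\<close>.\<close>
  have small_time: "2 * h x1 < 1 / t" if "0 < t" "ereal t < time_bound \<phi> x0" for t
  proof (cases "x0 = 0")
    case True
    then show ?thesis using sc(4) that by (simp add: h_def)
  next
    case False
    then have x0: "0 < x0" using assms(9) by simp
    then have "t < 1 / V x0" using that False by (simp add: time_bound_def vphi_V)
    then have "V x0 < 1 / t" using that V_pos[OF x0] by (simp add: field_simps)
    then show ?thesis using sc(5) False by simp
  qed

  \<comment> \<open>Existence, continuity and nonnegativity of the transition densities\<close>
  define p where "p t = fourier_density (char (distr M borel (T t)))" for t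
  have char_T: "char (distr M borel (T t)) = (\<lambda>y. exp (- of_real t * \<psi> y))" if "0 \<le> t" for t
  proof
    fix y
    have "char (distr M borel (T t)) y = (CLINT \<omega>|M. iexp (y * T t \<omega>))"
      unfolding char_def using measurable_X[OF that] by (subst integral_distr) auto
    then show "char (distr M borel (T t)) y = exp (- of_real t * \<psi> y)"
      using assms(3) that by (simp add: is_levy_khintchine_exponent_def)
  qed
  have cont: "continuous_densities M T p"
    unfolding continuous_densities_def
  proof (intro allI impI)
    fix t :: real assume t: "0 < t"
    interpret R: real_distribution "distr M borel (T t)"
      by (rule real_distribution_distr) (use measurable_X t in auto)
    have ch: "integrable lborel (char (distr M borel (T t)))"
    proof (rule exp_\<rho>_integrable[OF t])
      show "norm (char (distr M borel (T t)) y) = exp (- (t * \<rho> y))" for y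
        using t by (simp add: char_T Re_psi)
    qed measurable
    have c: "continuous_on UNIV (p t)"
      unfolding p_def fourier_density_def
      by (intro continuous_intros continuous_fourier_integral[OF ch]) auto
    have "distributed M lborel (T t) (\<lambda>x. ennreal (p t x))"
      unfolding distributed_def
    proof (intro conjI)
      show "distr M lborel (T t) = density lborel (\<lambda>x. ennreal (p t x))"
        using R.density_of_integrable_char[OF ch] by (simp add: p_def cong: distr_cong)
      show "(\<lambda>x. ennreal (p t x)) \<in> borel_measurable lborel"
        using borel_measurable_continuous_onI[OF c] by simp
      show "T t \<in> measurable M lborel" using measurable_X[of t] t by simp
    qed
    then show "continuous_on UNIV (p t) \<and> (\<forall>x. 0 \<le> p t x) \<and> distributed M lborel (T t) (\<lambda>x. ennreal (p t x))"
      using c R.fourier_density_nonneg[OF ch] by (simp add: p_def)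
  qed

  \<comment> \<open>Monotonicity, doubling and lower bound for the numerator of
    \<open>\<eta>\<close>\<close>
  define A where "A = vphi_star \<phi> x0 / \<phi> x0"
  \<comment> \<open>The factor \<open>A\<close> makes the branches agree at \<open>x0\<close>, so
    \<open>g\<close> is increasing across the junction.\<close>
  define g where "g v = (if x0 = 0 \<or> x0 \<le> v then Vs v else A * \<phi> v)" for v
  \<comment> \<open>Below \<open>x0\<close> the inequality \<open>Vs \<le> 2 * \<phi>\<close> yields
    the factor \<open>A / 2\<close>.\<close>
  define cg where "cg = (if x0 = 0 then 1 else min 1 (A / 2))"
  have phi_mono: "\<phi> v \<le> \<phi> w" if "0 \<le> v" "v \<le> w" for v w
    using phi[of v] phi[of w] \<Phi>_mono[OF that] mult_left_mono[OF that(2) b] that by simp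
  have phi_double: "\<phi> (2 * v) \<le> 2 * \<phi> v" if "0 \<le> v" for v
    using phi[of v] phi[of "2 * v"] \<Phi>_double[OF that] that by simp
  have Vs_phi: "Vs v \<le> 2 * \<phi> v" if "0 < v" for v
  proof (rule Vs_least[OF that])
    fix x assume x: "0 < x" "x \<le> v"
    then show "V x \<le> 2 * \<phi> v"
      using V_le_\<Phi>[of x] phi[of x] phi_mono[of x v] mult_nonneg_nonneg[OF b, of x] by simp
  qed
  have Vs_pos: "0 < Vs v" if "0 < v" for v using V_le_Vs[of v v] V_pos[OF that] that by simp
  have phi_pos: "0 < \<phi> v" if "0 < v" for v using Vs_phi[OF that] Vs_pos[OF that] by simp
  have A: "0 < A" "A * \<phi> x0 = Vs x0" if "x0 \<noteq> 0"
    unfolding A_def vphi_star_Vs using that assms(9) Vs_pos[of x0] phi_pos[of x0] by auto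
  have cg: "0 < cg" unfolding cg_def using A by auto
  have g_mono: "g v \<le> g w" if vw: "0 < v" "v \<le> w" for v w
  proof -
    consider "x0 = 0 \<or> x0 \<le> v" | "x0 \<noteq> 0" "v < x0" "x0 \<le> w" | "x0 \<noteq> 0" "w < x0" by linarith
    then show ?thesis
    proof cases
      case 1
      then show ?thesis using Vs_mono[OF vw] vw by (auto simp: g_def)
    next
      case 2
      have "A * \<phi> v \<le> A * \<phi> x0" using A[OF 2(1)] phi_mono[of v x0] 2 vw by (intro mult_left_mono) auto
      also have "\<dots> \<le> Vs w" using A[OF 2(1)] Vs_mono[of x0 w] 2 vw by simp
      finally show ?thesis using 2 by (simp add: g_def)
    next
      case 3
      then show ?thesis using A[OF 3(1)] phi_mono[of v w] vw by (simp add: g_def)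
    qed
  qed
  have Vs_double: "Vs (2 * v) \<le> 4 * Vs v" if "0 < v" for v using Vs_scale_upper[OF that, of 2] by simp
  have g_double: "g (2 * v) \<le> 8 * g v" if v: "0 < v" for v
  proof -
    consider "x0 = 0 \<or> x0 \<le> v" | "x0 \<noteq> 0" "v < x0" "x0 \<le> 2 * v" | "x0 \<noteq> 0" "2 * v < x0" "v < x0"
      using v by linarith
    then show ?thesis
    proof cases
      case 1
      then show ?thesis using Vs_double[OF v] Vs_nonneg[OF v] v by (auto simp: g_def)
    next
      case 2
      have x0: "0 < x0" using 2 v by simp
      have "Vs (2 * v) \<le> Vs (2 * x0)" using 2 v by (intro Vs_mono) auto
      also have "\<dots> \<le> 4 * (A * \<phi> x0)" using Vs_double[OF x0] A[OF 2(1)] by simp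
      also have "\<dots> \<le> 4 * (A * (2 * \<phi> v))"
        using A[OF 2(1)] phi_mono[of x0 "2 * v"] phi_double[of v] 2 v by (intro mult_left_mono) auto
      finally show ?thesis using 2 by (simp add: g_def)
    next
      case 3
      then have "A * \<phi> (2 * v) \<le> A * (2 * \<phi> v)" using A[OF 3(1)] phi_double[of v] v by (intro mult_left_mono) auto
      then show ?thesis using 3 A[OF 3(1)] phi_pos[OF v] mult_pos_pos[of A "\<phi> v"] by (simp add: g_def)
    qed
  qed
  have g_lower: "cg * Vs v \<le> g v" if v: "0 < v" for v
  proof (cases "x0 = 0 \<or> x0 \<le> v")
    case True
    then have "cg * Vs v \<le> 1 * Vs v" using Vs_nonneg[OF v] by (intro mult_right_mono) (auto simp: cg_def)
    then show ?thesis using True by (simp add: g_def)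
  next
    case False
    then have "cg * Vs v \<le> A / 2 * (2 * \<phi> v)"
      using Vs_nonneg[OF v] Vs_phi[OF v] A by (intro mult_mono) (auto simp: cg_def)
    then show ?thesis using False by (simp add: g_def)
  qed
  have eta_g: "eta \<phi> x0 s = ereal (g (1 / s) / s)" if "0 < s" for s
  proof (cases "x0 = 0")
    case False
    then have "s \<le> 1 / x0 \<longleftrightarrow> x0 \<le> 1 / s" using that assms(9) by (auto simp: field_simps)
    then show ?thesis using that False by (auto simp: eta_def g_def A_def vphi_star_Vs)
  qed (use that in \<open>auto simp: eta_def g_def vphi_star_Vs\<close>)

  \<comment> \<open>Bounds at the scale \<open>psi_inv\<close> and passage to
    \<open>vphi_inv\<close>\<close>
  obtain A1 where A1: "0 < A1" "\<And>s. 0 < s \<Longrightarrow> 2 * h x1 < s \<Longrightarrow>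
    0 < Sup {r. 0 < r \<and> \<rho>s r = s} \<and> x1 \<le> Sup {r. 0 < r \<and> \<rho>s r = s} \<and>
    s \<le> 2 * h (Sup {r. 0 < r \<and> \<rho>s r = s}) \<and> h (Sup {r. 0 < r \<and> \<rho>s r = s}) \<le> A1 * s"
    using \<rho>s_inverse by blast
  have u_props: "0 < psi_inv \<psi> (1 / t)" "x1 \<le> psi_inv \<psi> (1 / t)" "t * h (psi_inv \<psi> (1 / t)) \<le> A1"
    "1 \<le> 2 * (t * h (psi_inv \<psi> (1 / t)))" "h (psi_inv \<psi> (1 / t)) \<le> A1 * (1 / t)"
    if t: "0 < t" "ereal t < time_bound \<phi> x0" for t
    using A1(2)[of "1 / t"] small_time[OF t] t(1) unfolding psi_inv_def psi_star_\<rho>s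
    by (auto simp: field_simps)
  obtain C where C: "0 < C"
    "\<And>t u x. 0 < t \<Longrightarrow> 0 < u \<Longrightarrow> x1 \<le> u \<Longrightarrow> t * h u \<le> A1 \<Longrightarrow> 1 \<le> 2 * (t * h u) \<Longrightarrow>
      norm (CLINT y|lborel. iexp (-(y * x)) * exp (- compensated_exponent (\<lambda>s. t / u * k (s / u)) y)) \<le> C"
    "\<And>t u x. 0 < t \<Longrightarrow> 0 < u \<Longrightarrow> x1 \<le> u \<Longrightarrow> t * h u \<le> A1 \<Longrightarrow> 1 \<le> 2 * (t * h u) \<Longrightarrow> x \<noteq> 0 \<Longrightarrow>
      norm (CLINT y|lborel. iexp (-(y * x)) * exp (- compensated_exponent (\<lambda>s. t / u * k (s / u)) y))
        \<le> C * (t * g (u / \<bar>x\<bar>) / \<bar>x\<bar>)"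
    using normalized_bound[OF cg A1(1) zero_less_numeral g_mono g_double g_lower] by blast
  define K where "K = max 1 ((2 * A1 / c') powr (1 / \<alpha>'))"
  have K: "1 \<le> K" by (simp add: K_def)
  \<comment> \<open>Undoing the rescaling produces the factor \<open>psi_inv \<psi> (1 / t)\<close>,
    whereas the claim is stated with \<open>vphi_inv\<close>.\<close>
  have inv_le: "psi_inv \<psi> (1 / t) \<le> K * vphi_inv \<phi> (1 / t)"
    if t: "0 < t" "ereal t < time_bound \<phi> x0" for t
  proof -
    obtain w where w: "0 < w" "x1 \<le> w" "V w = 1 / t" "w \<le> vphi_inv \<phi> (1 / t)"
      using Vs_inverse[of "1 / t"] small_time[OF t] t(1) unfolding vphi_inv_def vphi_star_Vs by auto
    have "psi_inv \<psi> (1 / t) \<le> K * w"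
      unfolding K_def using A1(1) _ w(1-3) u_props(1,5)[OF t] by (rule inverse_comparison) (use t in simp)
    also have "\<dots> \<le> K * vphi_inv \<phi> (1 / t)" using w K by (intro mult_left_mono) auto
    finally show ?thesis .
  qed
  have bound: "p t (x + t * trunc_drift b \<nu> (1 / psi_inv \<psi> (1 / t))) \<le> C * K * vphi_inv \<phi> (1 / t)
      \<and> (x \<noteq> 0 \<longrightarrow> p t (x + t * trunc_drift b \<nu> (1 / psi_inv \<psi> (1 / t))) \<le> C * (t * (g (1 / \<bar>x\<bar>) / \<bar>x\<bar>)))"
    if t: "0 < t" "ereal t < time_bound \<phi> x0" for t x
  proof -
    define u where "u = psi_inv \<psi> (1 / t)"
    note u = u_props[OF t, folded u_def]
    let ?I = "CLINT y|lborel. iexp (-(y * (u * x))) * exp (- compensated_exponent (\<lambda>s. t / u * k (s / u)) y)"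
    have "p t = fourier_density (\<lambda>y. exp (- of_real t * \<psi> y))" unfolding p_def using t char_T by simp
    then have le: "p t (x + t * trunc_drift b \<nu> (1 / u)) \<le> u * norm ?I"
      unfolding drift using fourier_density_rescaled[OF t(1) u(1) psi] by simp
    have "u * norm ?I \<le> u * C" by (rule mult_left_mono[OF C(2)[OF t(1) u(1-4)] less_imp_le[OF u(1)]])
    also have "\<dots> \<le> (K * vphi_inv \<phi> (1 / t)) * C"
      using inv_le[OF t, folded u_def] C(1) by (intro mult_right_mono) auto
    finally have 1: "u * norm ?I \<le> C * K * vphi_inv \<phi> (1 / t)" by (simp add: mult_ac)
    have 2: "u * norm ?I \<le> C * (t * (g (1 / \<bar>x\<bar>) / \<bar>x\<bar>))" if "x \<noteq> 0"
    proof -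
      \<comment> \<open>At the rescaled point \<open>u * x\<close> the scale disappears from the
        argument of \<open>g\<close>, and the outer \<open>u\<close> cancels the one in the
        denominator.\<close>
      have "u * norm ?I \<le> u * (C * (t * g (u / \<bar>u * x\<bar>) / \<bar>u * x\<bar>))"
        by (rule mult_left_mono[OF C(3)[OF t(1) u(1-4)] less_imp_le[OF u(1)]]) (use u(1) that in simp)
      also have "\<dots> = C * (t * (g (1 / \<bar>x\<bar>) / \<bar>x\<bar>))" using u(1) that by (simp add: abs_mult)
      finally show ?thesis .
    qed
    show ?thesis using le 1 2 unfolding u_def by fastforce
  qed

  \<comment> \<open>The factor 16 = 8 * 2 is for the second bound, where the distance to the centre
    may shrink to \<open>x / 2\<close>: 8 from \<open>g\<close>, 2 from the division.\<close>
  define C' where "C' = C * K * 16"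
  have C': "0 < C'" "C * K \<le> C'" "16 * C \<le> C'"
    unfolding C'_def using C(1) K by auto
  have g_nonneg: "0 \<le> g v" if "0 < v" for v
    using g_lower[OF that] mult_nonneg_nonneg[OF less_imp_le[OF cg] Vs_nonneg[OF that]] by linarith
  have inv_nonneg: "0 \<le> vphi_inv \<phi> (1 / t)" if t: "0 < t" "ereal t < time_bound \<phi> x0" for t
    using inv_le[OF t] u_props(1)[OF t] K by (smt (verit) mult_nonneg_nonpos)
  have combine: "ereal q \<le> ereal C' * min (ereal (vphi_inv \<phi> (1 / t))) (ereal t * eta \<phi> x0 s)"
    if t: "0 < t" "ereal t < time_bound \<phi> x0" and q: "q \<le> C * K * vphi_inv \<phi> (1 / t)"
      "s \<noteq> 0 \<Longrightarrow> q \<le> 16 * C * (t * (g (1 / s) / s))" and s: "0 \<le> s" for q t s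
  proof -
    have q1: "q \<le> C' * vphi_inv \<phi> (1 / t)"
      using q(1) mult_right_mono[OF C'(2) inv_nonneg[OF t]] by linarith
    show ?thesis
    proof (cases "s = 0")
      case True
      \<comment> \<open>At \<open>s = 0\<close> the function \<open>eta\<close> is infinite, so the
        minimum is its first term.\<close>
      then show ?thesis using q1 t by (simp add: eta_def min_def)
    next
      case False
      then have s0: "0 < s" using s by simp
      have "0 \<le> t * (g (1 / s) / s)" using g_nonneg[of "1 / s"] s0 t by simp
      then have "q \<le> C' * (t * (g (1 / s) / s))"
        using q(2)[OF False] mult_right_mono[OF C'(3)] by fastforce
      then show ?thesis using q1 by (simp add: eta_g[OF s0] min_def)
    qed
  qed

  \<comment> \<open>The two bounds: centred at the truncated drift, and at the drift
    \<open>b\<close>\<close>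
  show ?thesis
  proof (intro exI[of _ p] conjI cont exI[of _ C'] allI impI C'(1))
    fix t x :: real assume t: "0 < t \<and> ereal t < time_bound \<phi> x0"
    then have t': "0 < t" "ereal t < time_bound \<phi> x0" by auto
    show "ereal (p t (x + t * trunc_drift b \<nu> (1 / psi_inv \<psi> (1 / t))))
           \<le> ereal C' * min (ereal (vphi_inv \<phi> (1 / t))) (ereal t * eta \<phi> x0 \<bar>x\<bar>)"
    proof (rule combine[OF t'])
      show "p t (x + t * trunc_drift b \<nu> (1 / psi_inv \<psi> (1 / t))) \<le> C * K * vphi_inv \<phi> (1 / t)"
        using bound[OF t'] by blast
      assume x: "\<bar>x\<bar> \<noteq> 0"
      have le16: "q \<le> 16 * z" if "0 \<le> z" "q \<le> z" for q z :: real using that by linarith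
      have "0 \<le> C * (t * (g (1 / \<bar>x\<bar>) / \<bar>x\<bar>))" using g_nonneg[of "1 / \<bar>x\<bar>"] x t' C(1) by simp
      moreover have "x \<noteq> 0" using x by simp
      then have "p t (x + t * trunc_drift b \<nu> (1 / psi_inv \<psi> (1 / t))) \<le> C * (t * (g (1 / \<bar>x\<bar>) / \<bar>x\<bar>))"
        using bound[OF t', of x] by blast
      ultimately show "p t (x + t * trunc_drift b \<nu> (1 / psi_inv \<psi> (1 / t))) \<le> 16 * C * (t * (g (1 / \<bar>x\<bar>) / \<bar>x\<bar>))"
        unfolding mult.assoc by (rule le16)
    qed simp
  next
    fix t x :: real
    assume "0 < t \<and> ereal t < time_bound \<phi> x0 \<and> 2 * exp 1 * t * deriv \<phi> (psi_inv \<psi> (1 / t)) \<le> x"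
    then have t': "0 < t" "ereal t < time_bound \<phi> x0"
      and x: "2 * exp 1 * t * deriv \<phi> (psi_inv \<psi> (1 / t)) \<le> x" by auto
    define u where "u = psi_inv \<psi> (1 / t)"
    have u: "0 < u" using u_props[OF t'] by (simp add: u_def)
    define \<beta> where "\<beta> = (LINT s|lborel. k s * (indicator {..<1 / u} s * s))"
    have \<beta>: "0 \<le> \<beta>" "\<beta> \<le> exp 1 * P 1 u" unfolding \<beta>_def using integral_truncated_le[OF u] by auto
    have x2: "2 * (t * (exp 1 * P 1 u)) \<le> x"
    proof -
      have "2 * exp 1 * t * P 1 u \<le> 2 * exp 1 * t * (b + P 1 u)"
        using b t' by (intro mult_left_mono) auto
      then show ?thesis using x dphi(1)[OF u] by (simp add: u_def[symmetric] mult_ac)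
    qed
    \<comment> \<open>Strict positivity gives \<open>0 < x\<close> even if \<open>b = 0\<close>, so
      that \<open>eta\<close> is finite at \<open>x\<close>.\<close>
    have P1: "0 < P 1 u" by (rule P_pos[of 2 u]) (use P2[OF u] u in auto)
    have x0': "0 < x" using x2 mult_pos_pos[OF t'(1) mult_pos_pos[OF exp_gt_zero[of 1] P1]] by linarith
    define x' where "x' = x - t * \<beta>"
    have "t * \<beta> \<le> t * (exp 1 * P 1 u)" using \<beta> t' by (intro mult_left_mono) auto
    \<comment> \<open>The hypothesis on \<open>x\<close> says that \<open>t * \<beta>\<close> is at
      most half of \<open>x\<close>, so recentring from \<open>b\<close> to the truncated drift
      keeps at least half of the distance.\<close>
    then have x': "x / 2 \<le> x'" "0 < x'" using x2 x0' unfolding x'_def by linarith+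
    have eq: "x + t * b = x' + t * trunc_drift b \<nu> (1 / psi_inv \<psi> (1 / t))"
      unfolding drift x'_def \<beta>_def u_def by (simp add: algebra_simps)
    show "ereal (p t (x + t * b)) \<le> ereal C' * min (ereal (vphi_inv \<phi> (1 / t))) (ereal t * eta \<phi> x0 x)"
    proof (rule combine[OF t'])
      show "p t (x + t * b) \<le> C * K * vphi_inv \<phi> (1 / t)" unfolding eq using bound[OF t'] by blast
      have "p t (x + t * b) \<le> C * (t * (g (1 / x') / x'))" unfolding eq using bound[OF t', of x'] x' by simp
      also have "\<dots> \<le> C * (t * (8 * g (1 / x) / (x / 2)))"
      proof -
        have "g (1 / x') \<le> g (2 * (1 / x))" using x' x0' by (intro g_mono) (auto simp: field_simps)
        also have "\<dots> \<le> 8 * g (1 / x)" using x0' by (intro g_double) auto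
        finally have "g (1 / x') / x' \<le> 8 * g (1 / x) / (x / 2)"
          using x' x0' g_nonneg[of "1 / x"] by (intro frac_le) auto
        then show ?thesis using C(1) t' by (intro mult_left_mono) auto
      qed
      also have "\<dots> = 16 * C * (t * (g (1 / x) / x))" by simp
      finally show "p t (x + t * b) \<le> 16 * C * (t * (g (1 / x) / x))" .
    qed (use x0' in simp)
  qed
qed

end
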